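(* Let $f:\mathbb{R}\to\mathbb{R}$ be continuous with $f(s)=0$ for $s\le 0$, and assume: (1) $f(0)=0$, $f(s)>0$ for $s>0$, and there exists $p\in(2,4)$ such that $0<\liminf_{s\to0^+}\frac{f(s)}{s^{p-1}}\le\limsup_{s\to0^+}\frac{f(s)}{s^{p-1}}<+\infty$; (2) there exists $\alpha_0>0$ such that $\lim_{s\to+\infty}f(s)e^{-\alpha s^2}=0$ for every $\alpha>\alpha_0$ and $\lim_{s\to+\infty}f(s)e^{-\alpha s^2}=+\infty$ for every $\alpha<\alpha_0$; (3) $\lim_{s\to+\infty}\frac{F(s)}{f(s)s}=0$. For $c\in(0,c_0)$ let $u_c$ be the local minimizer of $I|_{S_c}$ described in the context. Then, provided $c_0>0$ is sufficiently small (that is, after possibly replacing $c_0$ by a smaller positive number), for every $c\in(0,c_0)$ the function $u_c$ is a normalized ground state solution, i.e. $$I(u_c)=\min\{I(u):u\in S_c,\ (I|_{S_c})'(u)=0\}.$$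
   Context: $F(s)=\int_0^s f(\tau)\,d\tau$. $I:H^1(\mathbb{R}^2)\to\mathbb{R}$, $I(u)=\frac12\|\nabla u\|_2^2-\int_{\mathbb{R}^2}F(u)\,dx$. $S_c=\{u\in H^1(\mathbb{R}^2):\|u\|_2^2=c^2\}$. The condition $(I|_{S_c})'(u)=0$ means that $u\in S_c$ and there is $\lambda\in\mathbb{R}$ with $-\Delta u+\lambda u=f(u)$ weakly in $\mathbb{R}^2$. The local minimizer $u_c$: under (1)-(2) one can fix $c_0>0$, $\rho^*\in(0,4\pi/\alpha_0)$ and $\tau_0>0$ such that for all $c\in(0,c_0)$, with $V_c=\{u\in S_c:\|\nabla u\|_2^2<\rho^*\}$ and $\partial V_c=\{u\in S_c:\|\nabla u\|_2^2=\rho^*\}$, one has $m_c:=\inf_{V_c}I<0<\tau_0<\inf_{\partial V_c}I$, and $m_c$ is attained by a positive radially symmetric decreasing function $u_c\in V_c$, which solves $-\Delta u_c+\lambda_cu_c=f(u_c)$ for some $\lambda_c>0$. *)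

theory Defs
  imports "HOL-Analysis.Analysis"
begin

text \<open>
  Elements of \<open>H\<^sup>1\<close> are represented by Lebesgue measurable functions rather than by classes
  modulo null sets. The weak gradient is unique only almost everywhere; \<open>wgrad\<close> chooses
  one version of it.
\<close>

definition grad :: "(real^2 \<Rightarrow> real) \<Rightarrow> real^2 \<Rightarrow> real^2" where
  "grad \<phi> x = (\<chi> i. frechet_derivative \<phi> (at x) (axis i 1))"

primrec Ck :: "nat \<Rightarrow> (real^2 \<Rightarrow> real) \<Rightarrow> bool" where
  "Ck 0 \<phi> \<longleftrightarrow> continuous_on UNIV \<phi>"
| "Ck (Suc k) \<phi> \<longleftrightarrow> (\<forall>x. \<phi> differentiable (at x)) \<and> (\<forall>i. Ck k (\<lambda>x. grad \<phi> x $ i))"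

definition test_fun :: "(real^2 \<Rightarrow> real) \<Rightarrow> bool" where
  "test_fun \<phi> \<longleftrightarrow> (\<forall>k. Ck k \<phi>) \<and> compact (closure {x. \<phi> x \<noteq> 0})"

definition sq_integrable :: "(real^2 \<Rightarrow> 'b::euclidean_space) \<Rightarrow> bool" where
  "sq_integrable g \<longleftrightarrow> g \<in> borel_measurable lebesgue \<and> integrable lebesgue (\<lambda>x. (norm (g x))\<^sup>2)"

definition sq_norm :: "(real^2 \<Rightarrow> 'b::euclidean_space) \<Rightarrow> real" where
  "sq_norm g = (LINT x|lebesgue. (norm (g x))\<^sup>2)"

definition is_weak_grad :: "(real^2 \<Rightarrow> real) \<Rightarrow> (real^2 \<Rightarrow> real^2) \<Rightarrow> bool" where
  "is_weak_grad u g \<longleftrightarrow>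
     (\<forall>\<phi>. test_fun \<phi> \<longrightarrow>
        (LINT x|lebesgue. u x *\<^sub>R grad \<phi> x) = - (LINT x|lebesgue. \<phi> x *\<^sub>R g x))"

definition H1 :: "(real^2 \<Rightarrow> real) set" where
  "H1 = {u. sq_integrable u \<and> (\<exists>g. sq_integrable g \<and> is_weak_grad u g)}"

definition wgrad :: "(real^2 \<Rightarrow> real) \<Rightarrow> real^2 \<Rightarrow> real^2" where
  "wgrad u = (SOME g. sq_integrable g \<and> is_weak_grad u g)"

definition F :: "(real \<Rightarrow> real) \<Rightarrow> real \<Rightarrow> real" where
  "F f s = (LBINT \<tau>=ereal 0..ereal s. f \<tau>)"

definition I :: "(real \<Rightarrow> real) \<Rightarrow> (real^2 \<Rightarrow> real) \<Rightarrow> real" where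
  "I f u = 1/2 * sq_norm (wgrad u) - (LINT x|lebesgue. F f (u x))"

definition S :: "real \<Rightarrow> (real^2 \<Rightarrow> real) set" where
  "S c = {u \<in> H1. sq_norm u = c\<^sup>2}"

text \<open>
  The equation \<open>- \<Delta> u + lam u = f(u)\<close> in the sense of distributions. For \<open>f\<close> of critical exponential
  growth and \<open>u\<close> in \<open>H1\<close>, integrability of \<open>f (u x) * \<phi> x\<close> follows from the Trudinger-Moser inequality.
\<close>

definition weak_solution :: "(real \<Rightarrow> real) \<Rightarrow> real \<Rightarrow> (real^2 \<Rightarrow> real) \<Rightarrow> bool" where
  "weak_solution f lam u \<longleftrightarrow>
     (\<forall>\<phi>. test_fun \<phi> \<longrightarrow>
        (LINT x|lebesgue. wgrad u x \<bullet> grad \<phi> x) + lam * (LINT x|lebesgue. u x * \<phi> x)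
          = (LINT x|lebesgue. f (u x) * \<phi> x))"

definition constrained_critical :: "(real \<Rightarrow> real) \<Rightarrow> real \<Rightarrow> (real^2 \<Rightarrow> real) \<Rightarrow> bool" where
  "constrained_critical f c u \<longleftrightarrow> u \<in> S c \<and> (\<exists>lam. weak_solution f lam u)"

definition normalized_ground_state :: "(real \<Rightarrow> real) \<Rightarrow> real \<Rightarrow> (real^2 \<Rightarrow> real) \<Rightarrow> bool" where
  "normalized_ground_state f c u \<longleftrightarrow>
     constrained_critical f c u \<and> (\<forall>v. constrained_critical f c v \<longrightarrow> I f u \<le> I f v)"

definition V :: "real \<Rightarrow> real \<Rightarrow> (real^2 \<Rightarrow> real) set" where
  "V \<rho> c = {u \<in> S c. sq_norm (wgrad u) < \<rho>}"

definition bdV :: "real \<Rightarrow> real \<Rightarrow> (real^2 \<Rightarrow> real) set" where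
  "bdV \<rho> c = {u \<in> S c. sq_norm (wgrad u) = \<rho>}"

text \<open>
  Infima are taken in the extended reals, since the infimum of a set of reals that is
  empty or not bounded below is unspecified.
\<close>

definition m :: "(real \<Rightarrow> real) \<Rightarrow> real \<Rightarrow> real \<Rightarrow> ereal" where
  "m f \<rho> c = (INF u\<in>V \<rho> c. ereal (I f u))"

definition radially_decreasing :: "(real^2 \<Rightarrow> real) \<Rightarrow> bool" where
  "radially_decreasing u \<longleftrightarrow>
     (\<forall>x y. norm x = norm y \<longrightarrow> u x = u y) \<and> (\<forall>x y. norm x \<le> norm y \<longrightarrow> u y \<le> u x)"

definition local_minimizer :: "(real \<Rightarrow> real) \<Rightarrow> real \<Rightarrow> real \<Rightarrow> (real^2 \<Rightarrow> real) \<Rightarrow> bool" where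
  "local_minimizer f \<rho> c u \<longleftrightarrow>
     u \<in> V \<rho> c \<and> ereal (I f u) = m f \<rho> c \<and>
     (\<forall>x. u x > 0) \<and> radially_decreasing u \<and> (\<exists>lam>0. weak_solution f lam u)"

definition local_min_geometry ::
    "(real \<Rightarrow> real) \<Rightarrow> real \<Rightarrow> real \<Rightarrow> real \<Rightarrow> real \<Rightarrow> bool" where
  "local_min_geometry f \<alpha>\<^sub>0 c\<^sub>0 \<rho> \<tau>\<^sub>0 \<longleftrightarrow>
     0 < c\<^sub>0 \<and> 0 < \<rho> \<and> \<rho> < 4 * pi / \<alpha>\<^sub>0 \<and> 0 < \<tau>\<^sub>0 \<and>
     (\<forall>c. 0 < c \<and> c < c\<^sub>0 \<longrightarrow>
        m f \<rho> c < 0 \<and> ereal \<tau>\<^sub>0 < (INF u\<in>bdV \<rho> c. ereal (I f u)) \<and>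
        (\<exists>u. local_minimizer f \<rho> c u))"

end

theory Submission
  imports Defs
begin

text \<open>
  Let \<open>v\<close> be a constrained critical point with \<open>I(v) < I(u\<^sub>c) = m\<^sub>c < 0\<close>. Then \<open>v\<close> is not in \<open>V\<^sub>c\<close>, so its
  squared gradient norm \<open>D\<close> is at least \<open>\<rho>\<close>. The Nehari identity \<open>D + \<lambda>c\<^sup>2 = \<integral>f(v)v\<close>, the Pohozaev
  identity \<open>\<lambda>c\<^sup>2 = 2\<integral>F(v)\<close> and the bound \<open>F(s) \<le> Cs\<^sup>2 + f(s)s/8\<close>, which comes from the behaviour of
  \<open>f\<close> at zero and from \<open>F(s)/(f(s)s) \<rightarrow> 0\<close>, give \<open>I(v) \<ge> D/3 - 4Cc\<^sup>2/3\<close>. This is nonnegative for small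
  \<open>c\<close>, a contradiction.

  Both identities need \<open>f(v)\<close> to be square integrable, that is, \<open>exp(\<beta>v\<^sup>2)\<close> to be integrable where \<open>v\<close>
  is large, for all \<open>\<beta>\<close>. This follows from the inequality
  \<open>\<integral>w\<^sup>2 \<le> \<integral>\<bar>\<partial>\<^sub>1w\<bar> \<integral>\<bar>\<partial>\<^sub>2w\<bar>\<close>, applied to truncations of \<open>v\<close> between the levels \<open>a + \<surd>n\<close> and
  \<open>a + \<surd>(n+1)\<close>: the measures of the superlevel sets decay geometrically in \<open>n\<close>, with a ratio that is
  as small as desired if \<open>a\<close> is large. No regularity theory is needed for the Pohozaev identity, since
  the equation is tested with \<open>\<eta> * (X \<cdot> \<nabla>(\<eta> * v))\<close> for an even mollifier \<open>\<eta>\<close> and a vector field \<open>X\<close>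
  of compact support that then tends to the dilation field.
\<close>

section \<open>Smooth functions and test functions\<close>

text \<open>Nothing bounds the gradient of a competitor \<open>v\<close> from above, so an estimate
  whose constants depend on that gradient would be useless. Exponential integrability therefore
  supplies only the finiteness of the integrals in the two identities. The estimate itself is linear
  algebra in \<open>D\<close> and the integrals of \<open>f(v)v\<close> and \<open>F(v)\<close>,
  with a constant \<open>C\<close> that depends on \<open>f\<close> alone, so one threshold for
  \<open>c\<close> serves all critical points.

  Every exponent is admissible because \<open>v\<close> is fixed: the gradient energy over the set
  where \<open>v\<close> is at least \<open>a\<close> tends to 0 as \<open>a\<close> grows, and up
  to a factor 16 this energy is the ratio of the decay. With levels spaced like square roots,
  \<open>n\<close> steps reach a height of order sqrt(n), where exp(beta v^2) is at most of order
  exp(2 beta n), which a small ratio beats.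

  The Pohozaev multiplier X . grad v is merely square integrable, while the equation is known for
  test functions only. An even mollifier acts as a self-adjoint operator, so mollifying the test
  function amounts to mollifying the equation.\<close>

definition pd :: "2 \<Rightarrow> (real^2 \<Rightarrow> real) \<Rightarrow> real^2 \<Rightarrow> real" where
  "pd i \<phi> = (\<lambda>x. grad \<phi> x $ i)"

definition smooth :: "(real^2 \<Rightarrow> real) \<Rightarrow> bool" where
  "smooth \<phi> \<longleftrightarrow> (\<forall>k. Ck k \<phi>)"

lemma pd_eqI: "(\<phi> has_derivative D) (at x) \<Longrightarrow> pd i \<phi> x = D (axis i 1)"
  by (simp add: pd_def grad_def frechet_derivative_at[symmetric])

lemma has_derivative_pd:
  assumes "\<phi> differentiable (at x)"
  shows "(\<phi> has_derivative (\<lambda>h. \<Sum>i\<in>UNIV. pd i \<phi> x * h $ i)) (at x)"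
proof -
  let ?D = "frechet_derivative \<phi> (at x)"
  have D: "(\<phi> has_derivative ?D) (at x)"
    using assms frechet_derivative_works by blast
  then have lin: "linear ?D" by (rule has_derivative_linear)
  have "?D = (\<lambda>h. \<Sum>i\<in>UNIV. pd i \<phi> x * h $ i)"
  proof
    fix h :: "real^2"
    have "?D h = ?D (\<Sum>i\<in>UNIV. (h $ i) *\<^sub>R axis i 1)"
      using basis_expansion[of h] by (simp add: scalar_mult_eq_scaleR)
    also have "\<dots> = (\<Sum>i\<in>UNIV. h $ i * pd i \<phi> x)"
      by (simp add: linear_sum[OF lin] linear_scale[OF lin] pd_def grad_def)
    finally show "?D h = (\<Sum>i\<in>UNIV. pd i \<phi> x * h $ i)" by (simp add: mult.commute)
  qed
  with D show ?thesis by simp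
qed

lemma Ck_Suc_pd: "Ck (Suc k) \<phi> \<longleftrightarrow> (\<forall>x. \<phi> differentiable (at x)) \<and> (\<forall>i. Ck k (pd i \<phi>))"
  by (simp add: pd_def)

declare Ck.simps(2) [simp del]

lemma Ck_SucD: "Ck (Suc k) \<phi> \<Longrightarrow> Ck k \<phi>"
proof (induction k arbitrary: \<phi>)
  case 0
  then show ?case
    by (auto simp: Ck_Suc_pd intro: continuous_at_imp_continuous_on differentiable_imp_continuous_within)
qed (auto simp: Ck_Suc_pd)

lemma pd_const [simp]: "pd i (\<lambda>x. c) = (\<lambda>x. 0)"
  by (rule ext, subst pd_eqI[of _ "\<lambda>h. 0"]) auto

lemma Ck_const: "Ck k (\<lambda>x. c)"
  by (induction k arbitrary: c) (auto simp: Ck_Suc_pd)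

lemma pd_add:
  assumes "\<phi> differentiable (at x)" "\<psi> differentiable (at x)"
  shows "pd i (\<lambda>x. \<phi> x + \<psi> x) x = pd i \<phi> x + pd i \<psi> x"
  by (subst pd_eqI[OF has_derivative_add[OF has_derivative_pd has_derivative_pd]])
     (use assms in \<open>auto simp: axis_def if_distrib[of "\<lambda>t. _ * t"] cong: if_cong\<close>)

lemma pd_mult:
  assumes "\<phi> differentiable (at x)" "\<psi> differentiable (at x)"
  shows "pd i (\<lambda>x. \<phi> x * \<psi> x) x = \<phi> x * pd i \<psi> x + pd i \<phi> x * \<psi> x"
  by (subst pd_eqI[OF has_derivative_mult[OF has_derivative_pd has_derivative_pd]])
     (use assms in \<open>auto simp: axis_def if_distrib[of "\<lambda>t. _ * t"] cong: if_cong\<close>)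

lemma pd_affine:
  fixes b :: "real^2"
  assumes "\<And>x. \<phi> differentiable (at x)"
  shows "pd i (\<lambda>x. \<phi> (a *\<^sub>R x + b)) x = a * pd i \<phi> (a *\<^sub>R x + b)"
proof -
  have "((\<lambda>x. \<phi> (a *\<^sub>R x + b)) has_derivative
      (\<lambda>h. \<Sum>i\<in>UNIV. pd i \<phi> (a *\<^sub>R x + b) * (a *\<^sub>R h) $ i)) (at x)"
    by (rule has_derivative_compose[OF _ has_derivative_pd[OF assms]])
       (auto intro!: derivative_eq_intros)
  from pd_eqI[OF this] show ?thesis
    by (simp add: axis_def if_distrib[of "\<lambda>t. _ * t"] cong: if_cong)
qed

lemma pd_chain:
  assumes "\<phi> differentiable (at x)" "(h has_real_derivative D) (at (\<phi> x))"
  shows "(\<lambda>x. h (\<phi> x)) differentiable (at x)" "pd i (\<lambda>x. h (\<phi> x)) x = D * pd i \<phi> x"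
proof -
  have *: "((\<lambda>x. h (\<phi> x)) has_derivative (\<lambda>k. D * (\<Sum>i\<in>UNIV. pd i \<phi> x * k $ i))) (at x)"
    by (rule has_derivative_compose[OF has_derivative_pd[OF assms(1)]])
       (use assms(2) in \<open>simp add: has_field_derivative_def\<close>)
  show "(\<lambda>x. h (\<phi> x)) differentiable (at x)"
    using * by (rule differentiableI)
  from pd_eqI[OF *] show "pd i (\<lambda>x. h (\<phi> x)) x = D * pd i \<phi> x"
    by (simp add: axis_def if_distrib[of "\<lambda>t. _ * t"] cong: if_cong)
qed

lemma Ck_add: "Ck k \<phi> \<Longrightarrow> Ck k \<psi> \<Longrightarrow> Ck k (\<lambda>x. \<phi> x + \<psi> x)"
proof (induction k arbitrary: \<phi> \<psi>)
  case 0
  then show ?case by (auto intro: continuous_on_add)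
next
  case (Suc k)
  then have "pd i (\<lambda>x. \<phi> x + \<psi> x) = (\<lambda>x. pd i \<phi> x + pd i \<psi> x)" for i
    by (auto simp: Ck_Suc_pd pd_add)
  with Suc show ?case by (auto simp: Ck_Suc_pd)
qed

lemma Ck_mult: "Ck k \<phi> \<Longrightarrow> Ck k \<psi> \<Longrightarrow> Ck k (\<lambda>x. \<phi> x * \<psi> x)"
proof (induction k arbitrary: \<phi> \<psi>)
  case 0
  then show ?case by (auto intro: continuous_on_mult)
next
  case (Suc k)
  then have "pd i (\<lambda>x. \<phi> x * \<psi> x) = (\<lambda>x. \<phi> x * pd i \<psi> x + pd i \<phi> x * \<psi> x)" for i
    by (auto simp: Ck_Suc_pd pd_mult)
  with Suc show ?case
    using Ck_SucD[OF Suc.prems(1)] Ck_SucD[OF Suc.prems(2)]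
    by (auto simp: Ck_Suc_pd intro!: Ck_add)
qed

lemma Ck_affine: "Ck k \<phi> \<Longrightarrow> Ck k (\<lambda>x. \<phi> (a *\<^sub>R x + b))"
proof (induction k arbitrary: \<phi>)
  case 0
  then show ?case
    by (auto intro!: continuous_on_compose2[of UNIV \<phi>] continuous_intros)
next
  case (Suc k)
  then have diff: "\<phi> differentiable (at x)" for x by (simp add: Ck_Suc_pd)
  have "(\<lambda>x. \<phi> (a *\<^sub>R x + b)) differentiable (at x)" for x
    by (rule differentiable_chain_at[of "\<lambda>x. a *\<^sub>R x + b" x \<phi>, unfolded o_def])
       (auto intro: diff)
  moreover have "pd i (\<lambda>x. \<phi> (a *\<^sub>R x + b)) = (\<lambda>x. a * pd i \<phi> (a *\<^sub>R x + b))" for i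
    by (auto simp: pd_affine diff)
  ultimately show ?case
    using Suc by (auto simp: Ck_Suc_pd intro!: Ck_mult Ck_const)
qed

lemma pd_coord [simp]: "pd i (\<lambda>x. x $ j) = (\<lambda>x. if i = j then 1 else 0)"
  by (rule ext, subst pd_eqI[of _ "\<lambda>h. h $ j"])
     (auto simp: axis_def intro!: bounded_linear_imp_has_derivative bounded_linear_vec_nth)

lemma Ck_coord: "Ck k (\<lambda>x. x $ j)"
  by (cases k) (auto simp: Ck_Suc_pd intro!: Ck_const continuous_intros bounded_linear_imp_differentiable bounded_linear_vec_nth)

lemma smooth_const [simp, intro]: "smooth (\<lambda>x. c)"
  and smooth_coord [simp, intro]: "smooth (\<lambda>x. x $ j)"
  and smooth_add [intro]: "smooth \<phi> \<Longrightarrow> smooth \<psi> \<Longrightarrow> smooth (\<lambda>x. \<phi> x + \<psi> x)"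
  and smooth_mult [intro]: "smooth \<phi> \<Longrightarrow> smooth \<psi> \<Longrightarrow> smooth (\<lambda>x. \<phi> x * \<psi> x)"
  and smooth_affine: "smooth \<phi> \<Longrightarrow> smooth (\<lambda>x. \<phi> (a *\<^sub>R x + b))"
  by (auto simp: smooth_def intro: Ck_const Ck_coord Ck_add Ck_mult Ck_affine)

lemma smooth_sum [intro]:
  "(\<And>i. i \<in> A \<Longrightarrow> smooth (\<phi> i)) \<Longrightarrow> smooth (\<lambda>x. \<Sum>i\<in>A. \<phi> i x)"
  by (induction A rule: infinite_finite_induct) auto

lemma smooth_pd [intro]: "smooth \<phi> \<Longrightarrow> smooth (pd i \<phi>)"
  unfolding smooth_def using Ck_Suc_pd by blast

lemma smooth_differentiable [intro]: "smooth \<phi> \<Longrightarrow> \<phi> differentiable (at x)"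
  unfolding smooth_def using Ck_Suc_pd[of 0] by blast

lemma smooth_continuous [intro]: "smooth \<phi> \<Longrightarrow> continuous_on A \<phi>"
  unfolding smooth_def by (metis Ck.simps(1) continuous_on_subset subset_UNIV)

lemma smooth_measurable [measurable_dest]: "smooth \<phi> \<Longrightarrow> \<phi> \<in> borel_measurable borel"
  by (intro borel_measurable_continuous_onI) auto

lemma pd_sum:
  "(\<And>i. i \<in> A \<Longrightarrow> smooth (\<phi> i)) \<Longrightarrow> pd j (\<lambda>x. \<Sum>i\<in>A. \<phi> i x) x = (\<Sum>i\<in>A. pd j (\<phi> i) x)"
  by (induction A rule: infinite_finite_induct) (auto simp: pd_add smooth_differentiable smooth_sum)

text \<open>Closed bounded sets are compact here, so compact support is handled through a radius
  beyond which the function vanishes.\<close>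

lemma test_fun_iff: "test_fun \<phi> \<longleftrightarrow> smooth \<phi> \<and> (\<exists>R. \<forall>x. norm x > R \<longrightarrow> \<phi> x = 0)"
proof -
  have "bounded {x. \<phi> x \<noteq> 0} \<longleftrightarrow> (\<exists>R. \<forall>x. norm x > R \<longrightarrow> \<phi> x = 0)"
    unfolding bounded_iff by (metis (mono_tags, lifting) linorder_not_less mem_Collect_eq)
  then show ?thesis
    by (simp add: test_fun_def smooth_def compact_closure)
qed

lemma pd_eq_0_outside:
  assumes "\<And>x. norm x > R \<Longrightarrow> \<phi> x = 0" "norm x > R"
  shows "pd i \<phi> x = 0"
proof -
  have "(\<phi> has_derivative (\<lambda>h. 0)) (at x)"
  proof (rule has_derivative_transform_within_open)
    show "open {x::real^2. norm x > R}" by (intro open_Collect_less continuous_intros)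
  qed (use assms in \<open>auto intro: derivative_intros\<close>)
  from pd_eqI[OF this] show ?thesis by simp
qed

lemma test_fun_smooth: "test_fun \<phi> \<Longrightarrow> smooth \<phi>"
  by (simp add: test_fun_iff)

lemma test_fun_pd: "test_fun \<phi> \<Longrightarrow> test_fun (pd i \<phi>)"
  unfolding test_fun_iff using pd_eq_0_outside smooth_pd by metis

lemma test_fun_mult: "test_fun \<phi> \<Longrightarrow> smooth \<psi> \<Longrightarrow> test_fun (\<lambda>x. \<phi> x * \<psi> x)"
  unfolding test_fun_iff by fastforce

lemma test_fun_add:
  assumes "test_fun \<phi>" "test_fun \<psi>" shows "test_fun (\<lambda>x. \<phi> x + \<psi> x)"
proof -
  obtain R1 R2 where "\<And>x. norm x > R1 \<Longrightarrow> \<phi> x = 0" "\<And>x. norm x > R2 \<Longrightarrow> \<psi> x = 0"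
    using assms unfolding test_fun_iff by auto
  then have "\<forall>x. norm x > max R1 R2 \<longrightarrow> \<phi> x + \<psi> x = 0" by simp
  with assms show ?thesis unfolding test_fun_iff by blast
qed

lemma test_fun_sum:
  "(\<And>i. i \<in> A \<Longrightarrow> test_fun (\<phi> i)) \<Longrightarrow> test_fun (\<lambda>x. \<Sum>i\<in>A. \<phi> i x)"
  by (induction A rule: infinite_finite_induct)
     (auto simp: test_fun_add, auto simp: test_fun_iff)

lemma test_fun_affine:
  assumes "test_fun \<phi>" "a \<noteq> 0" shows "test_fun (\<lambda>x. \<phi> (a *\<^sub>R x + b))"
proof -
  obtain R where R: "\<And>x. norm x > R \<Longrightarrow> \<phi> x = 0" and "smooth \<phi>"
    using assms unfolding test_fun_iff by auto
  have "\<phi> (a *\<^sub>R x + b) = 0" if "norm x > (R + norm b) / \<bar>a\<bar>" for x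
  proof (rule R)
    have "R + norm b < \<bar>a\<bar> * norm x"
      using that assms(2) by (simp add: field_simps)
    also have "\<dots> \<le> norm (a *\<^sub>R x + b) + norm b"
      using norm_triangle_ineq4[of "a *\<^sub>R x + b" b] by simp
    finally show "R < norm (a *\<^sub>R x + b)" by simp
  qed
  then show ?thesis
    unfolding test_fun_iff using smooth_affine[OF \<open>smooth \<phi>\<close>] by blast
qed

lemma test_fun_bounded:
  assumes "test_fun \<phi>"
  obtains B where "B > 0" "\<And>x. \<bar>\<phi> x\<bar> \<le> B"
proof -
  obtain R where R: "\<And>x. norm x > R \<Longrightarrow> \<phi> x = 0" and "smooth \<phi>"
    using assms unfolding test_fun_iff by auto
  have "compact (\<phi> ` cball 0 R)"
    by (intro compact_continuous_image smooth_continuous \<open>smooth \<phi>\<close> compact_cball)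
  then obtain B where "B > 0" and B: "\<And>x. x \<in> cball 0 R \<Longrightarrow> \<bar>\<phi> x\<bar> \<le> B"
    using compact_imp_bounded[of "\<phi> ` cball 0 R"] unfolding bounded_pos by auto
  show ?thesis
    by (rule that[of B]) (use \<open>B > 0\<close> B R in \<open>force simp: not_le\<close>)+
qed

section \<open>A bump function\<close>

text \<open>The flat function exp(-1/t), multiplied by polynomials in 1/t so that the family is
  closed under differentiation. Smoothness is then one induction over the order, for all
  \<open>p\<close> at once.\<close>

definition exp_germ :: "real poly \<Rightarrow> real \<Rightarrow> real" where
  "exp_germ p t = (if t > 0 then poly p (1/t) * exp (- (1/t)) else 0)"

lemma poly_times_exp_neg_tendsto_0: "((\<lambda>s::real. poly p s * exp (- s)) \<longlongrightarrow> 0) at_top"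
proof -
  have "((\<lambda>s. \<Sum>i\<le>degree p. coeff p i * (s ^ i / exp s)) \<longlongrightarrow> (\<Sum>i\<le>degree p. coeff p i * 0)) at_top"
    by (intro tendsto_sum tendsto_mult tendsto_const tendsto_power_div_exp_0)
  then show ?thesis
    by (simp add: poly_altdef sum_distrib_right exp_minus divide_inverse mult.assoc)
qed

text \<open>With s = 1/t one has ds/dt = -s^2, so p(s) exp(-s) has derivative s^2 (p(s) - p'(s))
  exp(-s), and \<open>[:0,0,1:]\<close> is s^2. At t = 0 the right difference quotient is s p(s)
  exp(-s), which tends to 0 as s grows.\<close>

lemma exp_germ_deriv:
  "(exp_germ p has_real_derivative exp_germ ([:0,0,1:] * (p - pderiv p)) t) (at t)"
proof (cases t "0::real" rule: linorder_cases)
  case less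
  have "((\<lambda>t. 0) has_real_derivative 0) (at t)" by simp
  then show ?thesis
    unfolding exp_germ_def using less
    by (auto intro: has_field_derivative_transform_within_open[of "\<lambda>t. 0" 0 t "{..<0}"] )
next
  case greater
  have "((\<lambda>t. poly p (1/t) * exp (- (1/t))) has_real_derivative
      poly ([:0,0,1:] * (p - pderiv p)) (1/t) * exp (- (1/t))) (at t)"
    using greater
    by (auto intro!: derivative_eq_intros DERIV_chain2[OF poly_DERIV] simp: field_simps power2_eq_square)
  then show ?thesis
    using greater
    by (intro has_field_derivative_transform_within_open[of _ _ t "{0<..}" "exp_germ p"])
       (auto simp: exp_germ_def)
next
  case equal
  have "((\<lambda>h. exp_germ p h / h) \<longlongrightarrow> 0) (at_right 0)"
  proof -
    have "((\<lambda>h. poly (pCons 0 p) (inverse h) * exp (- inverse h)) \<longlongrightarrow> 0) (at_right (0::real))"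
      by (rule filterlim_compose[OF poly_times_exp_neg_tendsto_0 filterlim_inverse_at_top_right])
    then show ?thesis
      by (rule Lim_transform_eventually)
         (auto simp: exp_germ_def field_simps eventually_at_filter)
  qed
  moreover have "((\<lambda>h. exp_germ p h / h) \<longlongrightarrow> 0) (at_left 0)"
    by (rule Lim_transform_eventually[OF tendsto_const])
       (auto simp: exp_germ_def eventually_at_filter)
  ultimately show ?thesis
    unfolding equal DERIV_def
    by (simp add: exp_germ_def filterlim_at_split)
qed

text \<open>Symmetry of second derivatives is only needed for mollifiers, where it can be read off.\<close>

definition pd_commute :: "(real^2 \<Rightarrow> real) \<Rightarrow> bool" where
  "pd_commute \<phi> \<longleftrightarrow> (\<forall>i j. pd i (pd j \<phi>) = pd j (pd i \<phi>))"

lemma exp_germ_affine: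
  fixes j :: 2
  defines "g \<equiv> \<lambda>p a b (x::real^2). exp_germ p (a * x $ j + b)"
  shows "g p a b differentiable (at x)"
    and "pd i (g p a b) = (\<lambda>x. (if i = j then a else 0) * g ([:0,0,1:] * (p - pderiv p)) a b x)"
proof -
  have sm: "smooth (\<lambda>x::real^2. a * x $ j + b)" by (intro smooth_add smooth_mult) auto
  have "pd i (\<lambda>x::real^2. a * x $ j + b) x = (if i = j then a else 0)" for i x
    by (simp add: pd_add pd_mult smooth_differentiable smooth_mult)
  with pd_chain[OF smooth_differentiable[OF sm] exp_germ_deriv]
  show "g p a b differentiable (at x)"
    and "pd i (g p a b) = (\<lambda>x. (if i = j then a else 0) * g ([:0,0,1:] * (p - pderiv p)) a b x)"
    by (auto simp: g_def fun_eq_iff)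
qed

lemma smooth_exp_germ: "smooth (\<lambda>x. exp_germ p (a * x $ j + b))"
  unfolding smooth_def
proof
  fix k show "Ck k (\<lambda>x. exp_germ p (a * x $ j + b))"
  proof (induction k arbitrary: p)
    case 0
    show ?case
      using exp_germ_affine(1)[of p a j b]
      by (auto intro: continuous_at_imp_continuous_on differentiable_imp_continuous_within)
  next
    case (Suc k)
    show ?case
      unfolding Ck_Suc_pd using exp_germ_affine(1)[of p a j b]
      by (auto simp: exp_germ_affine(2) intro!: Ck_mult Ck_const Suc)
  qed
qed

text \<open>For a function of one coordinate, derivatives in two different directions vanish in
  either order.\<close>

lemma pd_commute_exp_germ: "pd_commute (\<lambda>x. exp_germ p (a * x $ j + b))"
  unfolding pd_commute_def exp_germ_affine(2)
  by (auto simp: fun_eq_iff pd_mult exp_germ_affine intro!: smooth_differentiable smooth_exp_germ)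

lemma pd_commute_mult:
  assumes "smooth \<phi>" "smooth \<psi>" "pd_commute \<phi>" "pd_commute \<psi>"
  shows "pd_commute (\<lambda>x. \<phi> x * \<psi> x)"
proof -
  note [simp] = smooth_differentiable[OF assms(1)] smooth_differentiable[OF assms(2)]
    smooth_differentiable[OF smooth_pd[OF assms(1)]] smooth_differentiable[OF smooth_pd[OF assms(2)]]
  have eq: "pd i (\<lambda>x. \<phi> x * \<psi> x) = (\<lambda>x. \<phi> x * pd i \<psi> x + pd i \<phi> x * \<psi> x)" for i
    by (simp add: pd_mult fun_eq_iff)
  have comm: "pd i (pd j \<phi>) x = pd j (pd i \<phi>) x" "pd i (pd j \<psi>) x = pd j (pd i \<psi>) x" for i j x
    using assms unfolding pd_commute_def by metis+
  show ?thesis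
    unfolding pd_commute_def eq
    by (auto simp: fun_eq_iff pd_add pd_mult comm[of _ _ ] assms smooth_differentiable smooth_mult smooth_pd)
qed

text \<open>Each coordinate contributes exp(-1/(1+t)) exp(-1/(1-t)), so the support is the square of
  half-width 1. A product of one-variable factors is chosen because its mixed derivatives visibly
  commute.\<close>

definition bump :: "real^2 \<Rightarrow> real" where
  "bump x = (exp_germ 1 (1 * x $ 1 + 1) * exp_germ 1 (-1 * x $ 1 + 1)) *
     (exp_germ 1 (1 * x $ 2 + 1) * exp_germ 1 (-1 * x $ 2 + 1))"

lemma bump:
  shows bump_smooth: "smooth bump" and bump_commute: "pd_commute bump"
    and bump_nonneg: "bump x \<ge> 0" and bump_even: "bump (- x) = bump x"
    and bump_0: "bump 0 > 0" and bump_outside: "norm x > 2 \<Longrightarrow> bump x = 0"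
proof -
  show "smooth bump"
    unfolding bump_def by (intro smooth_mult smooth_exp_germ)
  show "pd_commute bump"
    unfolding bump_def by (intro pd_commute_mult pd_commute_exp_germ smooth_mult smooth_exp_germ)
  show "bump x \<ge> 0" "bump (- x) = bump x" "bump 0 > 0"
    by (auto simp: bump_def exp_germ_def)
  assume "norm x > 2"
  \<comment> \<open>If both coordinates had modulus at most 1, the l1 norm would be at most 2; this
    is where the radius 2 comes from.\<close>
  moreover have "norm x \<le> \<bar>x $ 1\<bar> + \<bar>x $ 2\<bar>"
    using norm_le_l1_cart[of x] by (simp add: UNIV_2)
  ultimately have "\<bar>x $ 1\<bar> > 1 \<or> \<bar>x $ 2\<bar> > 1" by linarith
  then show "bump x = 0" by (auto simp: bump_def exp_germ_def abs_if split: if_splits)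
qed

lemma test_fun_bump: "test_fun bump"
  unfolding test_fun_iff using bump_smooth bump_outside by blast

section \<open>Square integrable functions\<close>

text \<open>Borel measurability and \<open>lborel\<close>, in contrast to
  \<open>sq_integrable\<close>, so that product measures and iterated integrals apply. The passage
  from Lebesgue functions is made once, in \<open>critical_point_energy\<close>.\<close>

definition L2 :: "('a::euclidean_space \<Rightarrow> real) \<Rightarrow> bool" where
  "L2 u \<longleftrightarrow> u \<in> borel_measurable borel \<and> integrable lborel (\<lambda>x. (u x)\<^sup>2)"

lemma L2_measurable [measurable_dest]: "L2 u \<Longrightarrow> u \<in> borel_measurable borel"
  by (simp add: L2_def)

lemma L2_square_integrable: "L2 u \<Longrightarrow> integrable lborel (\<lambda>x. (u x)\<^sup>2)"
  by (simp add: L2_def)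

lemma abs_mult_le_sum_squares: "\<bar>a * b\<bar> \<le> a\<^sup>2 + (b::real)\<^sup>2"
proof -
  have "0 \<le> (\<bar>a\<bar> - \<bar>b\<bar>)\<^sup>2" by simp
  then have "2 * (\<bar>a\<bar> * \<bar>b\<bar>) \<le> a\<^sup>2 + b\<^sup>2" by (simp add: power2_diff)
  moreover have "0 \<le> \<bar>a\<bar> * \<bar>b\<bar>" by simp
  ultimately show ?thesis unfolding abs_mult by linarith
qed

lemma square_add_le: "(a + b)\<^sup>2 \<le> 2 * a\<^sup>2 + 2 * (b::real)\<^sup>2"
  using zero_le_power2[of "a - b"] by (simp add: power2_sum power2_diff)

lemma L2_mult_integrable:
  assumes [measurable]: "L2 u" "L2 v"
  shows "integrable lborel (\<lambda>x. u x * v x)"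
proof (rule Bochner_Integration.integrable_bound)
  show "integrable lborel (\<lambda>x. (u x)\<^sup>2 + (v x)\<^sup>2)"
    using assms by (intro Bochner_Integration.integrable_add L2_square_integrable)
  show "(\<lambda>x. u x * v x) \<in> borel_measurable lborel" by measurable
qed (use abs_mult_le_sum_squares in \<open>auto simp del: abs_mult\<close>)

lemma L2_bound:
  assumes "L2 u" "v \<in> borel_measurable borel" "\<And>x. \<bar>v x\<bar> \<le> B * \<bar>u x\<bar>"
  shows "L2 v"
  unfolding L2_def
proof
  show "integrable lborel (\<lambda>x. (v x)\<^sup>2)"
  proof (rule Bochner_Integration.integrable_bound)
    show "integrable lborel (\<lambda>x. B\<^sup>2 * (u x)\<^sup>2)"
      using L2_square_integrable[OF assms(1)] by simp
    show "AE x in lborel. norm ((v x)\<^sup>2) \<le> norm (B\<^sup>2 * (u x)\<^sup>2)"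
      using power_mono[OF assms(3) abs_ge_zero, where n = 2] by (simp add: power_mult_distrib)
    show "(\<lambda>x. (v x)\<^sup>2) \<in> borel_measurable lborel" using assms(2) by measurable
  qed
qed fact

lemma L2_add:
  assumes [measurable]: "L2 u" "L2 v" shows "L2 (\<lambda>x. u x + v x)"
proof -
  have "integrable lborel (\<lambda>x. (u x)\<^sup>2 + (v x)\<^sup>2 + 2 * (u x * v x))"
    using assms by (intro Bochner_Integration.integrable_add integrable_mult_right L2_square_integrable L2_mult_integrable)
  then show ?thesis
    unfolding L2_def by (simp add: power2_sum mult.assoc)
qed

lemma L2_zero [simp]: "L2 (\<lambda>x. 0)"
  by (simp add: L2_def)

lemma L2_mult_bounded:
  assumes [measurable]: "L2 u" "b \<in> borel_measurable borel" and "\<And>x. \<bar>b x\<bar> \<le> B"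
  shows "L2 (\<lambda>x. b x * u x)"
  by (rule L2_bound[OF assms(1), of _ B]) (auto simp: abs_mult assms(3) mult_right_mono)

lemma L2_cmult: "L2 u \<Longrightarrow> L2 (\<lambda>x. c * u x)"
  by (rule L2_mult_bounded[of _ _ "\<bar>c\<bar>"]) auto

lemma L2_diff:
  assumes "L2 u" "L2 v" shows "L2 (\<lambda>x. u x - v x)"
  using L2_add[OF assms(1) L2_cmult[OF assms(2), of "-1"]] by simp

text \<open>The integral of (u + t v)^2 is a nonnegative quadratic A + 2tB + t^2 C. The minimizer t
  = -B/C gives the claim; if C = 0 and B were nonzero, t = -(A+1)/(2B) would produce the value
  -1.\<close>

lemma L2_Cauchy_Schwarz:
  assumes "L2 u" "L2 v"
  shows "(\<integral>x. u x * v x \<partial>lborel)\<^sup>2 \<le> (\<integral>x. (u x)\<^sup>2 \<partial>lborel) * (\<integral>x. (v x)\<^sup>2 \<partial>lborel)"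
proof -
  define A B C where "A = (\<integral>x. (u x)\<^sup>2 \<partial>lborel)" "B = (\<integral>x. u x * v x \<partial>lborel)"
    "C = (\<integral>x. (v x)\<^sup>2 \<partial>lborel)"
  note int = L2_square_integrable[OF assms(1)] L2_square_integrable[OF assms(2)]
    L2_mult_integrable[OF assms]
  have q: "0 \<le> A + 2 * t * B + t\<^sup>2 * C" for t
  proof -
    have "0 \<le> (\<integral>x. (u x + t * v x)\<^sup>2 \<partial>lborel)" by simp
    also have "(\<lambda>x. (u x + t * v x)\<^sup>2) = (\<lambda>x. (u x)\<^sup>2 + 2 * t * (u x * v x) + t\<^sup>2 * (v x)\<^sup>2)"
      by (auto simp: power2_sum power_mult_distrib)
    also have "(\<integral>x. (u x)\<^sup>2 + 2 * t * (u x * v x) + t\<^sup>2 * (v x)\<^sup>2 \<partial>lborel) = A + 2 * t * B + t\<^sup>2 * C"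
      using int by (simp add: A_B_C_def)
    finally show ?thesis .
  qed
  have "C \<ge> 0" "A \<ge> 0" by (simp_all add: A_B_C_def)
  show ?thesis
  proof (cases "C = 0")
    case True
    have "B = 0"
    proof (rule ccontr)
      assume "B \<noteq> 0"
      then show False using q[of "- (A + 1) / (2 * B)"] True by (simp add: field_simps)
    qed
    with True show ?thesis by (simp add: A_B_C_def[symmetric])
  next
    case False
    with \<open>C \<ge> 0\<close> have "C > 0" by simp
    then have "B\<^sup>2 \<le> A * C"
      using q[of "- B / C"] by (simp add: field_simps power2_eq_square)
    then show ?thesis by (simp add: A_B_C_def)
  qed
qed

lemma L2_square_add_le:
  assumes "L2 u" "L2 v"
  shows "(\<integral>x. (u x + v x)\<^sup>2 \<partial>lborel) \<le> 2 * (\<integral>x. (u x)\<^sup>2 \<partial>lborel) + 2 * (\<integral>x. (v x)\<^sup>2 \<partial>lborel)"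
proof -
  have "(\<integral>x. (u x + v x)\<^sup>2 \<partial>lborel) \<le> (\<integral>x. 2 * (u x)\<^sup>2 + 2 * (v x)\<^sup>2 \<partial>lborel)"
    using assms by (intro integral_mono L2_square_integrable L2_add square_add_le
      Bochner_Integration.integrable_add integrable_mult_right)
  then show ?thesis using L2_square_integrable[OF assms(1)] L2_square_integrable[OF assms(2)] by simp
qed

text \<open>Membership of all terms and of the limit is included: the integral of a nonintegrable
  function is 0 by default, so the limit alone would say nothing.\<close>

definition L2lim :: "(nat \<Rightarrow> 'a::euclidean_space \<Rightarrow> real) \<Rightarrow> ('a \<Rightarrow> real) \<Rightarrow> bool" where
  "L2lim U u \<longleftrightarrow> (\<forall>n. L2 (U n)) \<and> L2 u \<and> (\<lambda>n. \<integral>x. (U n x - u x)\<^sup>2 \<partial>lborel) \<longlonglongrightarrow> 0"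

lemma L2limD: "L2lim U u \<Longrightarrow> L2 (U n)" "L2lim U u \<Longrightarrow> L2 u"
  "L2lim U u \<Longrightarrow> (\<lambda>n. \<integral>x. (U n x - u x)\<^sup>2 \<partial>lborel) \<longlonglongrightarrow> 0"
  by (auto simp: L2lim_def)

lemma L2lim_const: "L2 u \<Longrightarrow> L2lim (\<lambda>n. u) u"
  by (simp add: L2lim_def)

lemma L2lim_mult_right:
  assumes "L2lim U u" "L2 v"
  shows "(\<lambda>n. \<integral>x. (U n x - u x) * v x \<partial>lborel) \<longlonglongrightarrow> 0"
proof -
  have "(\<lambda>n. (\<integral>x. (U n x - u x)\<^sup>2 \<partial>lborel) * (\<integral>x. (v x)\<^sup>2 \<partial>lborel)) \<longlonglongrightarrow> 0"
    using tendsto_mult_right[OF L2limD(3)[OF assms(1)]] by simp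
  then have "(\<lambda>n. (\<integral>x. (U n x - u x) * v x \<partial>lborel)\<^sup>2) \<longlonglongrightarrow> 0"
    by (rule Lim_null_comparison[rotated])
       (use assms in \<open>auto intro!: always_eventually L2_Cauchy_Schwarz L2_diff simp: L2lim_def\<close>)
  then show ?thesis by simp
qed

text \<open>UW - uv = (U-u)(W-v) + (U-u)v + (W-v)u, and each summand tends to 0 by
  Cauchy-Schwarz.\<close>

lemma L2lim_integral_mult:
  assumes "L2lim U u" "L2lim W v"
  shows "(\<lambda>n. \<integral>x. U n x * W n x \<partial>lborel) \<longlonglongrightarrow> (\<integral>x. u x * v x \<partial>lborel)"
proof -
  note L = L2limD[OF assms(1)] L2limD[OF assms(2)]
  have int: "integrable lborel (\<lambda>x. a x * b x)" if "L2 a" "L2 b" for a b :: "'a \<Rightarrow> real"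
    using that by (rule L2_mult_integrable)
  have "(\<lambda>n. \<integral>x. (U n x - u x) * (W n x - v x) \<partial>lborel) \<longlonglongrightarrow> 0"
  proof -
    have "(\<lambda>n. (\<integral>x. (U n x - u x)\<^sup>2 \<partial>lborel) * (\<integral>x. (W n x - v x)\<^sup>2 \<partial>lborel)) \<longlonglongrightarrow> 0"
      using tendsto_mult[OF L(3) L(6)] by simp
    then have "(\<lambda>n. (\<integral>x. (U n x - u x) * (W n x - v x) \<partial>lborel)\<^sup>2) \<longlonglongrightarrow> 0"
      by (rule Lim_null_comparison[rotated])
         (use L in \<open>auto intro!: always_eventually L2_Cauchy_Schwarz L2_diff\<close>)
    then show ?thesis by simp
  qed
  from tendsto_add[OF this tendsto_add[OF L2lim_mult_right[OF assms(1) L(5)] L2lim_mult_right[OF assms(2) L(2)]]]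
  have "(\<lambda>n. (\<integral>x. (U n x - u x) * (W n x - v x) \<partial>lborel) +
     ((\<integral>x. (U n x - u x) * v x \<partial>lborel) + (\<integral>x. (W n x - v x) * u x \<partial>lborel))) \<longlonglongrightarrow> 0"
    by simp
  moreover have "(\<integral>x. (U n x - u x) * (W n x - v x) \<partial>lborel) +
     ((\<integral>x. (U n x - u x) * v x \<partial>lborel) + (\<integral>x. (W n x - v x) * u x \<partial>lborel))
     = (\<integral>x. U n x * W n x \<partial>lborel) - (\<integral>x. u x * v x \<partial>lborel)" for n
  proof -
    have i: "integrable lborel (\<lambda>x. U n x * W n x)" "integrable lborel (\<lambda>x. u x * v x)"
      "integrable lborel (\<lambda>x. (U n x - u x) * v x)" "integrable lborel (\<lambda>x. (W n x - v x) * u x)"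
      by (intro int L2_diff L)+
    have "(\<lambda>x. (U n x - u x) * (W n x - v x)) =
        (\<lambda>x. U n x * W n x - u x * v x - (U n x - u x) * v x - (W n x - v x) * u x)"
      by (simp add: algebra_simps)
    then have "(\<integral>x. (U n x - u x) * (W n x - v x) \<partial>lborel) = (\<integral>x. U n x * W n x \<partial>lborel)
        - (\<integral>x. u x * v x \<partial>lborel) - (\<integral>x. (U n x - u x) * v x \<partial>lborel)
        - (\<integral>x. (W n x - v x) * u x \<partial>lborel)"
      using i by (simp only: Bochner_Integration.integral_diff Bochner_Integration.integrable_diff)
    then show ?thesis by linarith
  qed
  ultimately show ?thesis
    by - (rule LIM_zero_cancel, simp)
qed

lemma L2lim_add:
  assumes "L2lim U u" "L2lim W v"
  shows "L2lim (\<lambda>n x. U n x + W n x) (\<lambda>x. u x + v x)"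
proof -
  note L = L2limD[OF assms(1)] L2limD[OF assms(2)]
  have "(\<lambda>n. 2 * (\<integral>x. (U n x - u x)\<^sup>2 \<partial>lborel) + 2 * (\<integral>x. (W n x - v x)\<^sup>2 \<partial>lborel)) \<longlonglongrightarrow> 0"
    using tendsto_add[OF tendsto_mult_right_zero[OF L(3)] tendsto_mult_right_zero[OF L(6)]] by simp
  then have "(\<lambda>n. \<integral>x. ((U n x + W n x) - (u x + v x))\<^sup>2 \<partial>lborel) \<longlonglongrightarrow> 0"
  proof (rule Lim_null_comparison[rotated], intro always_eventually allI)
    fix n
    show "norm (\<integral>x. ((U n x + W n x) - (u x + v x))\<^sup>2 \<partial>lborel)
      \<le> 2 * (\<integral>x. (U n x - u x)\<^sup>2 \<partial>lborel) + 2 * (\<integral>x. (W n x - v x)\<^sup>2 \<partial>lborel)"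
      using L2_square_add_le[OF L2_diff[OF L(1,2)] L2_diff[OF L(4,5)], of n n]
      by (simp add: algebra_simps)
  qed
  then show ?thesis using L by (auto simp: L2lim_def L2_add)
qed

lemma L2lim_bound:
  assumes "L2lim U u" "\<And>n. L2 (W n)" "L2 v" "\<And>n x. \<bar>W n x - v x\<bar> \<le> B * \<bar>U n x - u x\<bar>"
  shows "L2lim W v"
proof -
  note L = L2limD[OF assms(1)]
  have "(\<lambda>n. B\<^sup>2 * (\<integral>x. (U n x - u x)\<^sup>2 \<partial>lborel)) \<longlonglongrightarrow> 0"
    using tendsto_mult_right_zero[OF L(3)] .
  then have "(\<lambda>n. \<integral>x. (W n x - v x)\<^sup>2 \<partial>lborel) \<longlonglongrightarrow> 0"
  proof (rule Lim_null_comparison[rotated], intro always_eventually allI)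
    fix n
    have "(\<integral>x. (W n x - v x)\<^sup>2 \<partial>lborel) \<le> (\<integral>x. B\<^sup>2 * (U n x - u x)\<^sup>2 \<partial>lborel)"
    proof (intro integral_mono L2_square_integrable L2_diff integrable_mult_right assms L)
      show "(W n x - v x)\<^sup>2 \<le> B\<^sup>2 * (U n x - u x)\<^sup>2" for x
        using power_mono[OF assms(4)[of n x] abs_ge_zero, where n = 2] by (simp add: power_mult_distrib)
    qed
    then show "norm (\<integral>x. (W n x - v x)\<^sup>2 \<partial>lborel) \<le> B\<^sup>2 * (\<integral>x. (U n x - u x)\<^sup>2 \<partial>lborel)"
      by simp
  qed
  with assms show ?thesis by (auto simp: L2lim_def)
qed

lemma L2lim_dominated:
  assumes U: "\<And>n. U n \<in> borel_measurable borel" "u \<in> borel_measurable borel"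
    and w: "L2 w" "\<And>n x. \<bar>U n x\<bar> \<le> \<bar>w x\<bar>" "AE x in lborel. (\<lambda>n. U n x) \<longlonglongrightarrow> u x"
    and u: "L2 u"
  shows "L2lim U u"
proof -
  have LU: "L2 (U n)" for n by (rule L2_bound[OF w(1), of _ 1]) (use U w in auto)
  have "(\<lambda>n. \<integral>x. (U n x - u x)\<^sup>2 \<partial>lborel) \<longlonglongrightarrow> integral\<^sup>L lborel (\<lambda>x::'a. 0::real)"
  proof (rule integral_dominated_convergence[where w = "\<lambda>x. 2 * (w x)\<^sup>2 + 2 * (u x)\<^sup>2"])
    show "integrable lborel (\<lambda>x. 2 * (w x)\<^sup>2 + 2 * (u x)\<^sup>2)"
      using w(1) u by (auto simp: L2_def)
    show "AE x in lborel. (\<lambda>n. (U n x - u x)\<^sup>2) \<longlonglongrightarrow> 0"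
      using w(3) by eventually_elim (auto intro!: tendsto_eq_intros)
    fix n
    show "AE x in lborel. norm ((U n x - u x)\<^sup>2) \<le> 2 * (w x)\<^sup>2 + 2 * (u x)\<^sup>2"
    proof (intro AE_I2)
      fix x
      have "(U n x)\<^sup>2 \<le> (w x)\<^sup>2" using w(2)[of n x] by (simp add: abs_le_square_iff)
      then show "norm ((U n x - u x)\<^sup>2) \<le> 2 * (w x)\<^sup>2 + 2 * (u x)\<^sup>2"
        using square_add_le[of "U n x" "- u x"] by simp
    qed
  qed (use U in \<open>auto intro!: borel_measurable_power borel_measurable_diff\<close>)
  then show ?thesis using LU u by (auto simp: L2lim_def)
qed

text \<open>Split b_n U_n = b_n u + b_n (U_n - u): the first part converges by dominated
  convergence, the second is controlled by the uniform bound on b_n. Convergence of b_n is only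
  pointwise, as for cutoffs and for bounded functions of an almost everywhere convergent
  sequence.\<close>

lemma L2lim_mult_seq:
  assumes U: "L2lim U u" and b [measurable]: "\<And>n. b n \<in> borel_measurable borel"
    and B: "\<And>n x. \<bar>b n x\<bar> \<le> B" and lim: "AE x in lborel. (\<lambda>n. b n x) \<longlonglongrightarrow> c x"
    and [measurable]: "c \<in> borel_measurable borel" and C: "\<And>x. \<bar>c x\<bar> \<le> B"
  shows "L2lim (\<lambda>n x. b n x * U n x) (\<lambda>x. c x * u x)"
proof -
  note L = L2limD[OF U]
  note [measurable] = L(1,2)[THEN L2_measurable]
  have "B \<ge> 0" using order_trans[OF abs_ge_zero C] .
  have 1: "L2lim (\<lambda>n x. b n x * u x) (\<lambda>x. c x * u x)"
  proof (rule L2lim_dominated)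
    show "L2 (\<lambda>x. B * u x)" by (intro L2_cmult L)
    show "\<bar>b n x * u x\<bar> \<le> \<bar>B * u x\<bar>" for n x
      using B[of n x] \<open>B \<ge> 0\<close> by (simp add: abs_mult mult_right_mono)
    show "AE x in lborel. (\<lambda>n. b n x * u x) \<longlonglongrightarrow> c x * u x"
      using lim by eventually_elim (auto intro!: tendsto_intros)
    show "L2 (\<lambda>x. c x * u x)" by (intro L2_mult_bounded[OF L(2) _ C]) measurable
  qed measurable
  have 2: "L2lim (\<lambda>n x. b n x * (U n x - u x)) (\<lambda>x. 0)"
  proof (rule L2lim_bound[OF U])
    show "L2 (\<lambda>x. b n x * (U n x - u x))" for n
      by (intro L2_mult_bounded[OF L2_diff[OF L(1,2)] _ B]) measurable
    show "\<bar>b n x * (U n x - u x) - 0\<bar> \<le> B * \<bar>U n x - u x\<bar>" for n x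
      by (simp add: abs_mult mult_right_mono B)
  qed simp
  from L2lim_add[OF 1 2] show ?thesis by (simp add: algebra_simps)
qed

lemma L2lim_mult_bounded:
  assumes U: "L2lim U u" and b: "b \<in> borel_measurable borel" and B: "\<And>x. \<bar>b x\<bar> \<le> B"
  shows "L2lim (\<lambda>n x. b x * U n x) (\<lambda>x. b x * u x)"
  by (rule L2lim_mult_seq[OF U b B _ b B]) auto

lemma L2lim_Lipschitz:
  assumes U: "L2lim U u" and h: "\<And>s t. \<bar>h s - h t\<bar> \<le> B * \<bar>s - t\<bar>" "h 0 = 0"
    and [measurable]: "h \<in> borel_measurable borel"
  shows "L2lim (\<lambda>n x. h (U n x)) (\<lambda>x. h (u x))"
proof -
  note L = L2limD[OF U]
  note [measurable] = L(1,2)[THEN L2_measurable]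
  have h0: "\<bar>h s\<bar> \<le> B * \<bar>s\<bar>" for s using h(1)[of s 0] h(2) by simp
  show ?thesis
  proof (rule L2lim_bound[OF U _ _ h(1)])
    show "L2 (\<lambda>x. h (U n x))" for n by (rule L2_bound[OF L(1) _ h0]) measurable
    show "L2 (\<lambda>x. h (u x))" by (rule L2_bound[OF L(2) _ h0]) measurable
  qed
qed

lemma L2lim_subseq: "L2lim U u \<Longrightarrow> strict_mono r \<Longrightarrow> L2lim (\<lambda>n. U (r n)) u"
  unfolding L2lim_def using LIMSEQ_subseq_LIMSEQ[of _ 0 r] by (auto simp: o_def)

lemma L2lim_AE_subseq:
  assumes "L2lim U u"
  obtains r where "strict_mono r" "AE x in lborel. (\<lambda>n. U (r n) x) \<longlonglongrightarrow> u x"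
proof -
  note L = L2limD[OF assms]
  have "\<exists>r. strict_mono r \<and> (AE x in lborel. (\<lambda>n. (U (r n) x - u x)\<^sup>2) \<longlonglongrightarrow> 0)"
    using L(3) by (intro tendsto_L1_AE_subseq) (auto intro!: L2_square_integrable L2_diff L)
  then obtain r where "strict_mono r" and r: "AE x in lborel. (\<lambda>n. (U (r n) x - u x)\<^sup>2) \<longlonglongrightarrow> 0"
    by blast
  from r have "AE x in lborel. (\<lambda>n. U (r n) x) \<longlonglongrightarrow> u x"
    by eventually_elim (simp add: LIM_zero_iff)
  with \<open>strict_mono r\<close> show ?thesis by (rule that)
qed

section \<open>Convolution and mollifiers\<close>

lemma uniformly_continuous_compact_support:
  fixes f :: "'a::euclidean_space \<Rightarrow> real"
  assumes "continuous_on UNIV f" and out: "\<And>x. norm x > R \<Longrightarrow> f x = 0" and "e > 0"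
  obtains d where "d > 0" "\<And>x y. dist x y < d \<Longrightarrow> \<bar>f x - f y\<bar> < e"
proof -
  have "uniformly_continuous_on (cball 0 (R + 1)) f"
    by (intro compact_uniformly_continuous continuous_on_subset[OF assms(1)]) auto
  then obtain d where "d > 0"
    and d: "\<And>x y. x \<in> cball 0 (R + 1) \<Longrightarrow> y \<in> cball 0 (R + 1) \<Longrightarrow> dist x y < d \<Longrightarrow> \<bar>f x - f y\<bar> < e"
    unfolding uniformly_continuous_on_def dist_real_def using \<open>e > 0\<close> by metis
  \<comment> \<open>At distance below 1, two points either both lie in the ball of radius R + 1 or
    both lie outside radius R, where \<open>f\<close> vanishes.\<close>
  show ?thesis
  proof (rule that[of "min d 1"])
    fix x y :: 'a assume xy: "dist x y < min d 1"
    show "\<bar>f x - f y\<bar> < e"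
    proof (cases "norm x \<le> R + 1 \<and> norm y \<le> R + 1")
      case True
      then show ?thesis using d[of x y] xy by simp
    next
      case False
      have "norm x \<le> norm y + dist x y" "norm y \<le> norm x + dist x y"
        by (metis add.commute dist_norm norm_triangle_sub dist_commute)+
      with False xy have "norm x > R" "norm y > R" by linarith+
      then show ?thesis using out \<open>e > 0\<close> by simp
    qed
  qed (use \<open>d > 0\<close> in simp)
qed

text \<open>A class wider than the test functions: the primitive of a truncated nonlinearity,
  composed with a test function and multiplied by another, is in general only once continuously
  differentiable.\<close>

definition C1c :: "(real^2 \<Rightarrow> real) \<Rightarrow> bool" where
  "C1c \<phi> \<longleftrightarrow> (\<forall>x. \<phi> differentiable (at x)) \<and> (\<forall>i. continuous_on UNIV (pd i \<phi>)) \<and>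
     (\<exists>R. \<forall>x. norm x > R \<longrightarrow> \<phi> x = 0)"

lemma test_fun_C1c: "test_fun \<phi> \<Longrightarrow> C1c \<phi>"
  by (auto simp: C1c_def test_fun_iff intro: smooth_differentiable smooth_continuous smooth_pd)

text \<open>The mean value inequality for \<open>K\<close> minus its linearization at
  \<open>x\<close>. Compact support makes the derivatives uniformly continuous, hence
  \<open>d\<close> independent of \<open>x\<close>; each of the two components contributes
  e/2.\<close>

lemma C1c_uniform_derivative:
  assumes K: "C1c K" and "e > 0"
  obtains d where "d > 0"
    "\<And>x h :: real^2. norm h < d \<Longrightarrow> \<bar>K (x + h) - K x - (\<Sum>i\<in>UNIV. pd i K x * h $ i)\<bar> \<le> e * norm h"
proof -
  have "\<exists>d>0. \<forall>x y::real^2. dist x y < d \<longrightarrow> \<bar>pd i K x - pd i K y\<bar> < e / 2" for i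
  proof -
    obtain R where "\<And>x. norm x > R \<Longrightarrow> K x = 0" using K by (auto simp: C1c_def)
    then have "\<And>x. norm x > R \<Longrightarrow> pd i K x = 0" by (rule pd_eq_0_outside)
    moreover have "continuous_on UNIV (pd i K)" using K by (simp add: C1c_def)
    ultimately show ?thesis
      using uniformly_continuous_compact_support[of "pd i K" R "e/2"] \<open>e > 0\<close> by (metis half_gt_zero)
  qed
  then obtain D where D: "\<And>i. D i > 0" "\<And>i x y. dist x y < D i \<Longrightarrow> \<bar>pd i K x - pd i K y\<bar> < e / 2"
    by metis
  define d where "d = min (D 1) (D 2)"
  have d: "d > 0" "\<And>i x y. dist x y < d \<Longrightarrow> \<bar>pd i K x - pd i K y\<bar> < e / 2"
  proof -
    show "d > 0" using D(1) by (simp add: d_def)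
    fix i and x y :: "real^2" assume "dist x y < d"
    then have "dist x y < D i" using exhaust_2[of i] by (auto simp: d_def)
    then show "\<bar>pd i K x - pd i K y\<bar> < e / 2" by (rule D(2))
  qed
  have d': "K differentiable (at x)" for x using K by (simp add: C1c_def)
  show ?thesis
  proof (rule that[OF d(1)])
    fix x h :: "real^2" assume h: "norm h < d"
    let ?g = "\<lambda>z. K z - (\<Sum>i\<in>UNIV. pd i K x * z $ i)"
    let ?g' = "\<lambda>z k. (\<Sum>i\<in>UNIV. pd i K z * k $ i) - (\<Sum>i\<in>UNIV. pd i K x * k $ i)"
    have "norm (?g (x + h) - ?g x) \<le> e * norm (x + h - x)"
    proof (rule differentiable_bound[of "ball x d" ?g ?g'])
      show "(?g has_derivative ?g' z) (at z within ball x d)" if "z \<in> ball x d" for z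
        by (rule has_derivative_at_withinI)
           (intro has_derivative_diff has_derivative_pd d'
             bounded_linear_imp_has_derivative bounded_linear_sum bounded_linear_mult_right
             bounded_linear_compose[OF bounded_linear_mult_right bounded_linear_vec_nth])
      show "onorm (?g' z) \<le> e" if z: "z \<in> ball x d" for z
      proof (rule onorm_le)
        fix k
        have "norm (?g' z k) = \<bar>\<Sum>i\<in>UNIV. (pd i K z - pd i K x) * k $ i\<bar>"
          by (simp add: sum_subtractf left_diff_distrib)
        also have "\<dots> \<le> (\<Sum>i\<in>UNIV. \<bar>(pd i K z - pd i K x) * k $ i\<bar>)"
          by (rule sum_abs)
        also have "\<dots> \<le> (\<Sum>i\<in>(UNIV::2 set). e / 2 * norm k)"
        proof (rule sum_mono)
          fix i :: 2
          show "\<bar>(pd i K z - pd i K x) * k $ i\<bar> \<le> e / 2 * norm k"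
            unfolding abs_mult
            by (intro mult_mono component_le_norm_cart less_imp_le[OF d(2)])
               (use z \<open>e > 0\<close> in \<open>auto simp: dist_commute\<close>)
        qed
        also have "\<dots> = e * norm k" by simp
        finally show "norm (?g' z k) \<le> e * norm k" .
      qed
    qed (use h \<open>d > 0\<close> in \<open>auto simp: dist_norm\<close>)
    then show "\<bar>K (x + h) - K x - (\<Sum>i\<in>UNIV. pd i K x * h $ i)\<bar> \<le> e * norm h"
      by (simp add: sum.distrib distrib_left algebra_simps)
  qed
qed

lemma L2_compact_support:
  fixes f :: "'a::euclidean_space \<Rightarrow> real"
  assumes [measurable]: "f \<in> borel_measurable borel" and B: "\<And>x. \<bar>f x\<bar> \<le> B"
    and out: "\<And>x. norm x > R \<Longrightarrow> f x = 0"
  shows "L2 f"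
  unfolding L2_def
proof
  show "integrable lborel (\<lambda>x. (f x)\<^sup>2)"
  proof (rule Bochner_Integration.integrable_bound)
    show "integrable lborel (\<lambda>x::'a. B\<^sup>2 * indicator (cball 0 R) x)"
      by (intro integrable_mult_right integrable_real_indicator) (use emeasure_lborel_cball_finite[of 0 R] in \<open>auto simp: infinity_ennreal_def\<close>)
    show "AE x in lborel. norm ((f x)\<^sup>2) \<le> norm (B\<^sup>2 * indicator (cball 0 R) x)"
      using power_mono[OF B abs_ge_zero, where n = 2] out
      by (auto simp: indicator_def not_le)
  qed measurable
qed fact

lemma L2_indicator_cball: "L2 (indicator (cball a r) :: 'a::euclidean_space \<Rightarrow> real)"
proof (rule L2_compact_support[of _ 1 "norm a + r"])
  fix x :: 'a assume "norm x > norm a + r"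
  then have "x \<notin> cball a r"
    using norm_triangle_sub[of x a] by (auto simp: dist_norm norm_minus_commute)
  then show "indicator (cball a r) x = (0::real)" by simp
qed (auto intro!: borel_measurable_indicator split: split_indicator)

lemma continuous_compact_support:
  fixes f :: "'a::euclidean_space \<Rightarrow> real"
  assumes c: "continuous_on UNIV f" and out: "\<And>x. norm x > R \<Longrightarrow> f x = 0"
  shows "L2 f" "integrable lborel f"
proof -
  have "compact (f ` cball 0 R)"
    by (intro compact_continuous_image continuous_on_subset[OF c] compact_cball) auto
  then obtain B where "B > 0" and B: "\<And>x. x \<in> cball 0 R \<Longrightarrow> \<bar>f x\<bar> \<le> B"
    using compact_imp_bounded[of "f ` cball 0 R"] unfolding bounded_pos by auto
  have "\<bar>f x\<bar> \<le> B" for x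
    using B[of x] out[of x] \<open>B > 0\<close> by (cases "norm x > R") auto
  then show "L2 f"
    using L2_compact_support[OF borel_measurable_continuous_onI[OF c] _ out] by blast
  have "integrable lborel (\<lambda>x. indicator (cball 0 R) x * f x)"
    by (intro L2_mult_integrable L2_indicator_cball) fact
  also have "(\<lambda>x. indicator (cball 0 R) x * f x) = f"
    using out by (auto simp: fun_eq_iff indicator_def not_le)
  finally show "integrable lborel f" .
qed

lemma test_fun_measurable [measurable_dest]: "test_fun K \<Longrightarrow> K \<in> borel_measurable borel"
  by (intro smooth_measurable test_fun_smooth)

lemma test_fun_L2: "test_fun K \<Longrightarrow> L2 K"
  unfolding test_fun_iff using continuous_compact_support(1) smooth_continuous by blast

lemma test_fun_integrable: "test_fun K \<Longrightarrow> integrable lborel K"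
  unfolding test_fun_iff using continuous_compact_support(2) smooth_continuous by blast

lemma test_fun_reflect: "test_fun K \<Longrightarrow> test_fun (\<lambda>y. K (x - y))"
  using test_fun_affine[of K "-1" x] by simp

section \<open>Convolution with test functions and mollifiers\<close>

definition conv :: "(real^2 \<Rightarrow> real) \<Rightarrow> (real^2 \<Rightarrow> real) \<Rightarrow> real^2 \<Rightarrow> real" where
  "conv K u x = (\<integral>y. K (x - y) * u y \<partial>lborel)"

lemma conv_integrable: "test_fun K \<Longrightarrow> L2 u \<Longrightarrow> integrable lborel (\<lambda>y. K (x - y) * u y)"
  by (rule L2_mult_integrable[OF test_fun_L2[OF test_fun_reflect]])

text \<open>Differentiation under the integral by direct estimate: the uniform expansion of
  \<open>K\<close> bounds the error by e/(C+1) |h| |u(y)| on the ball of radius R + 1 about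
  \<open>x\<close>. Outside that ball all terms vanish for |h| < 1. \<open>C\<close> is the integral
  of |u| over the ball, and C + 1 avoids a division by 0.\<close>

lemma has_derivative_conv:
  assumes K: "test_fun K" and u: "L2 u"
  shows "(conv K u has_derivative (\<lambda>h. \<Sum>i\<in>UNIV. conv (pd i K) u x * h $ i)) (at x)"
  unfolding has_derivative_at_alt
proof (intro conjI allI impI)
  show "bounded_linear (\<lambda>h. \<Sum>i\<in>UNIV. conv (pd i K) u x * h $ i)"
    by (intro bounded_linear_sum bounded_linear_compose[OF bounded_linear_mult_right bounded_linear_vec_nth])
  fix e :: real assume "e > 0"
  obtain R where R: "\<And>x. norm x > R \<Longrightarrow> K x = 0" using K by (auto simp: test_fun_iff)
  define ind :: "real^2 \<Rightarrow> real" where "ind = indicator (cball x (R + 1))"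
  have ind: "L2 ind" unfolding ind_def by (rule L2_indicator_cball)
  have absu: "L2 (\<lambda>y. \<bar>u y\<bar>)" using u by (auto simp: L2_def)
  define C where "C = (\<integral>y. ind y * \<bar>u y\<bar> \<partial>lborel)"
  have "C \<ge> 0" unfolding C_def by (intro Bochner_Integration.integral_nonneg) (auto simp: ind_def)
  then have "e / (C + 1) > 0" using \<open>e > 0\<close> by simp
  from C1c_uniform_derivative[OF test_fun_C1c[OF K] this] obtain d where "d > 0"
    and d: "\<And>x h. norm h < d \<Longrightarrow> \<bar>K (x + h) - K x - (\<Sum>i\<in>UNIV. pd i K x * h $ i)\<bar> \<le> e / (C + 1) * norm h"
    by blast
  show "\<exists>d>0. \<forall>y. norm (y - x) < d \<longrightarrow>
      norm (conv K u y - conv K u x - (\<Sum>i\<in>UNIV. conv (pd i K) u x * (y - x) $ i)) \<le> e * norm (y - x)"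
  proof (intro exI[of _ "min d 1"] conjI allI impI)
    fix x' assume x': "norm (x' - x) < min d 1"
    define h where "h = x' - x"
    then have h: "norm h < d" "norm h < 1" "x' = x + h" using x' by auto
    let ?G = "\<lambda>y. (K (x + h - y) - K (x - y) - (\<Sum>i\<in>UNIV. pd i K (x - y) * h $ i)) * u y"
    have i: "integrable lborel (\<lambda>y. K (x + h - y) * u y)" "integrable lborel (\<lambda>y. K (x - y) * u y)"
      "\<And>i. integrable lborel (\<lambda>y. h $ i * (pd i K (x - y) * u y))"
      by (intro integrable_mult_right conv_integrable K u test_fun_pd)+
    have "conv K u (x + h) - conv K u x - (\<Sum>i\<in>UNIV. conv (pd i K) u x * h $ i)
        = (\<integral>y. K (x + h - y) * u y \<partial>lborel) - (\<integral>y. K (x - y) * u y \<partial>lborel)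
          - (\<Sum>i\<in>UNIV. \<integral>y. h $ i * (pd i K (x - y) * u y) \<partial>lborel)"
      by (simp add: conv_def mult.commute[of "h $ _"])
    also have "\<dots> = (\<integral>y. K (x + h - y) * u y - K (x - y) * u y
          - (\<Sum>i\<in>UNIV. h $ i * (pd i K (x - y) * u y)) \<partial>lborel)"
      using i by (simp only: Bochner_Integration.integral_diff Bochner_Integration.integrable_diff
        Bochner_Integration.integral_sum Bochner_Integration.integrable_sum)
    also have "\<dots> = (\<integral>y. ?G y \<partial>lborel)"
      by (intro Bochner_Integration.integral_cong refl) (simp add: algebra_simps sum_distrib_left)
    finally have "\<bar>conv K u (x + h) - conv K u x - (\<Sum>i\<in>UNIV. conv (pd i K) u x * h $ i)\<bar>
      = \<bar>\<integral>y. ?G y \<partial>lborel\<bar>" by simp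
    also have "\<dots> \<le> (\<integral>y. e / (C + 1) * norm h * (ind y * \<bar>u y\<bar>) \<partial>lborel)"
    proof (rule integral_abs_bound_integral)
      show "integrable lborel (\<lambda>y. e / (C + 1) * norm h * (ind y * \<bar>u y\<bar>))"
        by (intro integrable_mult_right L2_mult_integrable ind absu)
      have "integrable lborel (\<lambda>y. K (x + h - y) * u y - K (x - y) * u y
          - (\<Sum>i\<in>UNIV. h $ i * (pd i K (x - y) * u y)))"
        using i by (intro Bochner_Integration.integrable_diff Bochner_Integration.integrable_sum)
      also have "?this \<longleftrightarrow> integrable lborel ?G"
        by (intro Bochner_Integration.integrable_cong refl) (simp add: algebra_simps sum_distrib_left)
      finally show "integrable lborel ?G" .
      fix y
      show "\<bar>?G y\<bar> \<le> e / (C + 1) * norm h * (ind y * \<bar>u y\<bar>)"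
      proof (cases "y \<in> cball x (R + 1)")
        case True
        have "\<bar>?G y\<bar> \<le> (e / (C + 1) * norm h) * \<bar>u y\<bar>"
          unfolding abs_mult[of _ "u y"] using d[OF h(1), of "x - y"]
          by (intro mult_right_mono) (auto simp: algebra_simps)
        then show ?thesis using True by (simp add: ind_def)
      next
        case False
        then have *: "norm (x - y) > R + 1" by (simp add: dist_norm)
        moreover have "norm (x - y) \<le> norm (x + h - y) + norm h"
          using norm_triangle_ineq4[of "x + h - y" h] by simp
        ultimately have "norm (x + h - y) > R" using h by simp
        moreover have "pd i K (x - y) = 0" for i
          using pd_eq_0_outside[OF R] * by simp
        ultimately show ?thesis using R * False by (simp add: ind_def)
      qed
    qed
    also have "\<dots> = e / (C + 1) * norm h * C" by (simp add: C_def)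
    also have "\<dots> \<le> e * norm h"
      using \<open>C \<ge> 0\<close> \<open>e > 0\<close> by (simp add: field_simps mult_left_mono)
    finally show "norm (conv K u x' - conv K u x - (\<Sum>i\<in>UNIV. conv (pd i K) u x * (x' - x) $ i)) \<le> e * norm (x' - x)"
      using h by simp
  qed (use \<open>d > 0\<close> in simp)
qed

lemma pd_conv:
  assumes "test_fun K" "L2 u" shows "pd i (conv K u) = conv (pd i K) u"
  by (rule ext, subst pd_eqI[OF has_derivative_conv[OF assms]])
     (simp add: axis_def if_distrib[of "\<lambda>t. _ * t"] cong: if_cong)

lemma conv_differentiable: "test_fun K \<Longrightarrow> L2 u \<Longrightarrow> conv K u differentiable (at x)"
  by (rule differentiableI[OF has_derivative_conv])

lemma smooth_conv: assumes "test_fun K" "L2 u" shows "smooth (conv K u)"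
  unfolding smooth_def
proof
  fix k show "Ck k (conv K u)"
    using assms(1)
  proof (induction k arbitrary: K)
    case 0
    then show ?case
      using conv_differentiable[OF _ assms(2)]
      by (auto intro: continuous_at_imp_continuous_on differentiable_imp_continuous_within)
  next
    case (Suc k)
    then show ?case
      by (auto simp: Ck_Suc_pd pd_conv assms(2) conv_differentiable test_fun_pd)
  qed
qed

lemma conv_eq_0_outside:
  assumes "\<And>x. norm x > r \<Longrightarrow> K x = 0" "\<And>x. norm x > R \<Longrightarrow> u x = 0" "norm x > r + R"
  shows "conv K u x = 0"
proof -
  have "K (x - y) * u y = 0" for y
  proof (cases "norm y > R")
    case False
    with assms(3) norm_triangle_sub[of x y] have "norm (x - y) > r" by linarith
    then show ?thesis using assms(1) by simp
  qed (use assms(2) in simp)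
  then show ?thesis unfolding conv_def by (simp only: Bochner_Integration.integral_zero)
qed

lemma test_fun_conv:
  assumes "test_fun K" "L2 u" "\<And>x. norm x > R \<Longrightarrow> u x = 0" shows "test_fun (conv K u)"
proof -
  obtain r where "\<And>x. norm x > r \<Longrightarrow> K x = 0" using assms(1) by (auto simp: test_fun_iff)
  with assms(3) have "\<forall>x. norm x > r + R \<longrightarrow> conv K u x = 0"
    by (blast intro: conv_eq_0_outside)
  with smooth_conv[OF assms(1,2)] show ?thesis unfolding test_fun_iff by blast
qed

text \<open>Evenness makes the convolution self-adjoint, and commuting derivatives of the kernel
  pass to every mollified function. Both enter when the equation is tested with a mollified vector
  field.\<close>

definition mollifier :: "(real^2 \<Rightarrow> real) \<Rightarrow> bool" where
  "mollifier \<eta> \<longleftrightarrow> test_fun \<eta> \<and> (\<forall>x. \<eta> x \<ge> 0) \<and> (\<forall>x. \<eta> (- x) = \<eta> x) \<and>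
     (\<integral>x. \<eta> x \<partial>lborel) = 1 \<and> pd_commute \<eta>"

lemma mollifierD:
  assumes "mollifier \<eta>"
  shows "test_fun \<eta>" "\<eta> x \<ge> 0" "\<eta> (x - y) = \<eta> (y - x)" "(\<integral>x. \<eta> x \<partial>lborel) = 1"
    "pd i (pd j \<eta>) = pd j (pd i \<eta>)"
proof -
  from assms have "\<eta> (- (x - y)) = \<eta> (x - y)" unfolding mollifier_def by blast
  then show "\<eta> (x - y) = \<eta> (y - x)" by simp
qed (use assms in \<open>auto simp: mollifier_def pd_commute_def\<close>)

lemma integral_lborel_translate:
  fixes f :: "'a::euclidean_space \<Rightarrow> real"
  assumes [measurable]: "f \<in> borel_measurable borel"
  shows "(\<integral>x. f (x - a) \<partial>lborel) = (\<integral>x. f x \<partial>lborel)"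
    and "(\<integral>\<^sup>+x. ennreal (f (x - a)) \<partial>lborel) = (\<integral>\<^sup>+x. ennreal (f x) \<partial>lborel)"
proof -
  have d: "lborel = distr lborel borel ((+) (- a))" using lborel_distr_plus[of "- a"] by simp
  show "(\<integral>x. f (x - a) \<partial>lborel) = (\<integral>x. f x \<partial>lborel)"
    by (subst (2) d, subst integral_distr) (auto simp: add.commute)
  show "(\<integral>\<^sup>+x. ennreal (f (x - a)) \<partial>lborel) = (\<integral>\<^sup>+x. ennreal (f x) \<partial>lborel)"
    by (subst (2) d, subst nn_integral_distr) (auto simp: add.commute)
qed

lemma mollifier_integral:
  assumes "mollifier \<eta>"
  shows "(\<integral>y. \<eta> (x - y) \<partial>lborel) = 1" "(\<integral>\<^sup>+x. ennreal (\<eta> (x - y)) \<partial>lborel) = 1"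
proof -
  note \<eta> = mollifierD[OF assms]
  note [measurable] = test_fun_measurable[OF \<eta>(1)]
  have "(\<integral>y. \<eta> (x - y) \<partial>lborel) = (\<integral>y. \<eta> (y - x) \<partial>lborel)"
    using \<eta>(3) by metis
  then show "(\<integral>y. \<eta> (x - y) \<partial>lborel) = 1"
    using integral_lborel_translate(1)[of \<eta> x] \<eta>(4) by simp
  have "(\<integral>\<^sup>+x. ennreal (\<eta> x) \<partial>lborel) = ennreal (\<integral>x. \<eta> x \<partial>lborel)"
    by (intro nn_integral_eq_integral test_fun_integrable) (use \<eta> in auto)
  then show "(\<integral>\<^sup>+x. ennreal (\<eta> (x - y)) \<partial>lborel) = 1"
    using \<eta>(4) by (simp add: integral_lborel_translate(2))
qed

text \<open>Tonelli: integrating the kernel first over the variable that is absent from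
  \<open>w\<close> gives 1. Swapping the variables and evenness give the second case.\<close>

lemma mollifier_pair_integrable:
  assumes \<eta>: "mollifier \<eta>" and w: "integrable lborel w" "\<And>x. w x \<ge> 0"
  shows "integrable (lborel \<Otimes>\<^sub>M lborel) (\<lambda>(x, y). \<eta> (x - y) * w y)"
    and "integrable (lborel \<Otimes>\<^sub>M lborel) (\<lambda>(x, y). \<eta> (x - y) * w x)"
    and "integrable lborel (\<lambda>x. conv \<eta> w x)"
    and "(\<integral>x. conv \<eta> w x \<partial>lborel) = (\<integral>x. w x \<partial>lborel)"
proof -
  note \<eta>D = mollifierD[OF \<eta>]
  note [measurable] = test_fun_measurable[OF \<eta>D(1)]
  have [measurable]: "w \<in> borel_measurable borel" using w(1) by auto
  have fin: "(\<integral>\<^sup>+y. ennreal (w y) \<partial>lborel) = ennreal (\<integral>y. w y \<partial>lborel)"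
    using w by (intro nn_integral_eq_integral) auto
  have "(\<integral>\<^sup>+z. ennreal (norm (case z of (x, y) \<Rightarrow> \<eta> (x - y) * w y)) \<partial>(lborel \<Otimes>\<^sub>M lborel))
      = (\<integral>\<^sup>+y. (\<integral>\<^sup>+x. ennreal (\<eta> (x - y)) * ennreal (w y) \<partial>lborel) \<partial>lborel)"
    by (subst lborel_pair.nn_integral_snd[symmetric])
       (auto simp: \<eta>D w ennreal_mult abs_mult intro!: nn_integral_cong)
  also have "\<dots> = (\<integral>\<^sup>+y. ennreal (w y) \<partial>lborel)"
    by (intro nn_integral_cong) (simp add: nn_integral_multc mollifier_integral(2)[OF \<eta>])
  also have "\<dots> < \<infinity>" by (simp add: fin)
  finally show 1: "integrable (lborel \<Otimes>\<^sub>M lborel) (\<lambda>(x, y). \<eta> (x - y) * w y)"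
    by (intro integrableI_bounded) auto
  have "(\<lambda>(x, y). \<eta> (y - x) * w x) = (\<lambda>(x, y). \<eta> (x - y) * w x)"
    using \<eta>D(3) by (auto simp: fun_eq_iff)
  with lborel_pair.integrable_product_swap[OF 1]
  show "integrable (lborel \<Otimes>\<^sub>M lborel) (\<lambda>(x, y). \<eta> (x - y) * w x)" by simp
  show "integrable lborel (\<lambda>x. conv \<eta> w x)"
    using lborel_pair.integrable_fst'[OF 1] by (simp add: conv_def)
  have "(\<integral>x. conv \<eta> w x \<partial>lborel) = (\<integral>y. (\<integral>x. \<eta> (x - y) * w y \<partial>lborel) \<partial>lborel)"
    unfolding conv_def by (rule lborel_pair.Fubini_integral[OF 1, symmetric])
  also have "\<dots> = (\<integral>y. w y \<partial>lborel)"
    using mollifier_integral(1)[OF \<eta>] \<eta>D(3)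
    by (simp add: integral_lborel_translate(1) \<eta>D(4))
  finally show "(\<integral>x. conv \<eta> w x \<partial>lborel) = (\<integral>x. w x \<partial>lborel)" .
qed

text \<open>Jensen's inequality for the probability density \<open>\<eta> (x - y)\<close> in
  \<open>y\<close>, obtained by expanding the nonnegative variance about the mean
  \<open>c\<close>.\<close>

lemma conv_square_le:
  assumes \<eta>: "mollifier \<eta>" and u: "L2 u"
  shows "(conv \<eta> u x)\<^sup>2 \<le> conv \<eta> (\<lambda>y. (u y)\<^sup>2) x"
proof -
  note \<eta>D = mollifierD[OF \<eta>]
  note [measurable] = test_fun_measurable[OF \<eta>D(1)] L2_measurable[OF u]
  define c where "c = conv \<eta> u x"
  obtain B where B: "\<And>x. \<bar>\<eta> x\<bar> \<le> B" using test_fun_bounded[OF \<eta>D(1)] by blast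
  have i1: "integrable lborel (\<lambda>y. \<eta> (x - y) * (u y)\<^sup>2)"
    by (rule Bochner_Integration.integrable_bound[OF integrable_mult_right[OF L2_square_integrable[OF u], of B]])
       (auto simp: abs_mult intro!: mult_right_mono order_trans[OF B abs_ge_self])
  have i2: "integrable lborel (\<lambda>y. \<eta> (x - y) * u y)" by (rule conv_integrable[OF \<eta>D(1) u])
  have i3: "integrable lborel (\<lambda>y. \<eta> (x - y))"
    by (intro test_fun_integrable test_fun_reflect \<eta>D)
  have "0 \<le> (\<integral>y. \<eta> (x - y) * (u y - c)\<^sup>2 \<partial>lborel)"
    by (intro Bochner_Integration.integral_nonneg) (simp add: \<eta>D)
  also have "\<dots> = (\<integral>y. \<eta> (x - y) * (u y)\<^sup>2 - 2 * c * (\<eta> (x - y) * u y) + c\<^sup>2 * \<eta> (x - y) \<partial>lborel)"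
    by (intro Bochner_Integration.integral_cong) (auto simp: power2_diff algebra_simps)
  also have "\<dots> = conv \<eta> (\<lambda>y. (u y)\<^sup>2) x - 2 * c * c + c\<^sup>2"
    using i1 i2 i3 mollifier_integral(1)[OF \<eta>, of x] by (simp add: conv_def c_def)
  finally show ?thesis by (simp add: c_def power2_eq_square)
qed

lemma conv_L2:
  assumes \<eta>: "mollifier \<eta>" and u: "L2 u"
  shows "L2 (conv \<eta> u)" "(\<integral>x. (conv \<eta> u x)\<^sup>2 \<partial>lborel) \<le> (\<integral>x. (u x)\<^sup>2 \<partial>lborel)"
proof -
  note \<eta>D = mollifierD[OF \<eta>]
  note P = mollifier_pair_integrable[OF \<eta> L2_square_integrable[OF u] zero_le_power2]
  have [measurable]: "conv \<eta> u \<in> borel_measurable borel"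
    by (intro smooth_measurable smooth_conv \<eta>D u)
  have "integrable lborel (\<lambda>x. (conv \<eta> u x)\<^sup>2)"
    by (rule Bochner_Integration.integrable_bound[OF P(3)])
       (auto intro!: order_trans[OF conv_square_le[OF \<eta> u] abs_ge_self])
  then show L: "L2 (conv \<eta> u)" by (auto simp: L2_def)
  have "(\<integral>x. (conv \<eta> u x)\<^sup>2 \<partial>lborel) \<le> (\<integral>x. conv \<eta> (\<lambda>y. (u y)\<^sup>2) x \<partial>lborel)"
    by (intro integral_mono L2_square_integrable L P conv_square_le[OF \<eta> u])
  then show "(\<integral>x. (conv \<eta> u x)\<^sup>2 \<partial>lborel) \<le> (\<integral>x. (u x)\<^sup>2 \<partial>lborel)"
    by (simp add: P(4))
qed

text \<open>Fubini, with |u(y) v(x)| \<le> u(y)^2 + v(x)^2 reducing joint integrability to the two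
  cases of \<open>mollifier_pair_integrable\<close>; evenness then exchanges the arguments of the
  kernel.\<close>

lemma conv_symmetric:
  assumes \<eta>: "mollifier \<eta>" and u: "L2 u" and v: "L2 v"
  shows "(\<integral>x. conv \<eta> u x * v x \<partial>lborel) = (\<integral>x. u x * conv \<eta> v x \<partial>lborel)"
proof -
  note \<eta>D = mollifierD[OF \<eta>]
  note [measurable] = test_fun_measurable[OF \<eta>D(1)] L2_measurable[OF u] L2_measurable[OF v]
  have i: "integrable (lborel \<Otimes>\<^sub>M lborel) (\<lambda>(x, y). \<eta> (x - y) * (u y * v x))"
  proof (rule Bochner_Integration.integrable_bound)
    show "integrable (lborel \<Otimes>\<^sub>M lborel)
        (\<lambda>z. (case z of (x, y) \<Rightarrow> \<eta> (x - y) * (u y)\<^sup>2) + (case z of (x, y) \<Rightarrow> \<eta> (x - y) * (v x)\<^sup>2))"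
      by (intro Bochner_Integration.integrable_add mollifier_pair_integrable[OF \<eta>] L2_square_integrable u v) auto
    have "\<bar>\<eta> (x - y) * (u y * v x)\<bar> \<le> \<bar>\<eta> (x - y) * (u y)\<^sup>2 + \<eta> (x - y) * (v x)\<^sup>2\<bar>" for x y
    proof -
      have "\<bar>\<eta> (x - y) * (u y * v x)\<bar> \<le> \<eta> (x - y) * ((u y)\<^sup>2 + (v x)\<^sup>2)"
        unfolding abs_mult[of "\<eta> _"] using \<eta>D(2) abs_mult_le_sum_squares[of "u y" "v x"]
        by (simp add: mult_left_mono del: abs_mult)
      also have "\<dots> \<le> \<bar>\<eta> (x - y) * (u y)\<^sup>2 + \<eta> (x - y) * (v x)\<^sup>2\<bar>"
        by (simp add: distrib_left)
      finally show ?thesis .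
    qed
    then show "AE z in lborel \<Otimes>\<^sub>M lborel. norm (case z of (x, y) \<Rightarrow> \<eta> (x - y) * (u y * v x))
      \<le> norm ((case z of (x, y) \<Rightarrow> \<eta> (x - y) * (u y)\<^sup>2) + (case z of (x, y) \<Rightarrow> \<eta> (x - y) * (v x)\<^sup>2))"
      by (intro AE_I2) (auto split: prod.split simp del: abs_mult)
  qed measurable
  have "(\<integral>x. conv \<eta> u x * v x \<partial>lborel) = (\<integral>x. (\<integral>y. \<eta> (x - y) * (u y * v x) \<partial>lborel) \<partial>lborel)"
    unfolding conv_def by (simp flip: integral_mult_left_zero add: mult.assoc)
  also have "\<dots> = (\<integral>y. (\<integral>x. \<eta> (x - y) * (u y * v x) \<partial>lborel) \<partial>lborel)"
    by (rule lborel_pair.Fubini_integral[OF i, symmetric])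
  also have "\<dots> = (\<integral>y. u y * conv \<eta> v y \<partial>lborel)"
    unfolding conv_def by (simp flip: integral_mult_right_zero add: mult.left_commute \<eta>D(3))
  finally show ?thesis .
qed

definition moll :: "nat \<Rightarrow> real^2 \<Rightarrow> real" where
  "moll n x = bump (real (Suc n) *\<^sub>R x) / (\<integral>y. bump (real (Suc n) *\<^sub>R y) \<partial>lborel)"

lemma continuous_nonneg_integral_pos:
  fixes f :: "'a::euclidean_space \<Rightarrow> real"
  assumes "continuous_on UNIV f" "\<And>x. f x \<ge> 0" "f a > 0" "integrable lborel f"
  shows "(\<integral>x. f x \<partial>lborel) > 0"
proof -
  have "\<forall>\<^sub>F x in at a. f x > f a / 2"
    using assms by (intro order_tendstoD) (auto simp: continuous_on_def)
  then obtain r where "r > 0" and r: "\<And>x. dist x a < r \<Longrightarrow> f x > f a / 2"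
    unfolding eventually_at using \<open>f a > 0\<close> by (metis field_sum_of_halves less_add_same_cancel1 half_gt_zero UNIV_I)
  have fin: "emeasure lborel (ball a r) < \<infinity>" by (rule emeasure_lborel_ball_finite)
  have "0 < f a / 2 * measure lborel (ball a r)"
    using content_ball_pos[OF \<open>r > 0\<close>, of a] \<open>f a > 0\<close> by simp
  also have "\<dots> = (\<integral>x. f a / 2 * indicator (ball a r) x \<partial>lborel)" by simp
  also have "\<dots> \<le> (\<integral>x. f x \<partial>lborel)"
  proof (rule integral_mono)
    show "integrable lborel (\<lambda>x. f a / 2 * indicator (ball a r) x)"
      by (intro integrable_mult_right integrable_real_indicator fin) auto
    show "f a / 2 * indicator (ball a r) x \<le> f x" for x
      using r[of x] assms(2)[of x] by (auto simp: indicator_def dist_commute intro: less_imp_le)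
  qed fact
  finally show ?thesis .
qed

lemma mollifier_moll: "mollifier (moll n)"
  and moll_outside: "norm x > 2 / real (Suc n) \<Longrightarrow> moll n x = 0"
proof -
  define r where "r = real (Suc n)"
  then have "r > 0" by simp
  define c where "c = (\<integral>y. bump (r *\<^sub>R y) \<partial>lborel)"
  have t: "test_fun (\<lambda>x. bump (r *\<^sub>R x))"
    using test_fun_affine[OF test_fun_bump, of r 0] \<open>r > 0\<close> by simp
  have "c > 0" unfolding c_def
    by (rule continuous_nonneg_integral_pos[where a = 0])
       (auto intro!: smooth_continuous test_fun_smooth t test_fun_integrable simp: bump_nonneg bump_0)
  have eq: "moll n = (\<lambda>x. bump (r *\<^sub>R x) * (1 / c))"
    by (auto simp: moll_def r_def c_def)
  have com: "pd_commute (\<lambda>x. bump (r *\<^sub>R x))"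
  proof -
    have d: "bump differentiable (at x)" "pd i bump differentiable (at x)" for i x
      by (intro smooth_differentiable smooth_pd bump_smooth)+
    have 1: "pd i (\<lambda>x. bump (r *\<^sub>R x)) = (\<lambda>x. r * pd i bump (r *\<^sub>R x))" for i
      using pd_affine[of bump i r 0] d by auto
    have 2: "smooth (\<lambda>x. pd i bump (r *\<^sub>R x))" for i
      using smooth_affine[of "pd i bump" r 0] bump_smooth by auto
    have 3: "pd j (\<lambda>x. r * pd i bump (r *\<^sub>R x)) = (\<lambda>x. r * (r * pd j (pd i bump) (r *\<^sub>R x)))" for i j
      using pd_affine[of "pd i bump" j r 0] d
      by (auto simp: fun_eq_iff pd_mult smooth_differentiable[OF 2])
    show ?thesis
      using bump_commute unfolding pd_commute_def 1 3 by simp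
  qed
  show "mollifier (moll n)"
    unfolding mollifier_def
  proof (intro conjI allI)
    show "test_fun (moll n)" unfolding eq by (rule test_fun_mult[OF t smooth_const])
    show "pd_commute (moll n)" unfolding eq
      by (rule pd_commute_mult[OF test_fun_smooth[OF t] smooth_const com]) (auto simp: pd_commute_def)
    show "(\<integral>x. moll n x \<partial>lborel) = 1" unfolding eq using \<open>c > 0\<close> c_def by simp
    fix x
    show "0 \<le> moll n x" unfolding eq using \<open>c > 0\<close> by (simp add: bump_nonneg)
    show "moll n (- x) = moll n x" unfolding eq using bump_even[of "r *\<^sub>R x"] by simp
  qed
  assume "norm x > 2 / real (Suc n)"
  then have "2 < r * norm x" unfolding r_def[symmetric] using \<open>r > 0\<close> by (simp add: field_simps)
  then have "norm (r *\<^sub>R x) > 2" using \<open>r > 0\<close> by simp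
  then show "moll n x = 0" unfolding eq using bump_outside by simp
qed

section \<open>Density of continuous functions and convergence of mollifications\<close>

lemma AE_lborel_negligible:
  assumes "negligible N" shows "AE x in lborel. x \<notin> N"
proof -
  from assms obtain N' where "N' \<in> null_sets lborel" "N \<subseteq> N'"
    unfolding negligible_iff_null_sets null_sets_completion_iff2 by blast
  then show ?thesis by (auto intro!: AE_I'[of N'])
qed

text \<open>First \<open>u\<close> is truncated to height and radius k. The truncation is an almost
  everywhere limit of continuous functions, as \<open>measurable_on\<close> provides; clipping these
  to the same height and multiplying by a continuous cutoff gives a common majorant without changing
  the limit, so dominated convergence applies twice.\<close>

lemma L2_dense_continuous:
  fixes u :: "'a::euclidean_space \<Rightarrow> real"
  assumes u: "L2 u" and "e > 0"
  obtains v R where "continuous_on UNIV v" "\<And>x. norm x > R \<Longrightarrow> v x = 0" "L2 v"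
    "(\<integral>x. (u x - v x)\<^sup>2 \<partial>lborel) < e"
proof -
  note [measurable] = L2_measurable[OF u]
  define cl where "cl k s = max (- k) (min k s)" for k s :: real
  have cl: "\<bar>cl k s\<bar> \<le> k" "\<bar>cl k s\<bar> \<le> \<bar>s\<bar>" "\<bar>s\<bar> \<le> k \<Longrightarrow> cl k s = s" if "k \<ge> 0" for k s
    using that by (auto simp: cl_def)
  have [measurable]: "cl k \<in> borel_measurable borel" for k unfolding cl_def by measurable
  define U where "U k x = indicator (cball 0 (real k)) x * cl (real k) (u x)" for k x
  have [measurable]: "U k \<in> borel_measurable borel" for k
    unfolding U_def
    by (intro borel_measurable_times borel_measurable_indicator
        measurable_compose[OF L2_measurable[OF u], of "cl (real k)"]) simp_all
  have "L2lim U u"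
  proof (rule L2lim_dominated[OF _ _ u _ _ u])
    show "\<bar>U k x\<bar> \<le> \<bar>u x\<bar>" for k x
      using cl(2)[of "real k" "u x"] by (auto simp: U_def indicator_def)
    show "AE x in lborel. (\<lambda>k. U k x) \<longlonglongrightarrow> u x"
    proof (intro AE_I2)
      fix x
      have "\<forall>\<^sub>F k in sequentially. real k \<ge> max \<bar>u x\<bar> (norm x)"
        using filterlim_real_sequentially unfolding filterlim_at_top by blast
      then have "\<forall>\<^sub>F k in sequentially. U k x = u x"
        by eventually_elim (auto simp: U_def cl(3))
      then show "(\<lambda>k. U k x) \<longlonglongrightarrow> u x" by (simp add: tendsto_eventually)
    qed
  qed measurable
  from L2limD(3)[OF this] have "\<forall>\<^sub>F k in sequentially. (\<integral>x. (U k x - u x)\<^sup>2 \<partial>lborel) < e / 4"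
    using \<open>e > 0\<close> by (intro order_tendstoD) auto
  then obtain k where k: "(\<integral>x. (U k x - u x)\<^sup>2 \<partial>lborel) < e / 4"
    by (auto simp: eventually_sequentially)
  have Uk: "L2 (U k)" using L2limD(1)[OF \<open>L2lim U u\<close>] .
  have "U k \<in> borel_measurable lebesgue" by (rule measurable_completion) simp
  then have "U k measurable_on UNIV"
    by (simp add: measurable_on_iff_borel_measurable)
  then obtain N g where "negligible N" and g: "\<And>n. continuous_on UNIV (g n)"
    and lim: "\<And>x. x \<notin> N \<Longrightarrow> (\<lambda>n. g n x) \<longlonglongrightarrow> U k x"
    unfolding measurable_on_def by auto
  define ct where "ct x = max 0 (min 1 (real k + 1 - norm x))" for x :: 'a
  have ct: "ct x = 1" if "norm x \<le> real k" for x using that by (simp add: ct_def)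
  have ct0: "ct x = 0" if "norm x > real k + 1" for x using that by (simp add: ct_def)
  have ct1: "\<bar>ct x\<bar> \<le> 1" for x by (simp add: ct_def)
  define W where "W n x = ct x * cl (real k) (g n x)" for n x
  have W: "continuous_on UNIV (W n)" for n
    unfolding W_def ct_def cl_def by (intro continuous_intros g)
  then have [measurable]: "W n \<in> borel_measurable borel" for n
    by (rule borel_measurable_continuous_onI)
  have Wb: "\<bar>W n x\<bar> \<le> real k" for n x
    using mult_mono[OF ct1[of x] cl(1)[of "real k" "g n x"]] by (simp add: W_def abs_mult)
  have W0: "W n x = 0" if "norm x > real k + 1" for n x using ct0[OF that] by (simp add: W_def)
  have "L2lim W (U k)"
  proof (rule L2lim_dominated[OF _ _ _ _ _ Uk])
    show "L2 (\<lambda>x. real k * indicator (cball 0 (real k + 1)) x)"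
      by (intro L2_cmult L2_indicator_cball)
    show "\<bar>W n x\<bar> \<le> \<bar>real k * indicator (cball 0 (real k + 1)) x\<bar>" for n x
      using Wb[of n x] W0[of x n] by (auto simp: indicator_def not_le)
    show "AE x in lborel. (\<lambda>n. W n x) \<longlonglongrightarrow> U k x"
      using AE_lborel_negligible[OF \<open>negligible N\<close>]
    proof eventually_elim
      case (elim x)
      have "(\<lambda>n. W n x) \<longlonglongrightarrow> ct x * cl (real k) (U k x)"
        unfolding W_def cl_def by (intro tendsto_intros lim elim)
      also have "ct x * cl (real k) (U k x) = U k x"
      proof (cases "norm x \<le> real k")
        case True
        then have "U k x = cl (real k) (u x)" by (simp add: U_def)
        then have "\<bar>U k x\<bar> \<le> real k" using cl(1) by simp
        then show ?thesis using ct[OF True] cl(3) by simp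
      next
        case False
        then have "U k x = 0" by (simp add: U_def)
        then show ?thesis by (simp add: cl_def)
      qed
      finally show ?case .
    qed
  qed measurable
  from L2limD(3)[OF this] have "\<forall>\<^sub>F n in sequentially. (\<integral>x. (W n x - U k x)\<^sup>2 \<partial>lborel) < e / 4"
    using \<open>e > 0\<close> by (intro order_tendstoD) auto
  then obtain n where n: "(\<integral>x. (W n x - U k x)\<^sup>2 \<partial>lborel) < e / 4"
    by (auto simp: eventually_sequentially)
  have Wn: "L2 (W n)" using L2limD(1)[OF \<open>L2lim W (U k)\<close>] .
  show ?thesis
  proof (rule that[OF W W0 Wn])
    have 1: "(u x - U k x)\<^sup>2 = (U k x - u x)\<^sup>2" for x by (rule power2_commute)
    have 2: "(U k x - W n x)\<^sup>2 = (W n x - U k x)\<^sup>2" for x by (rule power2_commute)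
    have "(\<integral>x. ((u x - U k x) + (U k x - W n x))\<^sup>2 \<partial>lborel)
        \<le> 2 * (\<integral>x. (u x - U k x)\<^sup>2 \<partial>lborel) + 2 * (\<integral>x. (U k x - W n x)\<^sup>2 \<partial>lborel)"
      by (intro L2_square_add_le L2_diff u Uk Wn)
    with k n show "(\<integral>x. (u x - W n x)\<^sup>2 \<partial>lborel) < e"
      by (simp add: 1 2)
  qed
qed

lemma conv_diff:
  assumes "test_fun K" "L2 u" "L2 v"
  shows "conv K (\<lambda>x. u x - v x) x = conv K u x - conv K v x"
  using conv_integrable[OF assms(1,2), of x] conv_integrable[OF assms(1,3), of x]
  by (simp add: conv_def right_diff_distrib)

text \<open>The kernel has mass 1 and support of radius 2/(n+1), so uniform continuity gives
  pointwise convergence. All mollifications are bounded by the bound of \<open>v\<close> and live in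
  the ball of radius R + 2, which dominates.\<close>

lemma conv_moll_L2lim_continuous:
  assumes v: "continuous_on UNIV v" and out: "\<And>x. norm x > R \<Longrightarrow> v x = 0" and L: "L2 v"
  shows "L2lim (\<lambda>n. conv (moll n) v) v"
proof -
  note M = mollifierD[OF mollifier_moll]
  have "compact (v ` cball 0 R)"
    by (intro compact_continuous_image continuous_on_subset[OF v] compact_cball) auto
  then obtain B where "B > 0" and B': "\<And>x. x \<in> cball 0 R \<Longrightarrow> \<bar>v x\<bar> \<le> B"
    using compact_imp_bounded[of "v ` cball 0 R"] unfolding bounded_pos by auto
  have B: "\<bar>v x\<bar> \<le> B" for x
    using B'[of x] out[of x] \<open>B > 0\<close> by (cases "norm x > R") auto
  have int: "integrable lborel (\<lambda>y. moll n (x - y))" for n x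
    by (intro test_fun_integrable test_fun_reflect M)
  note int' = conv_integrable[OF M(1) L]
  show ?thesis
  proof (rule L2lim_dominated[OF _ _ _ _ _ L])
    show "conv (moll n) v \<in> borel_measurable borel" for n
      by (intro smooth_measurable smooth_conv M L)
    show "v \<in> borel_measurable borel" using L by auto
    show "L2 (\<lambda>x::real^2. B * indicator (cball 0 (2 + R)) x)" by (intro L2_cmult L2_indicator_cball)
    show "\<bar>conv (moll n) v x\<bar> \<le> \<bar>B * indicator (cball 0 (2 + R)) x\<bar>" for n x
    proof (cases "norm x \<le> 2 + R")
      case True
      have "\<bar>conv (moll n) v x\<bar> \<le> (\<integral>y. B * moll n (x - y) \<partial>lborel)"
        unfolding conv_def
        by (intro integral_abs_bound_integral int' integrable_mult_right int)
           (simp add: abs_mult M(2) mult.commute[of B] mult_left_mono B)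
      also have "\<dots> = B" using mollifier_integral(1)[OF mollifier_moll] by simp
      finally show ?thesis using True \<open>B > 0\<close> by simp
    next
      case False
      have "moll n y = 0" if "norm y > 2" for y
      proof (rule moll_outside)
        have "2 / real (Suc n) \<le> 2" by (simp add: field_simps)
        with that show "2 / real (Suc n) < norm y" by linarith
      qed
      then have "conv (moll n) v x = 0"
        using False by (intro conv_eq_0_outside[of 2 _ R]) (auto simp: out)
      then show ?thesis by simp
    qed
    show "AE x in lborel. (\<lambda>n. conv (moll n) v x) \<longlonglongrightarrow> v x"
    proof (intro AE_I2 LIMSEQ_I)
      fix x and e :: real assume "e > 0"
      then have "e / 2 > 0" by simp
      from uniformly_continuous_compact_support[OF v out this] obtain d
        where "d > 0" and d: "\<And>x y. dist x y < d \<Longrightarrow> \<bar>v x - v y\<bar> < e / 2" by blast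
      obtain n0 where n0: "2 / d < real n0" using reals_Archimedean2 by blast
      show "\<exists>n0. \<forall>n\<ge>n0. norm (conv (moll n) v x - v x) < e"
      proof (intro exI[of _ n0] allI impI)
        fix n assume "n \<ge> n0"
        have "2 / d < real (Suc n)" using n0 \<open>n \<ge> n0\<close> by linarith
        then have nd: "2 / real (Suc n) < d" using \<open>d > 0\<close> by (simp add: field_simps)
        have "conv (moll n) v x - v x = (\<integral>y. moll n (x - y) * v y - v x * moll n (x - y) \<partial>lborel)"
          using int int' mollifier_integral(1)[OF mollifier_moll, of n x] by (simp add: conv_def)
        also have "\<bar>\<dots>\<bar> \<le> (\<integral>y. e / 2 * moll n (x - y) \<partial>lborel)"
        proof (intro integral_abs_bound_integral Bochner_Integration.integrable_diff integrable_mult_right int int')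
          fix y
          have eq: "\<bar>moll n (x - y) * v y - v x * moll n (x - y)\<bar> = moll n (x - y) * \<bar>v y - v x\<bar>"
          proof -
            have "moll n (x - y) * v y - v x * moll n (x - y) = moll n (x - y) * (v y - v x)"
              by (simp add: algebra_simps)
            then show ?thesis by (simp add: abs_mult M(2))
          qed
          show "\<bar>moll n (x - y) * v y - v x * moll n (x - y)\<bar> \<le> e / 2 * moll n (x - y)"
          proof (cases "dist x y < d")
            case True
            then have "moll n (x - y) * \<bar>v y - v x\<bar> \<le> moll n (x - y) * (e / 2)"
              by (intro mult_left_mono M less_imp_le[OF d]) (simp add: dist_commute)
            then show ?thesis unfolding eq by (simp only: mult.commute)
          next
            case False
            then have "moll n (x - y) = 0" using nd by (intro moll_outside) (simp add: dist_norm)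
            then show ?thesis by simp
          qed
        qed
        also have "\<dots> < e" using mollifier_integral(1)[OF mollifier_moll, of n x] \<open>e > 0\<close> by simp
        finally show "norm (conv (moll n) v x - v x) < e" by simp
      qed
    qed
  qed
qed

text \<open>Mollification does not increase the L2 norm, so replacing \<open>u\<close> by a nearby
  continuous \<open>v\<close> costs little both before and after it.\<close>

lemma conv_moll_L2lim:
  assumes u: "L2 u" shows "L2lim (\<lambda>n. conv (moll n) u) u"
  unfolding L2lim_def
proof (intro conjI allI conv_L2 mollifier_moll u LIMSEQ_I)
  note M = mollifierD[OF mollifier_moll]
  fix e :: real assume "e > 0"
  then have "e / 16 > 0" by simp
  from L2_dense_continuous[OF u this] obtain v R where
    v: "continuous_on UNIV v" "\<And>x. norm x > R \<Longrightarrow> v x = 0" "L2 v"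
    and uv: "(\<integral>x. (u x - v x)\<^sup>2 \<partial>lborel) < e / 16" by blast
  have "L2lim (\<lambda>n. conv (moll n) v) v" by (rule conv_moll_L2lim_continuous[OF v])
  note L = L2limD[OF this]
  obtain n0 where n0: "\<And>n. n \<ge> n0 \<Longrightarrow> (\<integral>x. (conv (moll n) v x - v x)\<^sup>2 \<partial>lborel) < e / 16"
    using LIMSEQ_D[OF L(3) \<open>e / 16 > 0\<close>] by auto
  show "\<exists>n0. \<forall>n\<ge>n0. norm ((\<integral>x. (conv (moll n) u x - u x)\<^sup>2 \<partial>lborel) - 0) < e"
  proof (intro exI[of _ n0] allI impI)
    fix n assume "n \<ge> n0"
    let ?a = "conv (moll n) (\<lambda>x. u x - v x)" and ?b = "\<lambda>x. conv (moll n) v x - v x" and ?c = "\<lambda>x. v x - u x"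
    have La: "L2 ?a" and Lb: "L2 ?b" and Lc: "L2 ?c"
      by (intro conv_L2 mollifier_moll L2_diff u v L)+
    have a: "(\<integral>x. (?a x)\<^sup>2 \<partial>lborel) < e / 16"
      using conv_L2(2)[OF mollifier_moll L2_diff[OF u v(3)]] uv by (rule le_less_trans)
    have c: "(\<integral>x. (?c x)\<^sup>2 \<partial>lborel) < e / 16"
      using uv by (simp add: power2_commute)
    have "(\<integral>x. (conv (moll n) u x - u x)\<^sup>2 \<partial>lborel) = (\<integral>x. (?a x + (?b x + ?c x))\<^sup>2 \<partial>lborel)"
      by (intro Bochner_Integration.integral_cong) (auto simp: conv_diff M u v)
    also have "\<dots> \<le> 2 * (\<integral>x. (?a x)\<^sup>2 \<partial>lborel) + 2 * (\<integral>x. (?b x + ?c x)\<^sup>2 \<partial>lborel)"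
      by (intro L2_square_add_le La L2_add Lb Lc)
    also have "\<dots> \<le> 2 * (\<integral>x. (?a x)\<^sup>2 \<partial>lborel) + 2 * (2 * (\<integral>x. (?b x)\<^sup>2 \<partial>lborel) + 2 * (\<integral>x. (?c x)\<^sup>2 \<partial>lborel))"
      by (intro add_left_mono mult_left_mono L2_square_add_le Lb Lc) auto
    \<comment> \<open>The total is 10/16 of e. The bound is stated for arbitrary reals and
      instantiated by the next \<open>note\<close>, which feeds the calculation.\<close>
    also have "2 * A + 2 * (2 * B + 2 * C) < e" if "A < e / 16" "B < e / 16" "C < e / 16" for A B C
      using that \<open>e > 0\<close> by (simp add: field_simps)
    note this[OF a n0[OF \<open>n \<ge> n0\<close>] c]
    finally show "norm ((\<integral>x. (conv (moll n) u x - u x)\<^sup>2 \<partial>lborel) - 0) < e" by simp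
  qed
qed

text \<open>By translation invariance the integral of psi(x+h) - psi(x) is 0 for h of length t along
  the axis, so t times the integral of the derivative equals, up to sign, the integral of the first
  order error. That error is at most e t on a ball of volume C, and e is chosen so that e C is too
  small.\<close>

lemma C1c_integral_pd:
  assumes \<psi>: "C1c \<psi>" shows "(\<integral>x. pd i \<psi> x \<partial>lborel) = 0"
proof (rule ccontr)
  assume neq: "(\<integral>x. pd i \<psi> x \<partial>lborel) \<noteq> 0"
  obtain R where R: "\<And>x. norm x > R \<Longrightarrow> \<psi> x = 0" and d': "\<And>x. \<psi> differentiable (at x)" and c: "\<And>i. continuous_on UNIV (pd i \<psi>)"
    using \<psi> by (auto simp: C1c_def)
  have c0: "continuous_on UNIV \<psi>"
    using d' by (auto intro: continuous_at_imp_continuous_on differentiable_imp_continuous_within)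
  then have [measurable]: "\<psi> \<in> borel_measurable borel" by (rule borel_measurable_continuous_onI)
  define C where "C = measure lborel (cball (0::real^2) (R + 1))"
  have "C \<ge> 0" by (simp add: C_def)
  define e where "e = \<bar>\<integral>x. pd i \<psi> x \<partial>lborel\<bar> / (C + 1)"
  have "e > 0" using neq \<open>C \<ge> 0\<close> by (simp add: e_def)
  from C1c_uniform_derivative[OF \<psi> this] obtain d where "d > 0"
    and d: "\<And>x h. norm h < d \<Longrightarrow> \<bar>\<psi> (x + h) - \<psi> x - (\<Sum>i\<in>UNIV. pd i \<psi> x * h $ i)\<bar> \<le> e * norm h"
    by blast
  define t where "t = min d 1 / 2"
  have t: "0 < t" "t < d" "t < 1" using \<open>d > 0\<close> by (auto simp: t_def)
  define h :: "real^2" where "h = axis i t"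
  have h: "norm h = t" "(\<Sum>j\<in>UNIV. pd j \<psi> x * h $ j) = t * pd i \<psi> x" for x
    using t by (auto simp: h_def norm_axis_1 axis_def if_distrib[of "\<lambda>t. _ * t"] norm_vec_def L2_set_def if_distrib[of "\<lambda>t. t ^ 2"] cong: if_cong)
  have i2: "integrable lborel \<psi>" and i3: "integrable lborel (pd i \<psi>)"
    using continuous_compact_support(2)[OF c0 R] continuous_compact_support(2)[OF c pd_eq_0_outside[OF R]] by auto
  have i1: "integrable lborel (\<lambda>x. \<psi> (x + h))"
  proof (rule continuous_compact_support(2))
    show "continuous_on UNIV (\<lambda>x. \<psi> (x + h))"
      by (intro continuous_on_compose2[OF c0] continuous_intros) auto
    show "\<psi> (x + h) = 0" if "norm x > R + 1" for x
      using that t h norm_triangle_ineq4[of "x + h" h] by (intro R) simp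
  qed
  have "(\<integral>x. \<psi> (x + h) - \<psi> x - t * pd i \<psi> x \<partial>lborel) = - t * (\<integral>x. pd i \<psi> x \<partial>lborel)"
    using i1 i2 i3 integral_lborel_translate(1)[of \<psi> "- h"] by simp
  then have "t * \<bar>\<integral>x. pd i \<psi> x \<partial>lborel\<bar> = \<bar>\<integral>x. \<psi> (x + h) - \<psi> x - t * pd i \<psi> x \<partial>lborel\<bar>"
    using t by (simp add: abs_mult)
  also have "\<dots> \<le> (\<integral>x. e * t * indicator (cball (0::real^2) (R + 1)) x \<partial>lborel)"
  proof (intro integral_abs_bound_integral Bochner_Integration.integrable_diff integrable_mult_right i1 i2 i3)
    show "integrable lborel (indicator (cball (0::real^2) (R + 1)) :: _ \<Rightarrow> real)"
      using emeasure_lborel_cball_finite[of "0::real^2" "R + 1"] by (intro integrable_real_indicator) auto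
    fix x
    show "\<bar>\<psi> (x + h) - \<psi> x - t * pd i \<psi> x\<bar> \<le> e * t * indicator (cball 0 (R + 1)) x"
    proof (cases "norm x \<le> R + 1")
      case True
      then show ?thesis using d[of h x] h t by simp
    next
      case False
      have "norm x \<le> norm (x + h) + norm h"
        using norm_triangle_ineq4[of "x + h" h] by simp
      with False h t have "norm (x + h) > R" by linarith
      then show ?thesis using R False pd_eq_0_outside[OF R] by simp
    qed
  qed
  also have "\<dots> = e * t * C" by (simp add: C_def)
  finally have "\<bar>\<integral>x. pd i \<psi> x \<partial>lborel\<bar> \<le> e * C" using t by simp
  then have "e * (C + 1) \<le> e * C" using \<open>C \<ge> 0\<close> by (simp add: e_def)
  then show False using \<open>e > 0\<close> by simp
qed

lemma smooth_mult_test_fun: "smooth \<phi> \<Longrightarrow> test_fun \<psi> \<Longrightarrow> test_fun (\<lambda>x. \<phi> x * \<psi> x)"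
  using test_fun_mult[of \<psi> \<phi>] by (simp add: mult.commute)

lemma integral_by_parts:
  assumes \<phi>: "smooth \<phi>" and \<psi>: "test_fun \<psi>"
  shows "(\<integral>x. \<phi> x * pd i \<psi> x \<partial>lborel) = - (\<integral>x. \<psi> x * pd i \<phi> x \<partial>lborel)"
proof -
  have "(\<integral>x. pd i (\<lambda>x. \<phi> x * \<psi> x) x \<partial>lborel) = 0"
    by (intro C1c_integral_pd test_fun_C1c smooth_mult_test_fun \<phi> \<psi>)
  moreover have "pd i (\<lambda>x. \<phi> x * \<psi> x) = (\<lambda>x. \<phi> x * pd i \<psi> x + \<psi> x * pd i \<phi> x)"
    using \<phi> \<psi> by (auto simp: pd_mult test_fun_smooth smooth_differentiable)
  moreover have "integrable lborel (\<lambda>x. \<phi> x * pd i \<psi> x)" "integrable lborel (\<lambda>x. \<psi> x * pd i \<phi> x)"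
    by (intro test_fun_integrable test_fun_mult smooth_mult_test_fun test_fun_pd smooth_pd \<phi> \<psi>)+
  ultimately show ?thesis by simp
qed

section \<open>Weak derivatives and density of test functions\<close>

definition weak_pd :: "2 \<Rightarrow> (real^2 \<Rightarrow> real) \<Rightarrow> (real^2 \<Rightarrow> real) \<Rightarrow> bool" where
  "weak_pd i u g \<longleftrightarrow> (\<forall>\<phi>. test_fun \<phi> \<longrightarrow>
     (\<integral>x. u x * pd i \<phi> x \<partial>lborel) = - (\<integral>x. \<phi> x * g x \<partial>lborel))"

text \<open>The derivative falls on the kernel, and the weak derivative is then tested with y -> K(x
  - y); the sign from the reflection cancels the one from integration by parts.\<close>

lemma pd_conv_weak:
  assumes K: "test_fun K" and u: "L2 u" and w: "weak_pd i u g"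
  shows "pd i (conv K u) = conv K g"
proof
  fix x
  have d: "K differentiable (at y)" for y by (intro smooth_differentiable test_fun_smooth K)
  have "pd i (\<lambda>y. K (x - y)) = (\<lambda>y. - pd i K (x - y))"
    using pd_affine[of K i "-1" x, OF d] by auto
  moreover have "(\<integral>y. u y * pd i (\<lambda>y. K (x - y)) y \<partial>lborel) = - (\<integral>y. K (x - y) * g y \<partial>lborel)"
    using w test_fun_reflect[OF K] unfolding weak_pd_def by blast
  ultimately show "pd i (conv K u) x = conv K g x"
    by (simp add: pd_conv[OF K u] conv_def mult.commute)
qed

lemma weak_pd_test_fun: "test_fun \<psi> \<Longrightarrow> weak_pd i \<psi> (pd i \<psi>)"
  unfolding weak_pd_def using integral_by_parts[OF test_fun_smooth] by blast

text \<open>Equal to 1 at the origin, hence pointwise convergent to 1, with a gradient of order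
  1/(n+1).\<close>

definition cutoff :: "nat \<Rightarrow> real^2 \<Rightarrow> real" where
  "cutoff n x = bump ((1 / real (Suc n)) *\<^sub>R x) / bump 0"

lemma test_fun_cutoff: "test_fun (cutoff n)"
proof -
  have "test_fun (\<lambda>x. bump ((1 / real (Suc n)) *\<^sub>R x + 0))" by (intro test_fun_affine test_fun_bump) simp
  from test_fun_mult[OF this smooth_const[of "1 / bump 0"]] show ?thesis
    by (simp add: cutoff_def[abs_def])
qed

lemma scale_tendsto_0: "(\<lambda>n. (1 / real (Suc n)) *\<^sub>R x) \<longlonglongrightarrow> (0::real^2)"
  using tendsto_scaleR[OF LIMSEQ_inverse_real_of_nat tendsto_const[of x]] by (simp add: inverse_eq_divide)

lemma smooth_scale_tendsto:
  "smooth \<phi> \<Longrightarrow> (\<lambda>n. \<phi> ((1 / real (Suc n)) *\<^sub>R x)) \<longlonglongrightarrow> \<phi> 0"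
  using isCont_tendsto_compose[OF _ scale_tendsto_0, of \<phi>] smooth_continuous[of \<phi> UNIV]
  by (simp add: continuous_on_eq_continuous_at)

lemma pd_cutoff:
  "pd i (cutoff n) x = (1 / real (Suc n)) * (pd i bump ((1 / real (Suc n)) *\<^sub>R x) / bump 0)"
proof -
  have d: "bump differentiable (at x)" for x by (intro smooth_differentiable bump_smooth)
  define A where "A x = bump ((1 / real (Suc n)) *\<^sub>R x + 0)" for x
  have "smooth A" unfolding A_def[abs_def] by (intro smooth_affine bump_smooth)
  have A: "pd i A x = (1 / real (Suc n)) * pd i bump ((1 / real (Suc n)) *\<^sub>R x + 0)"
    unfolding A_def[abs_def] by (rule pd_affine[OF d])
  have "pd i (\<lambda>x. A x * (1 / bump 0)) x = A x * pd i (\<lambda>x. 1 / bump 0) x + pd i A x * (1 / bump 0)"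
    by (rule pd_mult) (auto intro: smooth_differentiable \<open>smooth A\<close>)
  moreover have "cutoff n = (\<lambda>x. A x * (1 / bump 0))" by (auto simp: cutoff_def A_def)
  ultimately show ?thesis by (simp add: A)
qed

text \<open>Mollify and cut off. By the product rule the derivative is the cut off mollification of
  \<open>g i\<close> plus a term with the derivative of the cutoff, which tends to 0.\<close>

lemma test_fun_dense_H1:
  assumes u: "L2 u" and g: "\<And>i. L2 (g i)" and w: "\<And>i. weak_pd i u (g i)"
  obtains \<phi> where "\<And>n. test_fun (\<phi> n)" "L2lim \<phi> u" "\<And>i. L2lim (\<lambda>n. pd i (\<phi> n)) (g i)"
proof -
  note M = mollifierD[OF mollifier_moll]
  define \<phi> where "\<phi> n x = cutoff n x * conv (moll n) u x" for n x
  have sm: "smooth (conv (moll n) u)" for n by (intro smooth_conv M u)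
  obtain B where B: "\<And>x. \<bar>bump x\<bar> \<le> B" "B > 0" using test_fun_bounded[OF test_fun_bump] by blast
  have "\<exists>B>0. \<forall>x. \<bar>pd i bump x\<bar> \<le> B" for i
    using test_fun_bounded[OF test_fun_pd[OF test_fun_bump]] by metis
  then obtain B' where B': "\<And>i x. \<bar>pd i bump x\<bar> \<le> B' i" "\<And>i. B' i > 0" by metis
  \<comment> \<open>The maximum with 1 makes the same constant bound the limit of the
    cutoffs.\<close>
  have cb: "\<bar>cutoff n x\<bar> \<le> max (B / bump 0) 1" for n x
  proof -
    have "\<bar>cutoff n x\<bar> \<le> B / bump 0"
      unfolding cutoff_def abs_divide using B bump_0 by (simp add: divide_right_mono)
    then show ?thesis by simp
  qed
  have cl: "(\<lambda>n. cutoff n x) \<longlonglongrightarrow> 1" for x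
    using tendsto_divide[OF smooth_scale_tendsto[OF bump_smooth] tendsto_const[of "bump 0"]] bump_0
    by (simp add: cutoff_def)
  have c'b: "\<bar>pd i (cutoff n) x\<bar> \<le> B' i / bump 0" for n i x
  proof -
    have "\<bar>pd i (cutoff n) x\<bar> = (1 / real (Suc n)) * (\<bar>pd i bump ((1 / real (Suc n)) *\<^sub>R x)\<bar> / bump 0)"
      unfolding pd_cutoff using bump_0 by (simp add: abs_mult)
    also have "\<dots> \<le> 1 * (B' i / bump 0)"
      using B' bump_0 by (intro mult_mono divide_right_mono) (auto simp: less_imp_le)
    finally show ?thesis by simp
  qed
  have c'l: "(\<lambda>n. pd i (cutoff n) x) \<longlonglongrightarrow> 0" for i x
  proof -
    have "(\<lambda>n. (1 / real (Suc n)) * (pd i bump ((1 / real (Suc n)) *\<^sub>R x) / bump 0)) \<longlonglongrightarrow> 0 * (pd i bump 0 / bump 0)"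
      using LIMSEQ_inverse_real_of_nat bump_0
      by (intro tendsto_mult tendsto_divide smooth_scale_tendsto smooth_pd bump_smooth tendsto_const)
         (auto simp: inverse_eq_divide)
    then show ?thesis unfolding pd_cutoff by simp
  qed
  have pdphi: "pd i (\<phi> n) = (\<lambda>x. cutoff n x * conv (moll n) (g i) x + pd i (cutoff n) x * conv (moll n) u x)" for i n
    unfolding \<phi>_def[abs_def]
    by (auto simp: fun_eq_iff pd_mult smooth_differentiable sm test_fun_smooth test_fun_cutoff pd_conv_weak[OF M(1) u w])
  show ?thesis
  proof
    show "test_fun (\<phi> n)" for n unfolding \<phi>_def[abs_def] by (intro test_fun_mult test_fun_cutoff sm)
    have "L2lim (\<lambda>n x. cutoff n x * conv (moll n) v x) (\<lambda>x. 1 * v x)" if "L2 v" for v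
      by (rule L2lim_mult_seq[OF conv_moll_L2lim[OF that] _ cb])
         (auto simp: cl test_fun_measurable test_fun_cutoff)
    note l1 = this[simplified]
    show "L2lim \<phi> u" unfolding \<phi>_def[abs_def] by (rule l1[OF u])
    have "L2lim (\<lambda>n x. pd i (cutoff n) x * conv (moll n) u x) (\<lambda>x. 0 * u x)" for i
      by (rule L2lim_mult_seq[OF conv_moll_L2lim[OF u] _ c'b])
         (auto simp: c'l test_fun_measurable test_fun_cutoff test_fun_pd less_imp_le[OF B'(2)] less_imp_le[OF bump_0])
    from L2lim_add[OF l1[OF g] this]
    show "L2lim (\<lambda>n. pd i (\<phi> n)) (g i)" for i unfolding pdphi by simp
  qed
qed

section \<open>Exponential integrability\<close>

definition pt :: "real \<times> real \<Rightarrow> real^2" where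
  "pt z = fst z *\<^sub>R axis 1 1 + snd z *\<^sub>R axis 2 1"

lemma pt_nth [simp]: "pt (a, b) $ 1 = a" "pt (a, b) $ 2 = b"
  by (auto simp: pt_def axis_def)

lemma pt_measurable [measurable]: "pt \<in> borel_measurable borel"
  unfolding pt_def by (intro borel_measurable_continuous_onI continuous_intros)

lemma Basis_vec_2: "(Basis :: (real^2) set) = {axis 1 1, axis 2 1}"
  by (auto simp: Basis_vec_def UNIV_2)

text \<open>A measure with the right values on boxes is Lebesgue measure; this turns plane integrals
  into iterated ones in either order.\<close>

lemma lborel_pt: "distr (lborel \<Otimes>\<^sub>M lborel) borel pt = lborel"
proof (rule lborel_eqI[symmetric])
  have [measurable]: "pt \<in> (lborel \<Otimes>\<^sub>M lborel) \<rightarrow>\<^sub>M borel"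
    using pt_measurable by (simp add: lborel_prod)
  fix l u :: "real^2" assume le: "\<And>b. b \<in> Basis \<Longrightarrow> l \<bullet> b \<le> u \<bullet> b"
  have le': "l $ 1 \<le> u $ 1" "l $ 2 \<le> u $ 2"
    using le[of "axis 1 1"] le[of "axis 2 1"] by (auto simp: Basis_vec_2 inner_axis)
  have "pt -` box l u = {l $ 1<..<u $ 1} \<times> {l $ 2<..<u $ 2}"
    by (auto simp: mem_box_cart forall_2)
  then have "emeasure (distr (lborel \<Otimes>\<^sub>M lborel) borel pt) (box l u)
      = emeasure (lborel \<Otimes>\<^sub>M lborel) ({l $ 1<..<u $ 1} \<times> {l $ 2<..<u $ 2})"
    by (subst emeasure_distr) (auto simp: space_pair_measure)
  also have "\<dots> = ennreal (u $ 1 - l $ 1) * ennreal (u $ 2 - l $ 2)"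
    using le' by (subst lborel.emeasure_pair_measure_Times) auto
  also have "\<dots> = ennreal (\<Prod>b\<in>Basis. (u - l) \<bullet> b)"
    using le' by (simp add: Basis_vec_2 axis_eq_axis inner_axis ennreal_mult)
  finally show "emeasure (distr (lborel \<Otimes>\<^sub>M lborel) borel pt) (box l u) = ennreal (\<Prod>b\<in>Basis. (u - l) \<bullet> b)" .
qed simp

lemma nn_integral_pt:
  assumes [measurable]: "h \<in> borel_measurable borel"
  shows "(\<integral>\<^sup>+x. h x \<partial>lborel) = (\<integral>\<^sup>+a. \<integral>\<^sup>+b. h (pt (a, b)) \<partial>lborel \<partial>lborel)"
    and "(\<integral>\<^sup>+x. h x \<partial>lborel) = (\<integral>\<^sup>+b. \<integral>\<^sup>+a. h (pt (a, b)) \<partial>lborel \<partial>lborel)"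
proof -
  have [measurable]: "pt \<in> (lborel \<Otimes>\<^sub>M lborel) \<rightarrow>\<^sub>M borel"
    using pt_measurable by (simp add: lborel_prod)
  have eq: "(\<integral>\<^sup>+x. h x \<partial>lborel) = (\<integral>\<^sup>+z. h (pt z) \<partial>(lborel \<Otimes>\<^sub>M lborel))"
    by (subst lborel_pt[symmetric], subst nn_integral_distr) auto
  show "(\<integral>\<^sup>+x. h x \<partial>lborel) = (\<integral>\<^sup>+a. \<integral>\<^sup>+b. h (pt (a, b)) \<partial>lborel \<partial>lborel)"
    unfolding eq by (rule lborel.nn_integral_fst[symmetric]) simp
  show "(\<integral>\<^sup>+x. h x \<partial>lborel) = (\<integral>\<^sup>+b. \<integral>\<^sup>+a. h (pt (a, b)) \<partial>lborel \<partial>lborel)"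
    unfolding eq by (subst lborel_pair.nn_integral_snd[symmetric]) auto
qed

lemma compact_support_FTC_bound:
  fixes k k' :: "real \<Rightarrow> real"
  assumes d: "\<And>s. (k has_real_derivative k' s) (at s)" and c: "continuous_on UNIV k'"
    and out: "\<And>s. \<bar>s\<bar> > R \<Longrightarrow> k s = 0"
  shows "ennreal \<bar>k t\<bar> \<le> (\<integral>\<^sup>+s. ennreal \<bar>k' s\<bar> \<partial>lborel)"
proof -
  \<comment> \<open>A point to the left of both \<open>t\<close> and the support, so that
    \<open>k r\<close> is 0.\<close>
  define r where "r = min (t - 1) (- \<bar>R\<bar> - 1)"
  have r: "k r = 0" "r \<le> t" by (auto simp: r_def out)
  have fi: "integrable lborel (\<lambda>s. k' s * indicator {r..t} s)"
    and eq: "(\<integral>s. k' s * indicator {r..t} s \<partial>lborel) = k t - k r"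
    using integral_FTC_Icc_real[OF r(2) d] borel_integrable_atLeastAtMost[of r t k'] c
    by (auto simp: continuous_on_eq_continuous_at mult.commute[of "k' _"])
  have "ennreal \<bar>k t\<bar> = ennreal (norm (\<integral>s. k' s * indicator {r..t} s \<partial>lborel))"
    using r eq by simp
  also have "\<dots> \<le> (\<integral>\<^sup>+s. ennreal (norm (k' s * indicator {r..t} s)) \<partial>lborel)"
    by (rule integral_norm_bound_ennreal[OF fi])
  also have "\<dots> \<le> (\<integral>\<^sup>+s. ennreal \<bar>k' s\<bar> \<partial>lborel)"
    by (intro nn_integral_mono) (auto simp: indicator_def)
  finally show ?thesis .
qed

lemma abs_le_norm_pt: "\<bar>a\<bar> \<le> norm (pt (a, b))" "\<bar>b\<bar> \<le> norm (pt (a, b))"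
  using component_le_norm_cart[of "pt (a, b)" 1] component_le_norm_cart[of "pt (a, b)" 2] by simp_all

lemma DERIV_along_axis:
  assumes "w differentiable (at (x + s *\<^sub>R axis i 1))"
  shows "((\<lambda>s. w (x + s *\<^sub>R axis i 1)) has_real_derivative pd i w (x + s *\<^sub>R axis i 1)) (at s)"
proof -
  have "((\<lambda>s. w (x + s *\<^sub>R axis i 1)) has_derivative
     (\<lambda>h. \<Sum>j\<in>UNIV. pd j w (x + s *\<^sub>R axis i 1) * (h *\<^sub>R axis i 1 :: real^2) $ j)) (at s)"
    by (rule has_derivative_compose[where f = "\<lambda>s. x + s *\<^sub>R axis i 1" and f' = "\<lambda>h. h *\<^sub>R axis i 1",
        OF _ has_derivative_pd[OF assms]])
       (auto intro!: derivative_eq_intros)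
  then show ?thesis
    by (simp add: has_field_derivative_def axis_def if_distrib[of "\<lambda>t. _ * t"] mult.commute[of _ "pd i w _"] cong: if_cong)
qed

text \<open>The argument of Gagliardo and Nirenberg: |w(a,b)| is at most \<open>P b\<close>, the
  integral of |d_1 w| along the horizontal line, and at most \<open>Q a\<close>, that of |d_2 w|
  along the vertical one. The product \<open>Q a * P b\<close> integrates to the product of the
  integrals.\<close>

lemma Sobolev_L1:
  assumes d: "\<And>x. w differentiable (at x)" and c: "\<And>i. continuous_on UNIV (pd i w)"
    and out: "\<And>x. norm x > R \<Longrightarrow> w x = 0"
  shows "(\<integral>\<^sup>+x. ennreal ((w x)\<^sup>2) \<partial>lborel)
    \<le> (\<integral>\<^sup>+x. ennreal \<bar>pd 1 w x\<bar> \<partial>lborel) * (\<integral>\<^sup>+x. ennreal \<bar>pd 2 w x\<bar> \<partial>lborel)"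
proof -
  have "continuous_on UNIV w"
    using d by (auto intro: continuous_at_imp_continuous_on differentiable_imp_continuous_within)
  then have [measurable]: "w \<in> borel_measurable borel" by (rule borel_measurable_continuous_onI)
  have [measurable]: "pd i w \<in> borel_measurable borel" for i by (rule borel_measurable_continuous_onI[OF c])
  have [measurable]: "(\<lambda>(a, b). h (pt (a, b))) \<in> borel_measurable (lborel \<Otimes>\<^sub>M lborel)"
    if [measurable]: "h \<in> borel_measurable borel" for h :: "real^2 \<Rightarrow> ennreal"
  proof -
    have [measurable]: "pt \<in> (lborel \<Otimes>\<^sub>M lborel) \<rightarrow>\<^sub>M borel"
      using pt_measurable by (simp add: lborel_prod)
    have "(\<lambda>z. h (pt z)) \<in> borel_measurable (lborel \<Otimes>\<^sub>M lborel)" by measurable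
    then show ?thesis by (simp add: case_prod_unfold)
  qed
  define P where "P b = (\<integral>\<^sup>+s. ennreal \<bar>pd 1 w (pt (s, b))\<bar> \<partial>lborel)" for b
  define Q where "Q a = (\<integral>\<^sup>+s. ennreal \<bar>pd 2 w (pt (a, s))\<bar> \<partial>lborel)" for a
  have "(\<lambda>(b, a). ennreal \<bar>pd 1 w (pt (a, b))\<bar>) \<in> borel_measurable (lborel \<Otimes>\<^sub>M lborel)"
    by (rule measurable_pair_swap[of "\<lambda>(a, b). ennreal \<bar>pd 1 w (pt (a, b))\<bar>", simplified case_prod_conv]) measurable
  then have [measurable]: "P \<in> borel_measurable borel"
    unfolding P_def by (auto dest!: lborel.borel_measurable_nn_integral_fst)
  have "(\<lambda>(a, b). ennreal \<bar>pd 2 w (pt (a, b))\<bar>) \<in> borel_measurable (lborel \<Otimes>\<^sub>M lborel)" by measurable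
  then have [measurable]: "Q \<in> borel_measurable borel"
    unfolding Q_def by (auto dest!: lborel.borel_measurable_nn_integral_fst)
  have P: "ennreal \<bar>w (pt (a, b))\<bar> \<le> P b" for a b
  proof -
    have eq: "pt (s, b) = b *\<^sub>R axis 2 1 + s *\<^sub>R axis 1 1" for s by (simp add: pt_def add.commute)
    show ?thesis
      unfolding P_def
    proof (rule compact_support_FTC_bound[where k = "\<lambda>s. w (pt (s, b))" and t = a])
      show "((\<lambda>s. w (pt (s, b))) has_real_derivative pd 1 w (pt (s, b))) (at s)" for s
        unfolding eq by (rule DERIV_along_axis[OF d])
      show "continuous_on UNIV (\<lambda>s. pd 1 w (pt (s, b)))"
        unfolding eq by (intro continuous_on_compose2[OF c] continuous_intros) auto
      show "w (pt (s, b)) = 0" if "\<bar>s\<bar> > R" for s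
        using abs_le_norm_pt(1)[of s b] that by (intro out) linarith
    qed
  qed
  have Q: "ennreal \<bar>w (pt (a, b))\<bar> \<le> Q a" for a b
  proof -
    have eq: "pt (a, s) = a *\<^sub>R axis 1 1 + s *\<^sub>R axis 2 1" for s by (simp add: pt_def)
    show ?thesis
      unfolding Q_def
    proof (rule compact_support_FTC_bound[where k = "\<lambda>s. w (pt (a, s))" and t = b])
      show "((\<lambda>s. w (pt (a, s))) has_real_derivative pd 2 w (pt (a, s))) (at s)" for s
        unfolding eq by (rule DERIV_along_axis[OF d])
      show "continuous_on UNIV (\<lambda>s. pd 2 w (pt (a, s)))"
        unfolding eq by (intro continuous_on_compose2[OF c] continuous_intros) auto
      show "w (pt (a, s)) = 0" if "\<bar>s\<bar> > R" for s
        using abs_le_norm_pt(2)[of s a] that by (intro out) linarith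
    qed
  qed
  have "(\<integral>\<^sup>+x. ennreal ((w x)\<^sup>2) \<partial>lborel) = (\<integral>\<^sup>+a. \<integral>\<^sup>+b. ennreal ((w (pt (a, b)))\<^sup>2) \<partial>lborel \<partial>lborel)"
    by (rule nn_integral_pt) measurable
  also have "\<dots> \<le> (\<integral>\<^sup>+a. \<integral>\<^sup>+b. Q a * P b \<partial>lborel \<partial>lborel)"
  proof (intro nn_integral_mono)
    fix a b
    have "ennreal ((w (pt (a, b)))\<^sup>2) = ennreal \<bar>w (pt (a, b))\<bar> * ennreal \<bar>w (pt (a, b))\<bar>"
      by (simp add: ennreal_mult[symmetric] power2_eq_square)
    also have "\<dots> \<le> Q a * P b" by (intro mult_mono P Q) auto
    finally show "ennreal ((w (pt (a, b)))\<^sup>2) \<le> Q a * P b" .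
  qed
  also have "\<dots> = (\<integral>\<^sup>+b. P b \<partial>lborel) * (\<integral>\<^sup>+a. Q a \<partial>lborel)"
    by (simp add: nn_integral_cmult nn_integral_multc mult.commute)
  also have "(\<integral>\<^sup>+b. P b \<partial>lborel) = (\<integral>\<^sup>+x. ennreal \<bar>pd 1 w x\<bar> \<partial>lborel)"
    unfolding P_def by (rule nn_integral_pt(2)[symmetric]) measurable
  also have "(\<integral>\<^sup>+a. Q a \<partial>lborel) = (\<integral>\<^sup>+x. ennreal \<bar>pd 2 w x\<bar> \<partial>lborel)"
    unfolding Q_def by (rule nn_integral_pt(1)[symmetric]) measurable
  finally show ?thesis .
qed

section \<open>Smoothed truncations and the decay of superlevel sets\<close>

definition tent :: "real \<Rightarrow> real \<Rightarrow> real \<Rightarrow> real" where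
  "tent a h s = max 0 (s - a) - 2 * max 0 (s - a - h) + max 0 (s - a - 2 * h)"

text \<open>The primitive of the hat \<open>tent\<close>, which is supported in [a, a + 2h] with
  peak h. Hence this function climbs from 0 to h^2 across the slab. The hat replaces the derivative
  of a sharp truncation, an indicator, so that the composition is continuously differentiable and
  the classical chain rule applies.\<close>

definition ramp :: "real \<Rightarrow> real \<Rightarrow> real \<Rightarrow> real" where
  "ramp a h s = (max 0 (s - a))\<^sup>2 / 2 - (max 0 (s - a - h))\<^sup>2 + (max 0 (s - a - 2 * h))\<^sup>2 / 2"

lemma DERIV_max_square: "((\<lambda>s::real. (max 0 s)\<^sup>2 / 2) has_real_derivative max 0 t) (at t)"
proof (cases t "0::real" rule: linorder_cases)
  case less
  show ?thesis
  proof (rule has_field_derivative_transform_within_open[where f = "\<lambda>t. 0" and S = "{..<0}"])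
    show "((\<lambda>s::real. 0) has_real_derivative max 0 t) (at t)" using less by simp
  qed (use less in auto)
next
  case greater
  show ?thesis
  proof (rule has_field_derivative_transform_within_open[where f = "\<lambda>s. s\<^sup>2 / 2" and S = "{0<..}"])
    show "((\<lambda>s::real. s\<^sup>2 / 2) has_real_derivative max 0 t) (at t)"
      using greater by (auto intro!: derivative_eq_intros)
  qed (use greater in auto)
next
  case equal
  have "(\<lambda>h::real. (max 0 h)\<^sup>2 / 2 / h) \<midarrow>0\<rightarrow> 0"
  proof (rule Lim_null_comparison)
    show "\<forall>\<^sub>F h in at 0. norm ((max 0 h)\<^sup>2 / 2 / h) \<le> \<bar>h\<bar>"
      by (intro always_eventually) (auto simp: max_def power2_eq_square)
    show "(\<lambda>h::real. \<bar>h\<bar>) \<midarrow>0\<rightarrow> 0" by (auto intro!: tendsto_eq_intros)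
  qed
  then show ?thesis by (simp add: equal DERIV_def)
qed

lemma DERIV_ramp: "(ramp a h has_real_derivative tent a h s) (at s)"
proof -
  have *: "((\<lambda>s. (max 0 (s - c))\<^sup>2 / 2) has_real_derivative max 0 (s - c)) (at s)" for c
    using DERIV_shift[of "\<lambda>s. (max 0 s)\<^sup>2 / 2" "max 0 (s - c)" s "- c"] DERIV_max_square[of "s - c"] by simp
  have "((\<lambda>s. (max 0 (s - a))\<^sup>2 / 2 - 2 * ((max 0 (s - (a + h)))\<^sup>2 / 2) + (max 0 (s - (a + 2 * h)))\<^sup>2 / 2)
    has_real_derivative max 0 (s - a) - 2 * max 0 (s - (a + h)) + max 0 (s - (a + 2 * h))) (at s)"
    by (intro DERIV_add DERIV_diff DERIV_cmult *)
  then show ?thesis by (simp add: ramp_def[abs_def] tent_def diff_diff_eq)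
qed

lemma tent:
  assumes "h > 0"
  shows "0 \<le> tent a h s" "tent a h s \<le> h" "s < a \<or> s \<ge> a + 2 * h \<Longrightarrow> tent a h s = 0"
    "\<bar>tent a h s - tent a h t\<bar> \<le> 4 * \<bar>s - t\<bar>"
proof -
  show "0 \<le> tent a h s" "tent a h s \<le> h" "s < a \<or> s \<ge> a + 2 * h \<Longrightarrow> tent a h s = 0"
    using assms by (auto simp: tent_def max_def)
  have m: "\<bar>max 0 (s - c) - max 0 (t - c)\<bar> \<le> \<bar>s - t\<bar>" for c
    by (auto simp: max_def abs_if)
  have "\<bar>x - 2 * y + z - (x' - 2 * y' + z')\<bar> \<le> 4 * d"
    if "\<bar>x - x'\<bar> \<le> d" "\<bar>y - y'\<bar> \<le> d" "\<bar>z - z'\<bar> \<le> d" for x y z x' y' z' d :: real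
    using that by linarith
  from this[OF m[of a] m[of "a + h"] m[of "a + 2 * h"]]
  show "\<bar>tent a h s - tent a h t\<bar> \<le> 4 * \<bar>s - t\<bar>"
    unfolding tent_def diff_diff_eq .
qed

lemma tent_continuous: "continuous_on UNIV (tent a h)"
  unfolding tent_def by (intro continuous_intros)

lemma tent_measurable [measurable]: "tent a h \<in> borel_measurable borel"
  by (rule borel_measurable_continuous_onI[OF tent_continuous])

lemma ramp_measurable [measurable]: "ramp a h \<in> borel_measurable borel"
  unfolding ramp_def by measurable

lemma ramp_above: "h > 0 \<Longrightarrow> s \<ge> a + 2 * h \<Longrightarrow> ramp a h s = h\<^sup>2"
  by (simp add: ramp_def max_def power2_eq_square field_simps)

lemma ramp_0: "h > 0 \<Longrightarrow> a \<ge> 0 \<Longrightarrow> ramp a h 0 = 0"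
  by (simp add: ramp_def)

lemma ramp_Lipschitz:
  assumes "h > 0" shows "\<bar>ramp a h s - ramp a h t\<bar> \<le> h * \<bar>s - t\<bar>"
proof -
  have "norm (ramp a h s - ramp a h t) \<le> h * norm (s - t)"
  proof (rule field_differentiable_bound[of UNIV])
    show "(ramp a h has_field_derivative tent a h x) (at x within UNIV)" for x by (rule DERIV_ramp)
    show "norm (tent a h x) \<le> h" for x using tent(1,2)[OF assms, of a x] by simp
  qed auto
  then show ?thesis by simp
qed

lemma L2_abs: "L2 u \<Longrightarrow> L2 (\<lambda>x. \<bar>u x\<bar>)"
  by (auto simp: L2_def)

lemma L2lim_abs: "L2lim U u \<Longrightarrow> L2lim (\<lambda>n x. \<bar>U n x\<bar>) (\<lambda>x. \<bar>u x\<bar>)"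
  by (rule L2lim_Lipschitz[of U u "\<lambda>s. \<bar>s\<bar>" 1]) auto

text \<open>For test functions this is \<open>Sobolev_L1\<close> applied to the composition. Both
  \<open>ramp a h\<close> and \<open>tent a h\<close> are Lipschitz and vanish at 0, so they respect
  L2 limits and the inequality survives the passage to \<open>u\<close>.\<close>

lemma ramp_Sobolev:
  assumes u: "L2 u" and g: "\<And>i. L2 (g i)" and w: "\<And>i. weak_pd i u (g i)" and "h > 0" "a \<ge> 0"
  shows "(\<integral>x. ramp a h (u x) * ramp a h (u x) \<partial>lborel)
    \<le> (\<integral>x. tent a h (u x) * \<bar>g 1 x\<bar> \<partial>lborel) * (\<integral>x. tent a h (u x) * \<bar>g 2 x\<bar> \<partial>lborel)"
proof -
  obtain \<phi> where \<phi>: "\<And>n. test_fun (\<phi> n)" and l: "L2lim \<phi> u" "\<And>i. L2lim (\<lambda>n. pd i (\<phi> n)) (g i)"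
    using test_fun_dense_H1[OF u g w] by blast
  have lr: "L2lim (\<lambda>n x. ramp a h (\<phi> n x)) (\<lambda>x. ramp a h (u x))"
    by (rule L2lim_Lipschitz[OF l(1) ramp_Lipschitz[OF \<open>h > 0\<close>] ramp_0]) (use assms in auto)
  have lt: "L2lim (\<lambda>n x. tent a h (\<phi> n x)) (\<lambda>x. tent a h (u x))"
    by (rule L2lim_Lipschitz[OF l(1) tent(4)[OF \<open>h > 0\<close>]]) (use assms in \<open>auto simp: tent_def\<close>)
  have le: "(\<integral>x. ramp a h (\<phi> n x) * ramp a h (\<phi> n x) \<partial>lborel)
    \<le> (\<integral>x. tent a h (\<phi> n x) * \<bar>pd 1 (\<phi> n) x\<bar> \<partial>lborel) * (\<integral>x. tent a h (\<phi> n x) * \<bar>pd 2 (\<phi> n) x\<bar> \<partial>lborel)" for n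
  proof -
    define \<psi> where "\<psi> x = ramp a h (\<phi> n x)" for x
    note sm = test_fun_smooth[OF \<phi>[of n]]
    have d: "\<psi> differentiable (at x)" "pd i \<psi> x = tent a h (\<phi> n x) * pd i (\<phi> n) x" for x i
      unfolding \<psi>_def[abs_def] using pd_chain[OF smooth_differentiable[OF sm] DERIV_ramp] by auto
    obtain R where R: "\<And>x. norm x > R \<Longrightarrow> \<phi> n x = 0" using \<phi>[of n] by (auto simp: test_fun_iff)
    have c: "continuous_on UNIV (pd i \<psi>)" for i
    proof -
      have "continuous_on UNIV (\<lambda>x. tent a h (\<phi> n x) * pd i (\<phi> n) x)"
        using sm by (intro continuous_on_mult continuous_on_compose2[OF tent_continuous] smooth_continuous smooth_pd) auto
      then show ?thesis by (simp add: d(2) cong: continuous_on_cong)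
    qed
    have int: "integrable lborel (\<lambda>x. tent a h (\<phi> n x) * \<bar>pd i (\<phi> n) x\<bar>)" for i
      by (intro L2_mult_integrable L2limD(1)[OF lt] L2_abs L2limD(1)[OF l(2)])
    have nn: "(\<integral>\<^sup>+x. ennreal \<bar>pd i \<psi> x\<bar> \<partial>lborel) = ennreal (\<integral>x. tent a h (\<phi> n x) * \<bar>pd i (\<phi> n) x\<bar> \<partial>lborel)" for i
      using nn_integral_eq_integral[OF int[of i]] tent(1)[OF \<open>h > 0\<close>]
      by (simp add: d abs_mult)
    have "ennreal (\<integral>x. ramp a h (\<phi> n x) * ramp a h (\<phi> n x) \<partial>lborel) = (\<integral>\<^sup>+x. ennreal ((\<psi> x)\<^sup>2) \<partial>lborel)"
      unfolding \<psi>_def power2_eq_square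
      by (intro nn_integral_eq_integral[symmetric] L2_mult_integrable L2limD(1)[OF lr]) auto
    also have "\<dots> \<le> (\<integral>\<^sup>+x. ennreal \<bar>pd 1 \<psi> x\<bar> \<partial>lborel) * (\<integral>\<^sup>+x. ennreal \<bar>pd 2 \<psi> x\<bar> \<partial>lborel)"
    proof (rule Sobolev_L1[OF d(1) c])
      show "\<psi> x = 0" if "norm x > R" for x
        using R[OF that] ramp_0[OF \<open>h > 0\<close> \<open>a \<ge> 0\<close>] by (simp add: \<psi>_def)
    qed
    finally show ?thesis
      unfolding nn by (simp add: ennreal_mult[symmetric] tent(1)[OF \<open>h > 0\<close>] Bochner_Integration.integral_nonneg)
  qed
  show ?thesis
    by (rule LIMSEQ_le[OF L2lim_integral_mult[OF lr lr]
          tendsto_mult[OF L2lim_integral_mult[OF lt L2lim_abs[OF l(2)]] L2lim_integral_mult[OF lt L2lim_abs[OF l(2)]]]])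
       (use le in blast)
qed

lemma L2_indicator_mult:
  assumes "L2 u" "A \<in> sets borel" shows "L2 (\<lambda>x. indicator A x * u x)"
  by (rule L2_mult_bounded[OF assms(1) borel_measurable_indicator[OF assms(2)], of 1])
     (auto simp: indicator_def)

lemma L2_indicator_level:
  assumes u: "L2 u" and "a > 0"
  shows "L2 (indicator {x. u x \<ge> a})"
proof (rule L2_bound[OF u, of _ "1 / a"])
  note [measurable] = L2_measurable[OF u]
  show "indicator {x. u x \<ge> a} \<in> borel_measurable borel" by measurable
  show "\<bar>indicator {x. a \<le> u x} x\<bar> \<le> 1 / a * \<bar>u x\<bar>" for x
    using \<open>a > 0\<close> by (auto simp: indicator_def field_simps)
qed

lemma integrable_indicator_level:
  assumes u: "L2 u" and "a > 0"
  shows "integrable lborel (\<lambda>x. indicator {x. u x \<ge> a} x :: real)"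
  using L2_square_integrable[OF L2_indicator_level[OF assms]]
  by (simp add: indicator_def of_bool_def if_distrib[of "\<lambda>t. t ^ 2"] cong: if_cong)

text \<open>The Sobolev inequality for \<open>ramp a h\<close> composed with \<open>u\<close>, whose gradient lives on the slab
  \<open>a \<le> u < a + 2h\<close>, together with the Cauchy-Schwarz inequality on that slab.\<close>

lemma level_set_step:
  assumes u: "L2 u" and g: "\<And>i. L2 (g i)" and w: "\<And>i. weak_pd i u (g i)" and "h > 0" "a > 0"
  defines "\<mu> \<equiv> \<lambda>a. \<integral>x. indicator {x. u x \<ge> a} x \<partial>lborel"
  shows "h\<^sup>2 * \<mu> (a + 2 * h) \<le> (\<integral>x. indicator {x. a \<le> u x \<and> u x < a + 2 * h} x * ((g 1 x)\<^sup>2 + (g 2 x)\<^sup>2) \<partial>lborel) * \<mu> a"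
proof -
  note [measurable] = L2_measurable[OF u] L2_measurable[OF g]
  let ?A = "{x. a \<le> u x \<and> u x < a + 2 * h}"
  have A [measurable]: "?A \<in> sets borel" by measurable
  have iA: "L2 (indicator ?A)"
    by (rule L2_bound[OF L2_indicator_level[OF u \<open>a > 0\<close>], of _ 1]) (auto simp: indicator_def)
  have int\<mu>: "integrable lborel (\<lambda>x. indicator {x. u x \<ge> b} x :: real)" if "b > 0" for b
    by (rule integrable_indicator_level[OF u that])
  have intA: "integrable lborel (\<lambda>x. indicator ?A x :: real)"
    using L2_square_integrable[OF iA]
    by (simp add: indicator_def of_bool_def if_distrib[of "\<lambda>t. t ^ 2"] cong: if_cong)
  have Ale: "(\<integral>x. indicator ?A x \<partial>lborel) \<le> \<mu> a"
    unfolding \<mu>_def by (intro integral_mono intA int\<mu> \<open>a > 0\<close>) (auto simp: indicator_def)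
  have \<mu>0: "\<mu> b \<ge> 0" for b by (simp add: \<mu>_def)
  define G where "G i = (\<integral>x. indicator ?A x * (g i x)\<^sup>2 \<partial>lborel)" for i
  have iG: "integrable lborel (\<lambda>x. indicator ?A x * (g i x)\<^sup>2)" for i
    by (rule Bochner_Integration.integrable_bound[OF L2_square_integrable[OF g[of i]]]) (auto simp: indicator_def)
  have G0: "G i \<ge> 0" for i by (auto simp: G_def intro!: Bochner_Integration.integral_nonneg)
  define T where "T i = (\<integral>x. tent a h (u x) * \<bar>g i x\<bar> \<partial>lborel)" for i
  have t_le: "tent a h s \<le> h * (if a \<le> s \<and> s < a + 2 * h then 1 else 0)" for s
    using tent(2)[OF \<open>h > 0\<close>, of a s] tent(3)[OF \<open>h > 0\<close>, of s a] by auto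
  have T: "T i \<ge> 0" "(T i)\<^sup>2 \<le> h\<^sup>2 * (\<mu> a * G i)" for i
  proof -
    show T0: "T i \<ge> 0" using tent(1)[OF \<open>h > 0\<close>] by (auto simp: T_def intro!: Bochner_Integration.integral_nonneg)
    have "L2 (\<lambda>x. tent a h (u x))"
    proof (rule L2_bound[OF iA])
      show "\<bar>tent a h (u x)\<bar> \<le> h * \<bar>indicator ?A x\<bar>" for x
        using tent(1)[OF \<open>h > 0\<close>, of a "u x"] t_le[of "u x"] by (auto simp: indicator_def split: if_splits)
    qed measurable
    then have "T i \<le> (\<integral>x. h * (indicator ?A x * \<bar>g i x\<bar>) \<partial>lborel)"
      unfolding T_def
    proof (intro integral_mono integrable_mult_right L2_mult_integrable L2_abs g iA)
      show "tent a h (u x) * \<bar>g i x\<bar> \<le> h * (indicator ?A x * \<bar>g i x\<bar>)" for x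
        using mult_right_mono[OF t_le[of "u x"] abs_ge_zero[of "g i x"]] by (auto simp: indicator_def)
    qed
    \<comment> \<open>The indicator is doubled so that each factor in Cauchy-Schwarz carries one
      copy: one yields the measure of the slab, the other its energy.\<close>
    also have "\<dots> = h * (\<integral>x. indicator ?A x * (indicator ?A x * \<bar>g i x\<bar>) \<partial>lborel)"
    proof -
      have "indicator ?A x * (indicator ?A x * y) = indicator ?A x * y" for x and y :: real
        by (auto simp: indicator_def)
      then show ?thesis by (simp only: integral_mult_right_zero)
    qed
    finally have "(T i)\<^sup>2 \<le> (h * (\<integral>x. indicator ?A x * (indicator ?A x * \<bar>g i x\<bar>) \<partial>lborel))\<^sup>2"
      using T0 by (rule power_mono)
    also have "\<dots> = h\<^sup>2 * (\<integral>x. indicator ?A x * (indicator ?A x * \<bar>g i x\<bar>) \<partial>lborel)\<^sup>2"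
      by (rule power_mult_distrib)
    also have "(\<integral>x. indicator ?A x * (indicator ?A x * \<bar>g i x\<bar>) \<partial>lborel)\<^sup>2
        \<le> (\<integral>x. (indicator ?A x)\<^sup>2 \<partial>lborel) * (\<integral>x. (indicator ?A x * \<bar>g i x\<bar>)\<^sup>2 \<partial>lborel)"
      by (intro L2_Cauchy_Schwarz iA L2_indicator_mult L2_abs g A)
    also have "(\<integral>x. (indicator ?A x)\<^sup>2 \<partial>lborel) = (\<integral>x. indicator ?A x \<partial>lborel :: real)"
      by (intro Bochner_Integration.integral_cong) (auto simp: indicator_def)
    also have "(\<integral>x. (indicator ?A x * \<bar>g i x\<bar>)\<^sup>2 \<partial>lborel) = G i"
      unfolding G_def by (intro Bochner_Integration.integral_cong) (auto simp: indicator_def)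
    also have "(\<integral>x. indicator ?A x \<partial>lborel) * G i \<le> \<mu> a * G i"
      by (intro mult_right_mono Ale G0)
    finally show "(T i)\<^sup>2 \<le> h\<^sup>2 * (\<mu> a * G i)" using \<open>h > 0\<close> by (simp add: mult_left_mono)
  qed
  \<comment> \<open>\<open>ramp a h\<close> equals h^2 above the slab, so its square is h^4
    there.\<close>
  have "h ^ 4 * \<mu> (a + 2 * h) = (\<integral>x. h ^ 4 * indicator {x. u x \<ge> a + 2 * h} x \<partial>lborel)"
    by (simp add: \<mu>_def)
  also have "\<dots> \<le> (\<integral>x. ramp a h (u x) * ramp a h (u x) \<partial>lborel)"
  proof (intro integral_mono integrable_mult_right int\<mu>)
    have "L2 (\<lambda>x. ramp a h (u x))"
      by (rule L2_bound[OF u, of _ h])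
         (use ramp_Lipschitz[OF \<open>h > 0\<close>, of a _ 0] ramp_0[of h a] assms in auto)
    then show "integrable lborel (\<lambda>x. ramp a h (u x) * ramp a h (u x))" by (intro L2_mult_integrable)
    show "h ^ 4 * indicator {x. a + 2 * h \<le> u x} x \<le> ramp a h (u x) * ramp a h (u x)" for x
      using ramp_above[OF \<open>h > 0\<close>, of a "u x"] by (auto simp: indicator_def power2_eq_square power4_eq_xxxx)
  qed (use assms in auto)
  also have "\<dots> \<le> T 1 * T 2"
    unfolding T_def by (rule ramp_Sobolev[OF u g w]) (use assms in auto)
  also have "\<dots> \<le> (T 1)\<^sup>2 + (T 2)\<^sup>2"
    using abs_mult_le_sum_squares[of "T 1" "T 2"] by linarith
  also have "\<dots> \<le> h\<^sup>2 * ((G 1 + G 2) * \<mu> a)"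
    using T(2)[of 1] T(2)[of 2] by (simp add: algebra_simps)
  finally have "h\<^sup>2 * (h\<^sup>2 * \<mu> (a + 2 * h)) \<le> h\<^sup>2 * ((G 1 + G 2) * \<mu> a)"
    by (simp add: power2_eq_square power4_eq_xxxx mult.assoc)
  then have "h\<^sup>2 * \<mu> (a + 2 * h) \<le> (G 1 + G 2) * \<mu> a"
    by (rule mult_left_le_imp_le) (use \<open>h > 0\<close> in simp)
  also have "G 1 + G 2 = (\<integral>x. indicator ?A x * ((g 1 x)\<^sup>2 + (g 2 x)\<^sup>2) \<partial>lborel)"
    unfolding G_def using iG by (simp add: distrib_left)
  finally show ?thesis .
qed

text \<open>One term of the binomial expansion. It is the induction step by which the factors n + 1
  and the slab energies are absorbed into a power of the total energy.\<close>

lemma Suc_mult_power_le: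
  fixes x y :: real
  assumes "0 \<le> x" "0 \<le> y" shows "real (Suc n) * y * x ^ n \<le> (x + y) ^ Suc n"
proof (induction n)
  case (Suc n)
  have "real (Suc (Suc n)) * y * x ^ Suc n = x * (real (Suc n) * y * x ^ n) + y * x ^ Suc n"
    by (simp add: algebra_simps)
  also have "\<dots> \<le> x * (x + y) ^ Suc n + y * (x + y) ^ Suc n"
    using assms by (intro add_mono mult_left_mono Suc power_mono) auto
  finally show ?case by (simp add: algebra_simps)
qed (use assms in simp)

text \<open>With p and q the two roots, (p - q)(p + q) = 1 and p + q \<le> 2p, hence (p - q)/2 is at
  least 1/(4p). The square is the source of the constant 16 in the decay.\<close>

lemma sqrt_step: "1 / (16 * real (Suc n)) \<le> ((sqrt (real (Suc n)) - sqrt (real n)) / 2)\<^sup>2"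
proof -
  define p q where "p = sqrt (real (Suc n))" "q = sqrt (real n)"
  have pq: "0 < p" "0 \<le> q" "q \<le> p" "p\<^sup>2 = real (Suc n)" "q\<^sup>2 = real n" by (auto simp: p_q_def)
  have "(p - q) * (p + q) = 1" using pq by (simp add: algebra_simps power2_eq_square)
  then have "1 \<le> (p - q) * (2 * p)"
    using mult_left_mono[of "p + q" "2 * p" "p - q"] pq by simp
  then have "1 / (4 * p) \<le> (p - q) / 2" using pq by (simp add: field_simps)
  then have "(1 / (4 * p))\<^sup>2 \<le> ((p - q) / 2)\<^sup>2" using pq by (intro power_mono) auto
  then show ?thesis unfolding p_q_def(1)[symmetric] p_q_def(2)[symmetric]
    using pq by (simp add: power_divide power_mult_distrib)
qed

text \<open>The steps \<open>\<surd>(n+1) - \<surd>n\<close> cost a factor of order \<open>n!\<close>, which is absorbed by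
  \<open>n! \<Prod>d\<^sub>j \<le> (\<Sum>d\<^sub>j)\<^sup>n\<close> for the energies \<open>d\<^sub>j\<close> of the slabs.\<close>

lemma level_set_decay:
  assumes u: "L2 u" and g: "\<And>i. L2 (g i)" and w: "\<And>i. weak_pd i u (g i)" and "a > 0"
  defines "\<mu> \<equiv> \<lambda>a. \<integral>x. indicator {x. u x \<ge> a} x \<partial>lborel"
    and "E \<equiv> \<integral>x. indicator {x. u x \<ge> a} x * ((g 1 x)\<^sup>2 + (g 2 x)\<^sup>2) \<partial>lborel"
  shows "\<mu> (a + sqrt (real n)) \<le> (16 * E) ^ n * \<mu> a"
proof -
  note [measurable] = L2_measurable[OF u] L2_measurable[OF g]
  define s where "s n = a + sqrt (real n)" for n
  have s: "s n < s (Suc n)" "a \<le> s n" "s 0 = a" for n by (auto simp: s_def)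
  define G where "G x = (g 1 x)\<^sup>2 + (g 2 x)\<^sup>2" for x
  have G: "integrable lborel G" "\<And>x. G x \<ge> 0"
    using L2_square_integrable[OF g] by (auto simp: G_def[abs_def])
  have iG: "integrable lborel (\<lambda>x. indicator A x * G x)" if "A \<in> sets borel" for A
    by (rule Bochner_Integration.integrable_bound[OF G(1)])
       (use that in \<open>auto simp: indicator_def G_def[abs_def]\<close>)
  define D where "D n = (\<integral>x. indicator {x. a \<le> u x \<and> u x < s n} x * G x \<partial>lborel)" for n
  define d where "d n = (\<integral>x. indicator {x. s n \<le> u x \<and> u x < s (Suc n)} x * G x \<partial>lborel)" for n
  have D0: "D n \<ge> 0" "d n \<ge> 0" for n by (simp_all add: D_def d_def G(2))
  have DS: "D (Suc n) = D n + d n" for n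
  proof -
    have "D n + d n = (\<integral>x. indicator {x. a \<le> u x \<and> u x < s n} x * G x
        + indicator {x. s n \<le> u x \<and> u x < s (Suc n)} x * G x \<partial>lborel)"
      unfolding D_def d_def by (rule Bochner_Integration.integral_add[symmetric]; rule iG) measurable
    also have "\<dots> = D (Suc n)"
      unfolding D_def using s(1)[of n] s(2)[of n]
      by (intro Bochner_Integration.integral_cong) (auto simp: indicator_def)
    finally show ?thesis by simp
  qed
  have \<mu>0: "\<mu> b \<ge> 0" for b by (simp add: \<mu>_def)
  \<comment> \<open>The induction needs \<open>D n\<close>, the energy strictly below the level
    reached so far, because each step must add the energy of its own slab. The total
    \<open>E\<close> replaces it only at the end.\<close>
  have main: "\<mu> (s n) \<le> (16 * D n) ^ n * \<mu> a"
  proof (induction n)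
    case (Suc n)
    define h where "h = (s (Suc n) - s n) / 2"
    have h: "h > 0" "s n + 2 * h = s (Suc n)" using s(1)[of n] by (simp_all add: h_def field_simps)
    have "1 / (16 * real (Suc n)) * \<mu> (s (Suc n)) \<le> h\<^sup>2 * \<mu> (s (Suc n))"
      using sqrt_step[of n] by (intro mult_right_mono \<mu>0) (simp add: h_def s_def)
    also have "\<dots> \<le> d n * \<mu> (s n)"
      using level_set_step[OF u g w h(1), of "s n"] s(2)[of n] \<open>a > 0\<close>
      by (simp add: h \<mu>_def d_def G_def)
    finally have "\<mu> (s (Suc n)) \<le> 16 * real (Suc n) * d n * \<mu> (s n)" by (simp add: field_simps)
    also have "\<dots> \<le> 16 * real (Suc n) * d n * ((16 * D n) ^ n * \<mu> a)"
      by (intro mult_left_mono Suc) (simp add: D0)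
    also have "\<dots> = 16 ^ Suc n * (real (Suc n) * d n * D n ^ n) * \<mu> a"
      by (simp add: power_mult_distrib)
    also have "\<dots> \<le> 16 ^ Suc n * (D n + d n) ^ Suc n * \<mu> a"
      by (intro mult_right_mono mult_left_mono Suc_mult_power_le D0 \<mu>0) simp
    also have "\<dots> = (16 * D (Suc n)) ^ Suc n * \<mu> a"
      unfolding DS power_mult_distrib ..
    finally show ?case .
  qed (simp add: s)
  have "D n \<le> E"
    unfolding D_def E_def G_def[symmetric]
    by (intro integral_mono iG) (auto simp: indicator_def G(2))
  then have "(16 * D n) ^ n * \<mu> a \<le> (16 * E) ^ n * \<mu> a"
    by (intro mult_right_mono power_mono \<mu>0) (auto simp: D0)
  with main show ?thesis unfolding s_def by linarith
qed

text \<open>Summation over layers: where \<open>u\<close> lies between the levels \<open>s n\<close>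
  and \<open>s (Suc n)\<close>, u^2 \<le> 2a^2 + 2(n+1), so the exponential is at most
  \<open>c n\<close>. For large \<open>a\<close> the decay of the superlevel sets beats the growth
  exp(2 beta n) of \<open>c n\<close>, leaving a geometric series.\<close>

lemma exp_square_integrable:
  assumes u: "L2 u" and g: "\<And>i. L2 (g i)" and w: "\<And>i. weak_pd i u (g i)" and "\<beta> > 0"
  obtains a where "a > 0" "integrable lborel (\<lambda>x. indicator {x. u x \<ge> a} x * exp (\<beta> * (u x)\<^sup>2))"
proof -
  note [measurable] = L2_measurable[OF u] L2_measurable[OF g]
  define G where "G x = (g 1 x)\<^sup>2 + (g 2 x)\<^sup>2" for x
  have [measurable]: "G \<in> borel_measurable borel" unfolding G_def by measurable
  have G: "integrable lborel G" "\<And>x. G x \<ge> 0"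
    using L2_square_integrable[OF g] by (auto simp: G_def[abs_def])
  define E where "E a = (\<integral>x. indicator {x. u x \<ge> a} x * G x \<partial>lborel)" for a :: real
  have "(\<lambda>n. E (real n)) \<longlonglongrightarrow> integral\<^sup>L lborel (\<lambda>x::real^2. 0::real)"
    unfolding E_def
  proof (rule integral_dominated_convergence[OF _ _ G(1)])
    show "AE x in lborel. (\<lambda>n. indicator {x. real n \<le> u x} x * G x) \<longlonglongrightarrow> 0"
    proof (intro AE_I2 tendsto_eventually)
      fix x
      have "\<forall>\<^sub>F n in sequentially. real n \<ge> u x + 1"
        using filterlim_real_sequentially unfolding filterlim_at_top by blast
      then show "\<forall>\<^sub>F n in sequentially. indicator {x. real n \<le> u x} x * G x = 0"
        by eventually_elim auto
    qed
  qed (auto simp: indicator_def G(2))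
  \<comment> \<open>With the factor 16 from the decay and exp(2 beta) from \<open>c n\<close>, this
    makes the ratio of the series at most 1/2.\<close>
  then have "\<forall>\<^sub>F n in sequentially. E (real n) < exp (- 2 * \<beta>) / 32"
    by (intro order_tendstoD(2)[where y = 0]) auto
  moreover have "\<forall>\<^sub>F n in sequentially. n > 0" by (rule eventually_gt_at_top)
  ultimately obtain n0 where n0: "E (real n0) < exp (- 2 * \<beta>) / 32" "n0 > 0"
    using eventually_happens'[OF sequentially_bot eventually_conj] by blast
  define a where "a = real n0"
  have "a > 0" using n0 by (simp add: a_def)
  have E0: "0 \<le> E a" by (simp add: E_def G)
  have q: "exp (2 * \<beta>) * (16 * E a) \<le> 1 / 2"
    using n0(1) by (simp add: a_def exp_minus field_simps)
  define \<mu> :: "real \<Rightarrow> real" where "\<mu> b = (\<integral>x. indicator {x. u x \<ge> b} x \<partial>lborel)" for b :: real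
  have \<mu>0: "\<mu> b \<ge> 0" for b by (simp add: \<mu>_def)
  define s where "s n = a + sqrt (real n)" for n
  have s: "s n > 0" for n using \<open>a > 0\<close> by (simp add: s_def add_pos_nonneg)
  have decay: "\<mu> (s n) \<le> (16 * E a) ^ n * \<mu> a" for n
    using level_set_decay[OF u g w \<open>a > 0\<close>, of n] by (simp add: \<mu>_def s_def E_def G_def)
  define c where "c n = exp (\<beta> * (2 * a\<^sup>2 + 2 * real (Suc n)))" for n
  define K where "K = exp (\<beta> * (2 * a\<^sup>2 + 2)) * \<mu> a"
  have c\<mu>: "c n * \<mu> (s n) \<le> K * (1 / 2) ^ n" for n
  proof -
    have "c n * \<mu> (s n) \<le> c n * ((16 * E a) ^ n * \<mu> a)"
      by (intro mult_left_mono decay) (simp add: c_def)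
    also have "\<dots> = K * (exp (2 * \<beta>) * (16 * E a)) ^ n"
    proof -
      have "c n = exp (\<beta> * (2 * a\<^sup>2 + 2)) * exp (2 * \<beta>) ^ n"
        by (simp add: c_def exp_of_nat_mult[symmetric] exp_add[symmetric] algebra_simps)
      then show ?thesis by (simp add: K_def power_mult_distrib)
    qed
    also have "\<dots> \<le> K * (1 / 2) ^ n"
      by (intro mult_left_mono power_mono q) (auto simp: E0 K_def \<mu>0)
    finally show ?thesis .
  qed
  have pw: "ennreal (indicator {x. u x \<ge> a} x * exp (\<beta> * (u x)\<^sup>2))
      \<le> (\<Sum>n. ennreal (c n * indicator {x. u x \<ge> s n} x))" for x
  proof (cases "u x \<ge> a")
    case True
    \<comment> \<open>The index of the layer that contains \<open>u x\<close>; this single term of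
      the series already dominates.\<close>
    define n where "n = nat \<lfloor>(u x - a)\<^sup>2\<rfloor>"
    have n: "real n \<le> (u x - a)\<^sup>2" "(u x - a)\<^sup>2 < real n + 1"
      by (auto simp: n_def of_nat_nat)
    have "sqrt (real n) \<le> u x - a" using n(1) True by (simp add: real_le_lsqrt)
    then have sn: "s n \<le> u x" by (simp add: s_def)
    have "(u x)\<^sup>2 \<le> 2 * a\<^sup>2 + 2 * (u x - a)\<^sup>2" using square_add_le[of a "u x - a"] by simp
    also have "\<dots> \<le> 2 * a\<^sup>2 + 2 * real (Suc n)" using n(2) by simp
    finally have "exp (\<beta> * (u x)\<^sup>2) \<le> c n" using \<open>\<beta> > 0\<close> by (simp add: c_def mult_left_mono)
    then have "ennreal (indicator {x. u x \<ge> a} x * exp (\<beta> * (u x)\<^sup>2)) \<le> ennreal (c n * indicator {x. u x \<ge> s n} x)"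
      using True sn by (simp add: ennreal_leI)
    also have "\<dots> \<le> (\<Sum>n. ennreal (c n * indicator {x. u x \<ge> s n} x))"
      using sum_le_suminf[of "\<lambda>n. ennreal (c n * indicator {x. u x \<ge> s n} x)" "{n}"] by simp
    finally show ?thesis .
  qed simp
  have "(\<integral>\<^sup>+x. ennreal (norm (indicator {x. u x \<ge> a} x * exp (\<beta> * (u x)\<^sup>2))) \<partial>lborel)
      \<le> (\<integral>\<^sup>+x. (\<Sum>n. ennreal (c n * indicator {x. u x \<ge> s n} x)) \<partial>lborel)"
    using pw by (intro nn_integral_mono) simp
  also have "\<dots> = (\<Sum>n. \<integral>\<^sup>+x. ennreal (c n * indicator {x. u x \<ge> s n} x) \<partial>lborel)"
    by (rule nn_integral_suminf) measurable
  also have "\<dots> = (\<Sum>n. ennreal (c n * \<mu> (s n)))"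
  proof (intro suminf_cong)
    fix n
    have "(\<integral>\<^sup>+x. ennreal (c n * indicator {x. u x \<ge> s n} x) \<partial>lborel)
        = ennreal (\<integral>x. c n * indicator {x. u x \<ge> s n} x \<partial>lborel)"
      by (intro nn_integral_eq_integral integrable_mult_right integrable_indicator_level u s)
         (auto simp: c_def)
    then show "(\<integral>\<^sup>+x. ennreal (c n * indicator {x. u x \<ge> s n} x) \<partial>lborel) = ennreal (c n * \<mu> (s n))"
      by (simp add: \<mu>_def)
  qed
  also have "\<dots> \<le> (\<Sum>n. ennreal (K * (1 / 2) ^ n))"
    by (intro suminf_le ennreal_leI c\<mu>) auto
  also have "\<dots> = ennreal (\<Sum>n. K * (1 / 2) ^ n)"
    by (intro suminf_ennreal2) (auto simp: K_def \<mu>0 intro!: summable_mult summable_geometric)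
  also have "\<dots> < \<infinity>" by simp
  finally have "integrable lborel (\<lambda>x. indicator {x. u x \<ge> a} x * exp (\<beta> * (u x)\<^sup>2))"
    by (intro integrableI_bounded) auto
  with \<open>a > 0\<close> show ?thesis by (rule that)
qed

section \<open>The Nehari and Pohozaev identities\<close>

lemma DERIV_F:
  assumes "continuous_on UNIV f"
  shows "(F f has_real_derivative f s) (at s)"
proof -
  \<comment> \<open>The interval contains 0 and has \<open>s\<close> in its interior, whatever the
    sign of \<open>s\<close>.\<close>
  let ?r = "\<bar>s\<bar> + 1"
  have "((\<lambda>u. LBINT y=ereal 0..ereal u. f y) has_vector_derivative f s) (at s within {- ?r..?r})"
    by (rule interval_integral_FTC2) (use continuous_on_subset[OF assms] in auto)
  moreover have "at s within {- ?r..?r} = at s"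
    by (rule at_within_Icc_at) auto
  ultimately show ?thesis
    unfolding F_def[abs_def] has_real_derivative_iff_has_vector_derivative by simp
qed

lemma F_0 [simp]: "F f 0 = 0"
  by (simp add: F_def)

lemma F_continuous: "continuous_on UNIV f \<Longrightarrow> continuous_on UNIV (F f)"
  by (simp add: continuous_at_imp_continuous_on DERIV_isCont[OF DERIV_F])

lemma F_MVT:
  assumes "continuous_on UNIV f" "s > 0"
  obtains z where "0 < z" "z < s" "F f s = s * f z"
proof -
  from MVT2[OF assms(2) DERIV_F[OF assms(1)]]
  obtain z where "0 < z" "z < s" "F f s - F f 0 = (s - 0) * f z" by blast
  then show ?thesis using that[of z] by simp
qed

lemma F_nonpos_arg:
  assumes "continuous_on UNIV f" "\<And>s. s \<le> 0 \<Longrightarrow> f s = 0" "s \<le> 0"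
  shows "F f s = 0"
proof (cases "s = 0")
  case False
  with assms(3) have "s < 0" by simp
  from MVT2[OF this DERIV_F[OF assms(1)]] obtain z where "z < 0" "F f 0 - F f s = (0 - s) * f z" by blast
  then show ?thesis using assms(2)[of z] by simp
qed simp

text \<open>A bounded nonlinearity has a Lipschitz primitive, which respects L2 limits. Since
  \<open>f\<close> is bounded on [0, s], the truncated primitive at \<open>s\<close> equals
  \<open>F f s\<close> as soon as k exceeds that bound, and it never exceeds \<open>F f s\<close>,
  which supplies the majorant.\<close>

lemma F_truncated:
  assumes c: "continuous_on UNIV f" and np: "\<And>s. s \<le> 0 \<Longrightarrow> f s = 0" and nn: "\<And>s. f s \<ge> 0"
  defines "fk \<equiv> \<lambda>k s. min (f s) (real k)"
  shows "continuous_on UNIV (fk k)" "0 \<le> F (fk k) s" "F (fk k) s \<le> F f s"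
    "\<bar>F (fk k) s - F (fk k) t\<bar> \<le> real k * \<bar>s - t\<bar>"
    "(\<lambda>k. F (fk k) s) \<longlonglongrightarrow> F f s"
proof -
  show ck: "continuous_on UNIV (fk k)" for k unfolding fk_def by (intro continuous_intros c)
  have npk: "fk k s = 0" if "s \<le> 0" for k s using np[OF that] by (simp add: fk_def)
  show "0 \<le> F (fk k) s"
  proof (cases "s > 0")
    case True
    obtain z where "F (fk k) s = s * fk k z" by (rule F_MVT[OF ck True])
    then show ?thesis using nn[of z] True by (simp add: fk_def)
  qed (use F_nonpos_arg[OF ck npk] in simp)
  have diff: "\<exists>z. 0 < z \<and> z < s \<and> F f s - F (fk k) s = s * (f z - fk k z)" if "s > 0" for k
    using MVT2[OF that DERIV_diff[OF DERIV_F[OF c] DERIV_F[OF ck[of k]]]] by simp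
  show "F (fk k) s \<le> F f s"
  proof (cases "s > 0")
    case True
    then obtain z where z: "F f s - F (fk k) s = s * (f z - fk k z)" using diff by blast
    have "0 \<le> s * (f z - fk k z)" using True by (simp add: fk_def)
    with z show ?thesis by linarith
  qed (simp add: F_nonpos_arg[OF ck npk] F_nonpos_arg[OF c np])
  have "norm (F (fk k) s - F (fk k) t) \<le> real k * norm (s - t)"
  proof (rule field_differentiable_bound[of UNIV])
    show "(F (fk k) has_field_derivative fk k x) (at x within UNIV)" for x by (rule DERIV_F[OF ck])
    show "norm (fk k x) \<le> real k" for x using nn[of x] by (simp add: fk_def)
  qed auto
  then show "\<bar>F (fk k) s - F (fk k) t\<bar> \<le> real k * \<bar>s - t\<bar>" by simp
  show "(\<lambda>k. F (fk k) s) \<longlonglongrightarrow> F f s"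
  proof (cases "s > 0")
    case True
    have "compact (f ` {0..s})" by (intro compact_continuous_image continuous_on_subset[OF c]) auto
    then have "bounded (f ` {0..s})" by (rule compact_imp_bounded)
    then obtain B where "\<forall>y\<in>f ` {0..s}. norm y \<le> B" unfolding bounded_iff by blast
    then have B: "\<bar>f z\<bar> \<le> B" if "z \<in> {0..s}" for z using that by simp
    have "\<forall>\<^sub>F k in sequentially. real k \<ge> B"
      using filterlim_real_sequentially unfolding filterlim_at_top by blast
    then have "\<forall>\<^sub>F k in sequentially. F (fk k) s = F f s"
    proof eventually_elim
      case (elim k)
      obtain z where z: "0 < z" "z < s" "F f s - F (fk k) s = s * (f z - fk k z)" using diff[OF True] by blast
      have "fk k z = f z" using B[of z] z elim by (simp add: fk_def)
      with z show ?case by simp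
    qed
    then show ?thesis by (rule tendsto_eventually)
  qed (simp add: F_nonpos_arg[OF ck npk] F_nonpos_arg[OF c np])
qed

text \<open>\<open>f\<close> is truncated at \<open>k\<close> because \<open>f (\<phi> n x)\<close> need not converge in \<open>L2\<close> for approximations \<open>\<phi> n\<close> of \<open>u\<close>.\<close>

lemma chain_rule_integral:
  assumes c: "continuous_on UNIV f" and np: "\<And>s. s \<le> 0 \<Longrightarrow> f s = 0" and nn: "\<And>s. f s \<ge> 0"
    and u: "L2 u" and g: "\<And>i. L2 (g i)" and w: "\<And>i. weak_pd i u (g i)"
    and fu: "L2 (\<lambda>x. f (u x))" and Fu: "integrable lborel (\<lambda>x. F f (u x))" and X: "test_fun X"
  shows "(\<integral>x. f (u x) * (g j x * X x) \<partial>lborel) = - (\<integral>x. F f (u x) * pd j X x \<partial>lborel)"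
proof -
  note [measurable] = L2_measurable[OF u] L2_measurable[OF g] test_fun_measurable[OF X]
    borel_measurable_continuous_onI[OF c] borel_measurable_continuous_onI[OF F_continuous[OF c]]
  define fk where "fk k s = min (f s) (real k)" for k s
  note fk = F_truncated[OF c np nn, folded fk_def]
  have [measurable]: "fk k \<in> borel_measurable borel" for k by (rule borel_measurable_continuous_onI[OF fk(1)])
  have [measurable]: "F (fk k) \<in> borel_measurable borel" for k
    by (rule borel_measurable_continuous_onI[OF F_continuous[OF fk(1)]])
  have fkb: "\<bar>fk k s\<bar> \<le> real k" for k s using nn[of s] by (simp add: fk_def)
  obtain \<phi>' where \<phi>': "\<And>n. test_fun (\<phi>' n)" and l': "L2lim \<phi>' u" "\<And>i. L2lim (\<lambda>n. pd i (\<phi>' n)) (g i)"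
    using test_fun_dense_H1[OF u g w] by blast
  \<comment> \<open>The truncated nonlinearity is bounded and continuous but not Lipschitz, so
    \<open>fk k (\<phi> n x)\<close> is controlled through almost everywhere convergence, available
    along a subsequence.\<close>
  obtain r where r: "strict_mono r" "AE x in lborel. (\<lambda>n. \<phi>' (r n) x) \<longlonglongrightarrow> u x"
    using L2lim_AE_subseq[OF l'(1)] by blast
  define \<phi> where "\<phi> n = \<phi>' (r n)" for n
  have \<phi>: "test_fun (\<phi> n)" for n by (simp add: \<phi>_def \<phi>')
  have l: "L2lim \<phi> u" "L2lim (\<lambda>n. pd i (\<phi> n)) (g i)" for i
    using L2lim_subseq[OF l'(1) r(1)] L2lim_subseq[OF l'(2) r(1)] unfolding \<phi>_def[abs_def] by this+
  note [measurable] = test_fun_measurable[OF \<phi>]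
  have ae: "AE x in lborel. (\<lambda>n. \<phi> n x) \<longlonglongrightarrow> u x" using r(2) by (simp add: \<phi>_def)
  have eqk: "(\<integral>x. fk k (u x) * g j x * X x \<partial>lborel) = - (\<integral>x. F (fk k) (u x) * pd j X x \<partial>lborel)" for k
  proof -
    have eq: "(\<integral>x. fk k (\<phi> n x) * pd j (\<phi> n) x * X x \<partial>lborel) = - (\<integral>x. F (fk k) (\<phi> n x) * pd j X x \<partial>lborel)" for n
    proof -
      note sm = test_fun_smooth[OF \<phi>[of n]] and smX = test_fun_smooth[OF X]
      have d: "(\<lambda>x. F (fk k) (\<phi> n x)) differentiable (at x)"
          "pd i (\<lambda>x. F (fk k) (\<phi> n x)) x = fk k (\<phi> n x) * pd i (\<phi> n) x" for x i
        using pd_chain[OF smooth_differentiable[OF sm] DERIV_F[OF fk(1)]] by auto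
      have pd: "pd i (\<lambda>x. F (fk k) (\<phi> n x) * X x) = (\<lambda>x. F (fk k) (\<phi> n x) * pd i X x + fk k (\<phi> n x) * pd i (\<phi> n) x * X x)" for i
        by (auto simp: fun_eq_iff pd_mult d smooth_differentiable[OF smX])
      obtain R where R: "\<And>x. norm x > R \<Longrightarrow> X x = 0" using X by (auto simp: test_fun_iff)
      have c1: "continuous_on UNIV (\<lambda>x. F (fk k) (\<phi> n x) * pd i X x)"
        "continuous_on UNIV (\<lambda>x. fk k (\<phi> n x) * pd i (\<phi> n) x * X x)" for i
        by (intro continuous_on_mult continuous_on_compose2[OF F_continuous[OF fk(1)]]
            continuous_on_compose2[OF fk(1)] smooth_continuous smooth_pd sm smX; simp)+
      have "C1c (\<lambda>x. F (fk k) (\<phi> n x) * X x)"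
        unfolding C1c_def pd
      proof (intro conjI allI continuous_on_add c1)
        show "(\<lambda>x. F (fk k) (\<phi> n x) * X x) differentiable (at x)" for x
          by (intro differentiable_mult d smooth_differentiable smX)
        show "\<exists>R. \<forall>x. R < norm x \<longrightarrow> F (fk k) (\<phi> n x) * X x = 0" using R by auto
      qed
      from C1c_integral_pd[OF this, of j]
      have "(\<integral>x. F (fk k) (\<phi> n x) * pd j X x + fk k (\<phi> n x) * pd j (\<phi> n) x * X x \<partial>lborel) = 0"
        unfolding pd .
      moreover have "integrable lborel (\<lambda>x. F (fk k) (\<phi> n x) * pd j X x)"
          "integrable lborel (\<lambda>x. fk k (\<phi> n x) * pd j (\<phi> n) x * X x)"
        using continuous_compact_support(2)[OF c1(1), of R j] continuous_compact_support(2)[OF c1(2), of R j]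
          R pd_eq_0_outside[OF R] by auto
      ultimately show ?thesis by simp
    qed
    have "L2lim (\<lambda>n x. fk k (\<phi> n x) * pd j (\<phi> n) x) (\<lambda>x. fk k (u x) * g j x)"
    proof (rule L2lim_mult_seq[OF l(2) _ fkb _ _ fkb])
      show "AE x in lborel. (\<lambda>n. fk k (\<phi> n x)) \<longlonglongrightarrow> fk k (u x)"
        using ae
      proof eventually_elim
        case (elim x)
        have "isCont (fk k) (u x)" using fk(1) by (simp add: continuous_on_eq_continuous_at)
        then show ?case by (rule isCont_tendsto_compose[OF _ elim])
      qed
    qed measurable
    from L2lim_integral_mult[OF this L2lim_const[OF test_fun_L2[OF X]]]
    have 1: "(\<lambda>n. \<integral>x. fk k (\<phi> n x) * pd j (\<phi> n) x * X x \<partial>lborel) \<longlonglongrightarrow> (\<integral>x. fk k (u x) * g j x * X x \<partial>lborel)" .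
    have "L2lim (\<lambda>n x. F (fk k) (\<phi> n x)) (\<lambda>x. F (fk k) (u x))"
      by (rule L2lim_Lipschitz[OF l(1) fk(4)]) auto
    from tendsto_minus[OF L2lim_integral_mult[OF this L2lim_const[OF test_fun_L2[OF test_fun_pd[OF X]]]]]
    have 2: "(\<lambda>n. - (\<integral>x. F (fk k) (\<phi> n x) * pd j X x \<partial>lborel)) \<longlonglongrightarrow> - (\<integral>x. F (fk k) (u x) * pd j X x \<partial>lborel)" .
    show ?thesis using LIMSEQ_unique[OF 1] 2 unfolding eq by blast
  qed
  obtain B where B: "\<And>x. \<bar>X x\<bar> \<le> B" using test_fun_bounded[OF X] by blast
  obtain B' where B': "\<And>x. \<bar>pd j X x\<bar> \<le> B'" using test_fun_bounded[OF test_fun_pd[OF X]] by blast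
  have [measurable]: "pd j X \<in> borel_measurable borel" by (rule test_fun_measurable[OF test_fun_pd[OF X]])
  have "L2lim (\<lambda>k x. fk k (u x)) (\<lambda>x. f (u x))"
  proof (rule L2lim_dominated[OF _ _ fu _ _ fu])
    show "\<bar>fk k (u x)\<bar> \<le> \<bar>f (u x)\<bar>" for k x using nn[of "u x"] by (simp add: fk_def)
    show "AE x in lborel. (\<lambda>k. fk k (u x)) \<longlonglongrightarrow> f (u x)"
    proof (intro AE_I2 tendsto_eventually)
      fix x
      have "\<forall>\<^sub>F k in sequentially. real k \<ge> f (u x)"
        using filterlim_real_sequentially unfolding filterlim_at_top by blast
      then show "\<forall>\<^sub>F k in sequentially. fk k (u x) = f (u x)" by eventually_elim (simp add: fk_def)
    qed
  qed measurable
  moreover have "L2 (\<lambda>x. g j x * X x)"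
    using L2_mult_bounded[OF g[of j] _ B] by (simp add: mult.commute)
  ultimately have limL: "(\<lambda>k. \<integral>x. fk k (u x) * (g j x * X x) \<partial>lborel) \<longlonglongrightarrow> (\<integral>x. f (u x) * (g j x * X x) \<partial>lborel)"
    by (intro L2lim_integral_mult L2lim_const)
  have "(\<lambda>k. \<integral>x. F (fk k) (u x) * pd j X x \<partial>lborel) \<longlonglongrightarrow> (\<integral>x. F f (u x) * pd j X x \<partial>lborel)"
  proof (rule integral_dominated_convergence[where w = "\<lambda>x. F f (u x) * B'"])
    show "AE x in lborel. (\<lambda>k. F (fk k) (u x) * pd j X x) \<longlonglongrightarrow> F f (u x) * pd j X x"
      by (intro AE_I2 tendsto_mult fk(5) tendsto_const)
    show "AE x in lborel. norm (F (fk k) (u x) * pd j X x) \<le> F f (u x) * B'" for k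
      using fk(2,3) B' order_trans[OF fk(2) fk(3)] by (intro AE_I2) (simp add: abs_mult mult_mono)
    show "integrable lborel (\<lambda>x. F f (u x) * B')" using Fu by simp
  qed measurable
  from tendsto_minus[OF this]
  have "(\<lambda>k. \<integral>x. fk k (u x) * (g j x * X x) \<partial>lborel) \<longlonglongrightarrow> - (\<integral>x. F f (u x) * pd j X x \<partial>lborel)"
    unfolding eqk[symmetric] mult.assoc .
  with limL show ?thesis by (rule LIMSEQ_unique)
qed

section \<open>Testing the equation with vector fields and with the solution\<close>

lemma integral_by_parts_square:
  assumes a: "smooth a" and X: "test_fun X"
  shows "(\<integral>x. X x * (a x * pd j a x) \<partial>lborel) = - (\<integral>x. (a x * a x) * pd j X x \<partial>lborel) / 2"
proof -
  have "(\<integral>x. (a x * a x) * pd j X x \<partial>lborel) = - (\<integral>x. X x * pd j (\<lambda>x. a x * a x) x \<partial>lborel)"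
    by (intro integral_by_parts smooth_mult a X)
  also have "(\<lambda>x. X x * pd j (\<lambda>x. a x * a x) x) = (\<lambda>x. 2 * (X x * (a x * pd j a x)))"
    by (auto simp: fun_eq_iff pd_mult smooth_differentiable[OF a])
  finally show ?thesis by simp
qed

lemma L2_mult_test_fun:
  assumes "L2 a" "test_fun X" shows "L2 (\<lambda>x. a x * X x)"
proof -
  obtain B where "\<And>x. \<bar>X x\<bar> \<le> B" using test_fun_bounded[OF assms(2)] by blast
  from L2_mult_bounded[OF assms(1) test_fun_measurable[OF assms(2)] this] show ?thesis by (simp add: mult.commute)
qed

lemma L2lim_mult_test_fun:
  assumes "L2lim a b" "test_fun X" shows "L2lim (\<lambda>n x. a n x * X x) (\<lambda>x. b x * X x)"
proof -
  obtain B where "\<And>x. \<bar>X x\<bar> \<le> B" using test_fun_bounded[OF assms(2)] by blast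
  from L2lim_mult_bounded[OF assms(1) test_fun_measurable[OF assms(2)] this] show ?thesis by (simp add: mult.commute)
qed

text \<open>Mollifying the test function as well moves the mollifier to \<open>u\<close>, so that all second derivatives are
  those of the smooth function \<open>conv (moll n) u\<close> and can be integrated by parts.\<close>

lemma Pohozaev_local:
  assumes u: "L2 u" and g: "\<And>i. L2 (g i)" and w: "\<And>i. weak_pd i u (g i)" and h: "L2 h"
    and eq: "\<And>\<phi>. test_fun \<phi> \<Longrightarrow> (\<Sum>i\<in>UNIV. \<integral>x. g i x * pd i \<phi> x \<partial>lborel) + lam * (\<integral>x. u x * \<phi> x \<partial>lborel)
      = (\<integral>x. h x * \<phi> x \<partial>lborel)"
    and X: "\<And>j :: 2. test_fun (X j)"
  shows "(\<Sum>i\<in>UNIV. \<Sum>j\<in>UNIV. (\<integral>x. g i x * (g j x * pd i (X j) x) \<partial>lborel) - (\<integral>x. g i x * (g i x * pd j (X j) x) \<partial>lborel) / 2)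
      - lam * (\<Sum>j\<in>UNIV. \<integral>x. u x * (u x * pd j (X j) x) \<partial>lborel) / 2
    = (\<Sum>j\<in>UNIV. \<integral>x. h x * (g j x * X j x) \<partial>lborel)"
proof -
  have step: "(\<Sum>i\<in>UNIV. \<Sum>j\<in>UNIV. (\<integral>x. conv (moll n) (g i) x * (conv (moll n) (g j) x * pd i (X j) x) \<partial>lborel)
        - (\<integral>x. conv (moll n) (g i) x * (conv (moll n) (g i) x * pd j (X j) x) \<partial>lborel) / 2)
      - lam * (\<Sum>j\<in>UNIV. \<integral>x. conv (moll n) u x * (conv (moll n) u x * pd j (X j) x) \<partial>lborel) / 2
    = (\<Sum>j\<in>UNIV. \<integral>x. conv (moll n) h x * (conv (moll n) (g j) x * X j x) \<partial>lborel)" for n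
  proof -
    note mo = mollifier_moll[of n]
    note M = mollifierD[OF mo]
    define U where "U = conv (moll n) u"
    define G where "G i = conv (moll n) (g i)" for i
    have sm: "smooth U" "smooth (G i)" for i unfolding U_def G_def by (intro smooth_conv M u g)+
    have LU: "L2 U" "L2 (G i)" for i unfolding U_def G_def by (intro conv_L2 mo u g)+
    have pdU: "pd i U = G i" for i unfolding U_def G_def by (rule pd_conv_weak[OF M(1) u w])
    \<comment> \<open>Both sides are second derivatives of \<open>U\<close>; they fall on the
      mollifier, whose derivatives commute.\<close>
    have comm: "pd i (G j) = pd j (G i)" for i j
      unfolding pdU[symmetric] U_def
      by (simp add: pd_conv[OF M(1) u] pd_conv[OF test_fun_pd[OF M(1)] u] M(5)[of i j])
    define \<psi> where "\<psi> x = (\<Sum>j\<in>UNIV. X j x * G j x)" for x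
    have \<psi>: "test_fun \<psi>" unfolding \<psi>_def[abs_def] by (intro test_fun_sum test_fun_mult X sm)
    obtain R where R: "\<And>x. norm x > R \<Longrightarrow> \<psi> x = 0" using \<psi> by (auto simp: test_fun_iff)
    note L\<psi> = test_fun_L2[OF \<psi>] and L\<psi>' = test_fun_L2[OF test_fun_pd[OF \<psi>]]
    have t: "test_fun (conv (moll n) \<psi>)" by (rule test_fun_conv[OF M(1) L\<psi> R])
    have pdpsi: "pd i (conv (moll n) \<psi>) = conv (moll n) (pd i \<psi>)" for i
      by (rule pd_conv_weak[OF M(1) L\<psi> weak_pd_test_fun[OF \<psi>]])
    \<comment> \<open>The equation is tested with the mollified \<open>\<psi>\<close>.
      Self-adjointness moves the mollifier to \<open>g\<close>, \<open>u\<close> and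
      \<open>h\<close>, which leaves \<open>\<psi>\<close> paired with mollified functions.\<close>
    from eq[OF t]
    have main: "(\<Sum>i\<in>UNIV. \<integral>x. G i x * pd i \<psi> x \<partial>lborel) + lam * (\<integral>x. U x * \<psi> x \<partial>lborel)
      = (\<integral>x. conv (moll n) h x * \<psi> x \<partial>lborel)"
      unfolding pdpsi U_def G_def
      by (simp only: conv_symmetric[OF mo g L\<psi>'] conv_symmetric[OF mo u L\<psi>] conv_symmetric[OF mo h L\<psi>])
    have int: "integrable lborel (\<lambda>x. a x * (b x * Y x))" if "L2 a" "L2 b" "test_fun Y" for a b Y
      by (rule L2_mult_integrable[OF that(1) L2_mult_test_fun[OF that(2,3)]])
    have pd\<psi>: "pd i \<psi> x = (\<Sum>j\<in>UNIV. X j x * pd i (G j) x + pd i (X j) x * G j x)" for i x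
      unfolding \<psi>_def[abs_def]
      by (subst pd_sum) (auto simp: pd_mult smooth_differentiable sm test_fun_smooth X)
    have i1: "integrable lborel (\<lambda>x. G i x * (G j x * pd k (X l) x))" for i j k l
      by (intro int LU test_fun_pd X)
    have i2: "integrable lborel (\<lambda>x. X j x * (G i x * pd j (G i) x))" for i j
      by (intro test_fun_integrable test_fun_mult X smooth_mult sm smooth_pd)
    have s: "(\<Sum>i\<in>UNIV. \<integral>x. G i x * pd i \<psi> x \<partial>lborel)
      = (\<Sum>i\<in>UNIV. \<Sum>j\<in>UNIV. (\<integral>x. G i x * (G j x * pd i (X j) x) \<partial>lborel) - (\<integral>x. G i x * (G i x * pd j (X j) x) \<partial>lborel) / 2)"
    proof (rule sum.cong[OF refl])
      fix i :: 2
      \<comment> \<open>By \<open>comm\<close>, the second order term G_i X_j d_i G_j becomes X_j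
        G_i d_j G_i, which is X_j times half the derivative of G_i^2 and can be integrated by parts
        onto \<open>X j\<close>.\<close>
      have "(\<integral>x. G i x * pd i \<psi> x \<partial>lborel)
          = (\<integral>x. (\<Sum>j\<in>UNIV. G i x * (G j x * pd i (X j) x) + X j x * (G i x * pd j (G i) x)) \<partial>lborel)"
        by (intro Bochner_Integration.integral_cong refl)
           (simp add: pd\<psi> sum_distrib_left algebra_simps comm[of i])
      also have "\<dots> = (\<Sum>j\<in>UNIV. (\<integral>x. G i x * (G j x * pd i (X j) x) \<partial>lborel) + (\<integral>x. X j x * (G i x * pd j (G i) x) \<partial>lborel))"
        using i1 i2 by simp
      also have "\<dots> = (\<Sum>j\<in>UNIV. (\<integral>x. G i x * (G j x * pd i (X j) x) \<partial>lborel) - (\<integral>x. G i x * (G i x * pd j (X j) x) \<partial>lborel) / 2)"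
        by (simp add: integral_by_parts_square[OF sm(2) X] mult.assoc)
      finally show "(\<integral>x. G i x * pd i \<psi> x \<partial>lborel)
          = (\<Sum>j\<in>UNIV. (\<integral>x. G i x * (G j x * pd i (X j) x) \<partial>lborel) - (\<integral>x. G i x * (G i x * pd j (X j) x) \<partial>lborel) / 2)" .
    qed
    have "(\<integral>x. U x * \<psi> x \<partial>lborel) = (\<integral>x. (\<Sum>j\<in>UNIV. X j x * (U x * pd j U x)) \<partial>lborel)"
      by (intro Bochner_Integration.integral_cong refl) (simp add: \<psi>_def sum_distrib_left algebra_simps pdU)
    also have "\<dots> = (\<Sum>j\<in>UNIV. \<integral>x. X j x * (U x * pd j U x) \<partial>lborel)"
      by (intro Bochner_Integration.integral_sum test_fun_integrable test_fun_mult X smooth_mult sm smooth_pd)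
    also have "\<dots> = - (\<Sum>j\<in>UNIV. \<integral>x. U x * (U x * pd j (X j) x) \<partial>lborel) / 2"
      by (simp add: integral_by_parts_square[OF sm(1) X] mult.assoc sum_negf sum_divide_distrib)
    finally have s2: "(\<integral>x. U x * \<psi> x \<partial>lborel) = - (\<Sum>j\<in>UNIV. \<integral>x. U x * (U x * pd j (X j) x) \<partial>lborel) / 2" .
    have "(\<integral>x. conv (moll n) h x * \<psi> x \<partial>lborel) = (\<integral>x. (\<Sum>j\<in>UNIV. conv (moll n) h x * (G j x * X j x)) \<partial>lborel)"
      by (intro Bochner_Integration.integral_cong refl) (simp add: \<psi>_def sum_distrib_left algebra_simps)
    also have "\<dots> = (\<Sum>j\<in>UNIV. \<integral>x. conv (moll n) h x * (G j x * X j x) \<partial>lborel)"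
      by (intro Bochner_Integration.integral_sum int conv_L2 mo h LU X)
    finally show ?thesis
      using main unfolding s s2 by (simp add: U_def[symmetric] G_def[symmetric])
  qed
  note l = conv_moll_L2lim
  have "(\<lambda>n. (\<Sum>i\<in>UNIV. \<Sum>j\<in>UNIV. (\<integral>x. conv (moll n) (g i) x * (conv (moll n) (g j) x * pd i (X j) x) \<partial>lborel)
        - (\<integral>x. conv (moll n) (g i) x * (conv (moll n) (g i) x * pd j (X j) x) \<partial>lborel) / 2)
      - lam * (\<Sum>j\<in>UNIV. \<integral>x. conv (moll n) u x * (conv (moll n) u x * pd j (X j) x) \<partial>lborel) / 2)
    \<longlonglongrightarrow> (\<Sum>i\<in>UNIV. \<Sum>j\<in>UNIV. (\<integral>x. g i x * (g j x * pd i (X j) x) \<partial>lborel) - (\<integral>x. g i x * (g i x * pd j (X j) x) \<partial>lborel) / 2)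
      - lam * (\<Sum>j\<in>UNIV. \<integral>x. u x * (u x * pd j (X j) x) \<partial>lborel) / 2"
    by (intro tendsto_sum tendsto_diff tendsto_divide tendsto_mult[of "\<lambda>_. lam"] tendsto_const L2lim_integral_mult
        l g u L2lim_mult_test_fun test_fun_pd X) auto
  moreover have "(\<lambda>n. \<Sum>j\<in>UNIV. \<integral>x. conv (moll n) h x * (conv (moll n) (g j) x * X j x) \<partial>lborel)
    \<longlonglongrightarrow> (\<Sum>j\<in>UNIV. \<integral>x. h x * (g j x * X j x) \<partial>lborel)"
    by (intro tendsto_sum L2lim_integral_mult l h g L2lim_mult_test_fun X)
  ultimately show ?thesis unfolding step by (rule LIMSEQ_unique)
qed

text \<open>For the dilation field d_i X_j is the Kronecker delta and the divergence is 2. The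
  gradient terms then give D - (2/2) D = 0, so in dimension two only the mass term and the potential
  term remain: -lam |u|^2 = -2 times the integral of F(u).\<close>

lemma Pohozaev:
  assumes c: "continuous_on UNIV f" and np: "\<And>s. s \<le> 0 \<Longrightarrow> f s = 0" and nn: "\<And>s. f s \<ge> 0"
    and u: "L2 u" and g: "\<And>i. L2 (g i)" and w: "\<And>i. weak_pd i u (g i)"
    and fu: "L2 (\<lambda>x. f (u x))" and Fu: "integrable lborel (\<lambda>x. F f (u x))"
    and eq: "\<And>\<phi>. test_fun \<phi> \<Longrightarrow> (\<Sum>i\<in>UNIV. \<integral>x. g i x * pd i \<phi> x \<partial>lborel) + lam * (\<integral>x. u x * \<phi> x \<partial>lborel)
      = (\<integral>x. f (u x) * \<phi> x \<partial>lborel)"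
  shows "lam * (\<integral>x. (u x)\<^sup>2 \<partial>lborel) = 2 * (\<integral>x. F f (u x) \<partial>lborel)"
proof -
  \<comment> \<open>\<open>X n\<close> is a rescaling of a fixed compactly supported field that agrees with the dilation field to first
    order at the origin.\<close>
  define X where "X n j x = cutoff n x * x $ j" for n and j :: 2 and x :: "real^2"
  have X: "test_fun (X n j)" for n j unfolding X_def[abs_def] by (intro test_fun_mult test_fun_cutoff) auto
  have pdX: "pd i (X n j) x = cutoff n x * (if i = j then 1 else 0) + pd i (cutoff n) x * x $ j" for i n j x
    unfolding X_def[abs_def] by (simp add: pd_mult smooth_differentiable test_fun_smooth test_fun_cutoff)
  \<comment> \<open>The growth of the coordinate x_j is compensated by the factor 1/(n+1) in the
    derivative of the cutoff. The derivatives of \<open>X n\<close> are therefore rescalings of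
    fixed test functions: bounded uniformly in n, with pointwise limits
    \<open>Y i j 0\<close>.\<close>
  define Y where "Y i j x = bump x / bump 0 * (if i = j then 1 else 0) + pd i bump x * x $ j / bump 0" for i j :: 2 and x :: "real^2"
  have Y: "test_fun (Y i j)" for i j
  proof -
    have "test_fun (\<lambda>x. bump x * (1 / bump 0 * (if i = j then 1 else 0)) + pd i bump x * (x $ j * (1 / bump 0)))"
      by (intro test_fun_add test_fun_mult test_fun_bump test_fun_pd smooth_mult smooth_coord smooth_const)
    then show ?thesis unfolding Y_def[abs_def] by (simp add: mult.assoc)
  qed
  have XY: "pd i (X n j) x = Y i j ((1 / real (Suc n)) *\<^sub>R x)" for i n j x
    unfolding pdX pd_cutoff by (simp add: Y_def cutoff_def mult.assoc)
  have Y0: "Y i j 0 = (if i = j then 1 else 0)" for i j using bump_0 by (simp add: Y_def)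
  have lim: "(\<lambda>n. \<integral>x. h x * pd i (X n j) x \<partial>lborel) \<longlonglongrightarrow> (if i = j then (\<integral>x. h x \<partial>lborel) else 0)"
    if h: "integrable lborel h" for h i j
  proof -
    obtain B where B: "\<And>x. \<bar>Y i j x\<bar> \<le> B" using test_fun_bounded[OF Y] by blast
    have "(\<lambda>n. \<integral>x. h x * pd i (X n j) x \<partial>lborel) \<longlonglongrightarrow> (\<integral>x. h x * (if i = j then 1 else 0) \<partial>lborel)"
    proof (rule integral_dominated_convergence[where w = "\<lambda>x. \<bar>h x\<bar> * B"])
      show "(\<lambda>x. h x * (if i = j then 1 else 0)) \<in> borel_measurable lborel" using h by measurable
      show "(\<lambda>x. h x * pd i (X n j) x) \<in> borel_measurable lborel" for n
        using h test_fun_measurable[OF test_fun_pd[OF X]] by measurable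
      show "integrable lborel (\<lambda>x. \<bar>h x\<bar> * B)" using h by auto
      show "AE x in lborel. (\<lambda>n. h x * pd i (X n j) x) \<longlonglongrightarrow> h x * (if i = j then 1 else 0)"
        unfolding XY Y0[symmetric]
        by (intro AE_I2 tendsto_mult tendsto_const smooth_scale_tendsto test_fun_smooth Y)
      show "AE x in lborel. norm (h x * pd i (X n j) x) \<le> \<bar>h x\<bar> * B" for n
        unfolding XY using B by (intro AE_I2) (simp add: abs_mult mult_left_mono)
    qed
    then show ?thesis by (simp split: if_splits)
  qed
  have gg: "integrable lborel (\<lambda>x. g i x * g j x)" for i j by (intro L2_mult_integrable g)
  have uu: "integrable lborel (\<lambda>x. u x * u x)" by (intro L2_mult_integrable u)
  have id: "(\<Sum>i\<in>UNIV. \<Sum>j\<in>UNIV. (\<integral>x. (g i x * g j x) * pd i (X n j) x \<partial>lborel) - (\<integral>x. (g i x * g i x) * pd j (X n j) x \<partial>lborel) / 2)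
      - lam * (\<Sum>j\<in>UNIV. \<integral>x. (u x * u x) * pd j (X n j) x \<partial>lborel) / 2
    = (\<Sum>j\<in>UNIV. - (\<integral>x. F f (u x) * pd j (X n j) x \<partial>lborel))" for n
    using Pohozaev_local[OF u g w fu eq X] chain_rule_integral[OF c np nn u g w fu Fu X]
    by (simp add: mult.assoc)
  have "(\<lambda>n. (\<Sum>i\<in>UNIV. \<Sum>j\<in>UNIV. (\<integral>x. (g i x * g j x) * pd i (X n j) x \<partial>lborel) - (\<integral>x. (g i x * g i x) * pd j (X n j) x \<partial>lborel) / 2)
      - lam * (\<Sum>j\<in>UNIV. \<integral>x. (u x * u x) * pd j (X n j) x \<partial>lborel) / 2)
    \<longlonglongrightarrow> (\<Sum>i\<in>UNIV. \<Sum>j\<in>UNIV. (if i = j then (\<integral>x. g i x * g j x \<partial>lborel) else 0) - (if j = j then (\<integral>x. g i x * g i x \<partial>lborel) else 0) / 2)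
      - lam * (\<Sum>j\<in>(UNIV :: 2 set). if j = j then (\<integral>x. u x * u x \<partial>lborel) else 0) / 2"
    by (intro tendsto_sum tendsto_diff tendsto_divide tendsto_mult[of "\<lambda>_. lam"] tendsto_const lim gg uu) auto
  moreover have "(\<lambda>n. \<Sum>j\<in>UNIV. - (\<integral>x. F f (u x) * pd j (X n j) x \<partial>lborel))
    \<longlonglongrightarrow> (\<Sum>j\<in>(UNIV :: 2 set). - (if j = j then (\<integral>x. F f (u x) \<partial>lborel) else 0))"
    by (intro tendsto_sum tendsto_minus lim Fu)
  ultimately have "(\<Sum>i\<in>UNIV. \<Sum>j\<in>UNIV. (if i = j then (\<integral>x. g i x * g j x \<partial>lborel) else 0) - (if j = j then (\<integral>x. g i x * g i x \<partial>lborel) else 0) / 2)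
      - lam * (\<Sum>j\<in>(UNIV :: 2 set). if j = j then (\<integral>x. u x * u x \<partial>lborel) else 0) / 2
      = (\<Sum>j\<in>(UNIV :: 2 set). - (if j = j then (\<integral>x. F f (u x) \<partial>lborel) else 0))"
    unfolding id by (rule LIMSEQ_unique)
  then show ?thesis by (simp add: UNIV_2 power2_eq_square)
qed

text \<open>The solution is admissible as a test function by density: all three terms are L2
  pairings, the last because \<open>h\<close> is square integrable.\<close>

lemma Nehari:
  assumes u: "L2 u" and g: "\<And>i. L2 (g i)" and w: "\<And>i. weak_pd i u (g i)" and h: "L2 h"
    and eq: "\<And>\<phi>. test_fun \<phi> \<Longrightarrow> (\<Sum>i\<in>UNIV. \<integral>x. g i x * pd i \<phi> x \<partial>lborel) + lam * (\<integral>x. u x * \<phi> x \<partial>lborel)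
      = (\<integral>x. h x * \<phi> x \<partial>lborel)"
  shows "(\<Sum>i\<in>UNIV. \<integral>x. (g i x)\<^sup>2 \<partial>lborel) + lam * (\<integral>x. (u x)\<^sup>2 \<partial>lborel) = (\<integral>x. h x * u x \<partial>lborel)"
proof -
  obtain \<phi> where \<phi>: "\<And>n. test_fun (\<phi> n)" and l: "L2lim \<phi> u" "\<And>i. L2lim (\<lambda>n. pd i (\<phi> n)) (g i)"
    using test_fun_dense_H1[OF u g w] by blast
  have "(\<lambda>n. (\<Sum>i\<in>UNIV. \<integral>x. g i x * pd i (\<phi> n) x \<partial>lborel) + lam * (\<integral>x. u x * \<phi> n x \<partial>lborel))
    \<longlonglongrightarrow> (\<Sum>i\<in>UNIV. \<integral>x. g i x * g i x \<partial>lborel) + lam * (\<integral>x. u x * u x \<partial>lborel)"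
    by (intro tendsto_add tendsto_sum tendsto_mult[of "\<lambda>_. lam"] tendsto_const L2lim_integral_mult L2lim_const g u l)
  moreover have "(\<lambda>n. \<integral>x. h x * \<phi> n x \<partial>lborel) \<longlonglongrightarrow> (\<integral>x. h x * u x \<partial>lborel)"
    by (intro L2lim_integral_mult L2lim_const h l)
  ultimately show ?thesis
    unfolding eq[OF \<phi>] power2_eq_square by (rule LIMSEQ_unique)
qed

section \<open>The energy of critical points\<close>

text \<open>Near 0 the quotient bound gives f(s) \<le> K s^(p-1) \<le> K s, as p > 2 and s < 1. From
  the radius r up to M, a bound B for \<open>f\<close> is at most (B/r) s.\<close>

lemma linear_bound_near_0:
  fixes f :: "real \<Rightarrow> real"
  assumes c: "continuous_on UNIV f" and "f 0 = 0" and "p > 2"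
    and limsup: "Limsup (at_right 0) (\<lambda>s. ereal (f s / s powr (p - 1))) < \<infinity>"
  obtains C where "C > 0" "\<And>s. 0 \<le> s \<Longrightarrow> s \<le> M \<Longrightarrow> f s \<le> C * s"
proof -
  obtain K where K: "Limsup (at_right 0) (\<lambda>s. ereal (f s / s powr (p - 1))) < ereal (real K)"
    using limsup less_PInf_Ex_of_nat by auto
  have "\<forall>\<^sub>F s in at_right 0. ereal (f s / s powr (p - 1)) < ereal (real K)"
    by (rule Limsup_lessD[OF K])
  then obtain d where "d > 0" and d: "\<And>s. 0 < s \<Longrightarrow> s < d \<Longrightarrow> f s / s powr (p - 1) < real K"
    unfolding eventually_at_right_field by auto
  define r where "r = min d 1 / 2"
  have r: "0 < r" "r < d" "r < 1" using \<open>d > 0\<close> by (auto simp: r_def)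
  have small: "f s \<le> real K * s" if "0 < s" "s \<le> r" for s
  proof -
    have "f s < real K * s powr (p - 1)" using d[of s] that r by (simp add: field_simps)
    also have "s powr (p - 1) \<le> s powr 1" using that r \<open>p > 2\<close> by (intro powr_mono') auto
    finally show ?thesis using that by (simp add: mult_left_mono)
  qed
  have "compact (f ` {0..M})" by (intro compact_continuous_image continuous_on_subset[OF c]) auto
  then have "bounded (f ` {0..M})" by (rule compact_imp_bounded)
  then obtain B where "B > 0" "\<forall>y\<in>f ` {0..M}. norm y \<le> B" unfolding bounded_pos by blast
  then have B: "f s \<le> B" if "0 \<le> s" "s \<le> M" for s
    using that abs_le_D1[of "f s" B] by simp
  show ?thesis
  proof (rule that[of "real K + B / r"])
    show "real K + B / r > 0" using \<open>B > 0\<close> r by (simp add: add_nonneg_pos)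
    fix s assume s: "0 \<le> s" "s \<le> M"
    consider "s = 0" | "0 < s" "s \<le> r" | "r < s" using s by linarith
    then show "f s \<le> (real K + B / r) * s"
    proof cases
      case 2
      have "0 \<le> B / r * s" using \<open>B > 0\<close> r s by simp
      with small[OF 2] show ?thesis by (simp add: distrib_right)
    next
      case 3
      have "f s \<le> B" using B s by simp
      also have "B \<le> B / r * s" using 3 \<open>B > 0\<close> r by (simp add: field_simps)
      also have "\<dots> \<le> (real K + B / r) * s" using s by (simp add: distrib_right)
      finally show ?thesis .
    qed (simp add: \<open>f 0 = 0\<close>)
  qed
qed

text \<open>Below the level \<open>max a s0\<close> the linear bound gives f(u)^2 \<le> C^2 u^2.
  Above it the growth condition gives f(u)^2 \<le> exp(2 beta u^2); squaring doubles the exponent,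
  so exponential integrability is invoked at 2 beta.\<close>

lemma critical_nonlinearity_L2:
  assumes c: "continuous_on UNIV f" and np: "\<And>s. s \<le> 0 \<Longrightarrow> f s = 0" and nn: "\<And>s. f s \<ge> 0"
    and lin: "\<And>M. \<exists>C>0. \<forall>s. 0 \<le> s \<and> s \<le> M \<longrightarrow> f s \<le> C * s"
    and growth: "((\<lambda>s. f s * exp (- \<beta> * s\<^sup>2)) \<longlongrightarrow> 0) at_top" and "\<beta> > 0"
    and u: "L2 u" and g: "\<And>i. L2 (g i)" and w: "\<And>i. weak_pd i u (g i)"
  shows "L2 (\<lambda>x. f (u x))"
proof -
  note [measurable] = L2_measurable[OF u] borel_measurable_continuous_onI[OF c]
  have "\<forall>\<^sub>F s in at_top. f s * exp (- \<beta> * s\<^sup>2) < 1" using growth by (rule order_tendstoD) simp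
  then obtain s0 where s0: "\<And>s. s \<ge> s0 \<Longrightarrow> f s * exp (- \<beta> * s\<^sup>2) < 1"
    unfolding eventually_at_top_linorder by blast
  have big: "f s \<le> exp (\<beta> * s\<^sup>2)" if "s \<ge> s0" for s
    using s0[OF that] by (simp add: exp_minus field_simps)
  have "2 * \<beta> > 0" using \<open>\<beta> > 0\<close> by simp
  from exp_square_integrable[OF u g w this] obtain a where "a > 0"
    and a: "integrable lborel (\<lambda>x. indicator {x. u x \<ge> a} x * exp (2 * \<beta> * (u x)\<^sup>2))" by blast
  obtain C where "C > 0" and C: "\<And>s. 0 \<le> s \<Longrightarrow> s \<le> max a s0 \<Longrightarrow> f s \<le> C * s" using lin by blast
  have "integrable lborel (\<lambda>x. (f (u x))\<^sup>2)"
  proof (rule Bochner_Integration.integrable_bound)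
    show "integrable lborel (\<lambda>x. C\<^sup>2 * (u x)\<^sup>2 + indicator {x. u x \<ge> a} x * exp (2 * \<beta> * (u x)\<^sup>2))"
      by (intro Bochner_Integration.integrable_add integrable_mult_right L2_square_integrable u a)
    have "(f (u x))\<^sup>2 \<le> C\<^sup>2 * (u x)\<^sup>2 + indicator {x. u x \<ge> a} x * exp (2 * \<beta> * (u x)\<^sup>2)" for x
    proof -
      consider "u x \<le> 0" | "0 < u x" "u x \<le> max a s0" | "u x > max a s0" by linarith
      then show ?thesis
      proof cases
        case 2
        then have "(f (u x))\<^sup>2 \<le> (C * u x)\<^sup>2" using C nn by (intro power_mono) auto
        then show ?thesis by (simp add: power_mult_distrib add_increasing2)
      next
        case 3
        then have "(f (u x))\<^sup>2 \<le> (exp (\<beta> * (u x)\<^sup>2))\<^sup>2" using big nn by (intro power_mono) auto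
        also have "\<dots> = exp (2 * \<beta> * (u x)\<^sup>2)" by (simp add: power2_eq_square flip: exp_add)
        finally show ?thesis using 3 by (simp add: add_increasing)
      qed (simp add: np)
    qed
    then show "AE x in lborel. norm ((f (u x))\<^sup>2) \<le> norm (C\<^sup>2 * (u x)\<^sup>2 + indicator {x. u x \<ge> a} x * exp (2 * \<beta> * (u x)\<^sup>2))"
      by (intro AE_I2) (simp add: order_trans[OF _ abs_ge_self])
  qed measurable
  then show ?thesis unfolding L2_def by simp
qed

text \<open>Beyond some M the ratio F/(f s) is below 1/8. On (0, M) the mean value theorem gives
  F(s) = s f(z) with z < s, and the linear bound at z yields C s^2.\<close>

lemma F_le_quadratic_plus:
  assumes c: "continuous_on UNIV f" and np: "\<And>s. s \<le> 0 \<Longrightarrow> f s = 0" and pos: "\<And>s. s > 0 \<Longrightarrow> f s > 0"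
    and lin: "\<And>M. \<exists>C>0. \<forall>s. 0 \<le> s \<and> s \<le> M \<longrightarrow> f s \<le> C * s"
    and f3: "((\<lambda>s. F f s / (f s * s)) \<longlongrightarrow> 0) at_top"
  obtains C where "C > 0" "\<And>s. F f s \<le> C * s\<^sup>2 + f s * s / 8"
proof -
  have "\<forall>\<^sub>F s in at_top. F f s / (f s * s) < 1 / 8" using f3 by (rule order_tendstoD) simp
  then obtain M where M: "\<And>s. s \<ge> M \<Longrightarrow> F f s / (f s * s) < 1 / 8"
    unfolding eventually_at_top_linorder by blast
  obtain C where "C > 0" and C: "\<And>s. 0 \<le> s \<Longrightarrow> s \<le> M \<Longrightarrow> f s \<le> C * s" using lin by blast
  show ?thesis
  proof (rule that[OF \<open>C > 0\<close>])
    fix s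
    consider "s \<le> 0" | "0 < s" "s < M" | "0 < s" "M \<le> s" by linarith
    then show "F f s \<le> C * s\<^sup>2 + f s * s / 8"
    proof cases
      case 1
      then show ?thesis using F_nonpos_arg[OF c np 1] np[OF 1] \<open>C > 0\<close> by simp
    next
      case 2
      obtain z where z: "0 < z" "z < s" "F f s = s * f z" by (rule F_MVT[OF c 2(1)])
      have "f z \<le> C * z" using C z 2 by simp
      also have "\<dots> \<le> C * s" using z \<open>C > 0\<close> by simp
      finally have "F f s \<le> s * (C * s)" unfolding z(3) using 2 by (intro mult_left_mono) auto
      moreover have "0 \<le> f s * s / 8" using pos[of s] 2 by simp
      ultimately show ?thesis by (simp add: power2_eq_square algebra_simps)
    next
      case 3
      have "f s * s > 0" using pos[of s] 3 by simp
      then have "F f s < f s * s / 8" using M[OF 3(2)] by (simp add: field_simps)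
      moreover have "0 \<le> C * s\<^sup>2" using \<open>C > 0\<close> by simp
      ultimately show ?thesis by linarith
    qed
  qed
qed

text \<open>Let D, A, B, N be the integrals of |g|^2, f(u)u, F(u), u^2. Subtracting the two
  identities eliminates \<open>lam\<close> and gives A = D + 2B. Then B \<le> C N + A/8 becomes 3B/4
  \<le> C N + D/8, that is B \<le> D/6 + 4CN/3. Any factor below 1/4 in place of 1/8 would leave a
  positive multiple of D in D/2 - B.\<close>

lemma energy_lower_bound:
  assumes c: "continuous_on UNIV f" and np: "\<And>s. s \<le> 0 \<Longrightarrow> f s = 0" and nn: "\<And>s. f s \<ge> 0"
    and FC: "\<And>s. F f s \<le> C * s\<^sup>2 + f s * s / 8"
    and u: "L2 u" and g: "\<And>i. L2 (g i)" and w: "\<And>i. weak_pd i u (g i)" and fu: "L2 (\<lambda>x. f (u x))"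
    and eq: "\<And>\<phi>. test_fun \<phi> \<Longrightarrow> (\<Sum>i\<in>UNIV. \<integral>x. g i x * pd i \<phi> x \<partial>lborel) + lam * (\<integral>x. u x * \<phi> x \<partial>lborel)
      = (\<integral>x. f (u x) * \<phi> x \<partial>lborel)"
  shows "1/2 * (\<Sum>i\<in>UNIV. \<integral>x. (g i x)\<^sup>2 \<partial>lborel) - (\<integral>x. F f (u x) \<partial>lborel)
    \<ge> (\<Sum>i\<in>UNIV. \<integral>x. (g i x)\<^sup>2 \<partial>lborel) / 3 - 4/3 * C * (\<integral>x. (u x)\<^sup>2 \<partial>lborel)"
proof -
  note [measurable] = L2_measurable[OF u] borel_measurable_continuous_onI[OF F_continuous[OF c]]
  have F0: "F f s \<ge> 0" for s using order_trans[OF F_truncated(2) F_truncated(3)] c np nn by blast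
  have i: "integrable lborel (\<lambda>x. C * (u x)\<^sup>2 + f (u x) * u x / 8)"
    by (intro Bochner_Integration.integrable_add integrable_mult_right integrable_divide L2_square_integrable L2_mult_integrable u fu)
  have Fu: "integrable lborel (\<lambda>x. F f (u x))"
    by (rule Bochner_Integration.integrable_bound[OF i])
       (auto simp: F0 intro!: order_trans[OF FC abs_ge_self])
  have "(\<integral>x. F f (u x) \<partial>lborel) \<le> (\<integral>x. C * (u x)\<^sup>2 + f (u x) * u x / 8 \<partial>lborel)"
    by (intro integral_mono Fu i FC)
  also have "\<dots> = C * (\<integral>x. (u x)\<^sup>2 \<partial>lborel) + (\<integral>x. f (u x) * u x \<partial>lborel) / 8"
    using L2_square_integrable[OF u] L2_mult_integrable[OF fu u] by simp
  finally have "(\<integral>x. F f (u x) \<partial>lborel) \<le> C * (\<integral>x. (u x)\<^sup>2 \<partial>lborel) + (\<integral>x. f (u x) * u x \<partial>lborel) / 8" .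
  with Nehari[OF u g w fu eq] Pohozaev[OF c np nn u g w fu Fu eq]
  show ?thesis by (simp add: mult.assoc)
qed

text \<open>Fubini-type results are only available for Borel functions, hence the passage to Borel representatives.\<close>

lemma lebesgue_transfer:
  fixes a b :: "'a::euclidean_space \<Rightarrow> real"
  assumes [measurable]: "a \<in> borel_measurable lebesgue" "b \<in> borel_measurable borel"
    and ae: "AE x in lborel. a x = b x"
  shows "integral\<^sup>L lebesgue a = integral\<^sup>L lborel b" "integrable lebesgue a \<longleftrightarrow> integrable lborel b"
proof -
  have [measurable]: "b \<in> borel_measurable lebesgue" by (rule measurable_completion) simp
  have ae': "AE x in lebesgue. a x = b x" by (rule AE_completion[OF ae])
  have "integral\<^sup>L lebesgue a = integral\<^sup>L lebesgue b" by (rule integral_cong_AE[OF _ _ ae']) measurable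
  also have "\<dots> = integral\<^sup>L lborel b" by (rule integral_completion) simp
  finally show "integral\<^sup>L lebesgue a = integral\<^sup>L lborel b" .
  have "integrable lebesgue a \<longleftrightarrow> integrable lebesgue b" by (rule integrable_cong_AE[OF _ _ ae']) measurable
  also have "\<dots> \<longleftrightarrow> integrable lborel b" by (rule integrable_completion) simp
  finally show "integrable lebesgue a \<longleftrightarrow> integrable lborel b" .
qed

lemma integral_vec_nth:
  fixes h :: "'a \<Rightarrow> real^'n"
  assumes "\<And>i. integrable M (\<lambda>x. h x $ i)"
  shows "(\<integral>x. h x \<partial>M) $ i = (\<integral>x. h x $ i \<partial>M)"
proof -
  have "h = (\<lambda>x. \<Sum>i\<in>UNIV. (h x $ i) *\<^sub>R axis i 1)"
  proof
    fix x show "h x = (\<Sum>i\<in>UNIV. (h x $ i) *\<^sub>R axis i 1)"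
      using basis_expansion[of "h x"] by (simp add: scalar_mult_eq_scaleR)
  qed
  moreover have "integrable M (\<lambda>x. \<Sum>i\<in>UNIV. (h x $ i) *\<^sub>R (axis i 1 :: real^'n))"
    by (intro Bochner_Integration.integrable_sum integrable_scaleR_left assms)
  ultimately have "integrable M h" by simp
  from integral_bounded_linear[OF bounded_linear_vec_nth this] show ?thesis by simp
qed

text \<open>Borel functions that agree almost everywhere with \<open>v\<close> and with the
  components of \<open>wgrad v\<close> inherit the norms, the weak derivatives and the equation. The
  bound for them is therefore a bound for \<open>I f v\<close>.\<close>

lemma critical_point_energy:
  assumes c: "continuous_on UNIV f" and np: "\<And>s. s \<le> 0 \<Longrightarrow> f s = 0" and nn: "\<And>s. f s \<ge> 0"
    and lin: "\<And>M. \<exists>C>0. \<forall>s. 0 \<le> s \<and> s \<le> M \<longrightarrow> f s \<le> C * s"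
    and growth: "((\<lambda>s. f s * exp (- \<beta> * s\<^sup>2)) \<longlongrightarrow> 0) at_top" "\<beta> > 0"
    and FC: "\<And>s. F f s \<le> C * s\<^sup>2 + f s * s / 8"
    and v: "v \<in> H1" and sol: "weak_solution f lam v"
  shows "sq_norm (wgrad v) / 3 - 4/3 * C * sq_norm v \<le> I f v"
proof -
  have "sq_integrable v" and "\<exists>g. sq_integrable g \<and> is_weak_grad v g" using v by (auto simp: H1_def)
  from someI_ex[OF this(2)] have wg: "sq_integrable (wgrad v)" "is_weak_grad v (wgrad v)"
    by (auto simp: wgrad_def)
  have mv [measurable]: "v \<in> borel_measurable lebesgue" and iv: "integrable lebesgue (\<lambda>x. (v x)\<^sup>2)"
    using \<open>sq_integrable v\<close> by (auto simp: sq_integrable_def)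
  have mw: "wgrad v \<in> borel_measurable lebesgue" and iw: "integrable lebesgue (\<lambda>x. (norm (wgrad v x))\<^sup>2)"
    using wg(1) by (auto simp: sq_integrable_def)
  have [measurable]: "(\<lambda>x. wgrad v x $ i) \<in> borel_measurable lebesgue" for i
    using measurable_compose[OF mw, of "\<lambda>x. x $ i" borel]
    by (auto intro!: borel_measurable_continuous_onI continuous_intros)
  obtain u where u [measurable]: "u \<in> borel_measurable borel" and vu: "AE x in lborel. v x = u x"
    using completion_ex_borel_measurable_real[OF mv] by auto
  have "\<exists>g. g \<in> borel_measurable borel \<and> (AE x in lborel. wgrad v x $ i = g x)" for i
    using completion_ex_borel_measurable_real[of "\<lambda>x. wgrad v x $ i" lborel] by auto
  then obtain g where g [measurable]: "\<And>i. g i \<in> borel_measurable borel"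
    and wg': "\<And>i. AE x in lborel. wgrad v x $ i = g i x" by metis
  have n2: "(norm (x :: real^2))\<^sup>2 = (\<Sum>i\<in>UNIV. (x $ i)\<^sup>2)" for x
    unfolding power2_norm_eq_inner inner_vec_def by (simp add: power2_eq_square)
  have iwi: "integrable lebesgue (\<lambda>x. (wgrad v x $ i)\<^sup>2)" for i
  proof (rule Bochner_Integration.integrable_bound[OF iw])
    show "AE x in lebesgue. norm ((wgrad v x $ i)\<^sup>2) \<le> norm ((norm (wgrad v x))\<^sup>2)"
    proof (intro AE_I2)
      fix x
      have "\<bar>wgrad v x $ i\<bar>\<^sup>2 \<le> (norm (wgrad v x))\<^sup>2"
        by (intro power_mono component_le_norm_cart) simp
      then show "norm ((wgrad v x $ i)\<^sup>2) \<le> norm ((norm (wgrad v x))\<^sup>2)" by simp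
    qed
  qed measurable
  have "AE x in lborel. (v x)\<^sup>2 = (u x)\<^sup>2" using vu by eventually_elim simp
  from lebesgue_transfer[OF _ _ this] iv
  have tr2: "(\<integral>x. (v x)\<^sup>2 \<partial>lebesgue) = (\<integral>x. (u x)\<^sup>2 \<partial>lborel)" "integrable lborel (\<lambda>x. (u x)\<^sup>2)"
    by simp_all
  have trg: "(\<integral>x. (wgrad v x $ i)\<^sup>2 \<partial>lebesgue) = (\<integral>x. (g i x)\<^sup>2 \<partial>lborel)" "integrable lborel (\<lambda>x. (g i x)\<^sup>2)" for i
  proof -
    have "AE x in lborel. (wgrad v x $ i)\<^sup>2 = (g i x)\<^sup>2" using wg'[of i] by eventually_elim simp
    from lebesgue_transfer[OF _ _ this] iwi[of i]
    show "(\<integral>x. (wgrad v x $ i)\<^sup>2 \<partial>lebesgue) = (\<integral>x. (g i x)\<^sup>2 \<partial>lborel)" "integrable lborel (\<lambda>x. (g i x)\<^sup>2)"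
      by simp_all
  qed
  have Lu: "L2 u" and Lg: "L2 (g i)" for i using tr2 trg u g by (auto simp: L2_def)
  have sqv: "sq_norm v = (\<integral>x. (u x)\<^sup>2 \<partial>lborel)" using tr2 by (simp add: sq_norm_def)
  have sqg: "sq_norm (wgrad v) = (\<Sum>i\<in>UNIV. \<integral>x. (g i x)\<^sup>2 \<partial>lborel)"
    using iwi by (simp add: sq_norm_def n2 trg)
  have tru: "(\<integral>x. v x * \<psi> x \<partial>lebesgue) = (\<integral>x. u x * \<psi> x \<partial>lborel)" "integrable lebesgue (\<lambda>x. v x * \<psi> x)"
    if "test_fun \<psi>" for \<psi>
  proof -
    have [measurable]: "\<psi> \<in> borel_measurable borel" by (rule test_fun_measurable[OF that])
    have [measurable]: "\<psi> \<in> borel_measurable lebesgue" by (rule measurable_completion) simp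
    have "AE x in lborel. v x * \<psi> x = u x * \<psi> x" using vu by eventually_elim simp
    from lebesgue_transfer[OF _ _ this] L2_mult_integrable[OF Lu test_fun_L2[OF that]]
    show "(\<integral>x. v x * \<psi> x \<partial>lebesgue) = (\<integral>x. u x * \<psi> x \<partial>lborel)" "integrable lebesgue (\<lambda>x. v x * \<psi> x)"
      by simp_all
  qed
  have trw: "(\<integral>x. wgrad v x $ i * \<psi> x \<partial>lebesgue) = (\<integral>x. g i x * \<psi> x \<partial>lborel)" "integrable lebesgue (\<lambda>x. wgrad v x $ i * \<psi> x)"
    if "test_fun \<psi>" for \<psi> i
  proof -
    have [measurable]: "\<psi> \<in> borel_measurable borel" by (rule test_fun_measurable[OF that])
    have [measurable]: "\<psi> \<in> borel_measurable lebesgue" by (rule measurable_completion) simp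
    have "AE x in lborel. wgrad v x $ i * \<psi> x = g i x * \<psi> x" using wg'[of i] by eventually_elim simp
    from lebesgue_transfer[OF _ _ this] L2_mult_integrable[OF Lg[of i] test_fun_L2[OF that]]
    show "(\<integral>x. wgrad v x $ i * \<psi> x \<partial>lebesgue) = (\<integral>x. g i x * \<psi> x \<partial>lborel)" "integrable lebesgue (\<lambda>x. wgrad v x $ i * \<psi> x)"
      by simp_all
  qed
  have weak: "weak_pd i u (g i)" for i
    unfolding weak_pd_def
  proof (intro allI impI)
    fix \<phi> assume \<phi>: "test_fun \<phi>"
    \<comment> \<open>Taking a component commutes with the vector-valued integral because every
      component is integrable; this reduces \<open>is_weak_grad\<close> to scalar
      identities.\<close>
    have 1: "(\<integral>x. v x *\<^sub>R grad \<phi> x \<partial>lebesgue) $ i = (\<integral>x. v x * pd i \<phi> x \<partial>lebesgue)"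
      using integral_vec_nth[of lebesgue "\<lambda>x. v x *\<^sub>R grad \<phi> x" i] tru(2)[OF test_fun_pd[OF \<phi>]]
      by (simp add: pd_def)
    have 2: "(\<integral>x. \<phi> x *\<^sub>R wgrad v x \<partial>lebesgue) $ i = (\<integral>x. wgrad v x $ i * \<phi> x \<partial>lebesgue)"
      using integral_vec_nth[of lebesgue "\<lambda>x. \<phi> x *\<^sub>R wgrad v x" i] trw(2)[OF \<phi>]
      by (simp add: mult.commute)
    have "(\<integral>x. v x *\<^sub>R grad \<phi> x \<partial>lebesgue) = - (\<integral>x. \<phi> x *\<^sub>R wgrad v x \<partial>lebesgue)"
      using wg(2) \<phi> by (simp add: is_weak_grad_def)
    then have "(\<integral>x. v x *\<^sub>R grad \<phi> x \<partial>lebesgue) $ i = - ((\<integral>x. \<phi> x *\<^sub>R wgrad v x \<partial>lebesgue) $ i)"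
      by simp
    then show "(\<integral>x. u x * pd i \<phi> x \<partial>lborel) = - (\<integral>x. \<phi> x * g i x \<partial>lborel)"
      unfolding 1 2 tru(1)[OF test_fun_pd[OF \<phi>]] trw(1)[OF \<phi>] by (simp add: mult.commute)
  qed
  have fb [measurable]: "f \<in> borel_measurable borel" by (rule borel_measurable_continuous_onI[OF c])
  have Fb [measurable]: "F f \<in> borel_measurable borel" by (rule borel_measurable_continuous_onI[OF F_continuous[OF c]])
  have Lf: "L2 (\<lambda>x. f (u x))"
    by (rule critical_nonlinearity_L2[OF c np nn lin growth Lu Lg weak])
  have eq: "(\<Sum>i\<in>UNIV. \<integral>x. g i x * pd i \<phi> x \<partial>lborel) + lam * (\<integral>x. u x * \<phi> x \<partial>lborel)
      = (\<integral>x. f (u x) * \<phi> x \<partial>lborel)" if \<phi>: "test_fun \<phi>" for \<phi>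
  proof -
    have [measurable]: "\<phi> \<in> borel_measurable borel" by (rule test_fun_measurable[OF \<phi>])
    have [measurable]: "\<phi> \<in> borel_measurable lebesgue" by (rule measurable_completion) simp
    have "(\<integral>x. wgrad v x \<bullet> grad \<phi> x \<partial>lebesgue) = (\<integral>x. (\<Sum>i\<in>UNIV. wgrad v x $ i * pd i \<phi> x) \<partial>lebesgue)"
      by (simp add: inner_vec_def pd_def)
    also have "\<dots> = (\<Sum>i\<in>UNIV. \<integral>x. g i x * pd i \<phi> x \<partial>lborel)"
      using trw[OF test_fun_pd[OF \<phi>]] by simp
    finally have 1: "(\<integral>x. wgrad v x \<bullet> grad \<phi> x \<partial>lebesgue) = (\<Sum>i\<in>UNIV. \<integral>x. g i x * pd i \<phi> x \<partial>lborel)" .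
    have "AE x in lborel. f (v x) * \<phi> x = f (u x) * \<phi> x" using vu by eventually_elim simp
    then have 2: "(\<integral>x. f (v x) * \<phi> x \<partial>lebesgue) = (\<integral>x. f (u x) * \<phi> x \<partial>lborel)"
      by (intro lebesgue_transfer) measurable
    show ?thesis
      using sol \<phi> unfolding weak_solution_def 1[symmetric] 2[symmetric] tru(1)[OF \<phi>, symmetric] by blast
  qed
  have "AE x in lborel. F f (v x) = F f (u x)" using vu by eventually_elim simp
  then have "(\<integral>x. F f (v x) \<partial>lebesgue) = (\<integral>x. F f (u x) \<partial>lborel)"
    by (intro lebesgue_transfer) measurable
  then have "I f v = 1/2 * (\<Sum>i\<in>UNIV. \<integral>x. (g i x)\<^sup>2 \<partial>lborel) - (\<integral>x. F f (u x) \<partial>lborel)"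
    by (simp add: I_def sqg)
  with energy_lower_bound[OF c np nn FC Lu Lg weak Lf eq] show ?thesis
    by (simp add: sqg sqv)
qed

theorem theorem1p2:
  fixes f :: "real \<Rightarrow> real" and \<alpha>\<^sub>0 c\<^sub>0 \<rho> \<tau>\<^sub>0 :: real
  assumes f_cont: "continuous_on UNIV f"
    and f_nonpos: "\<And>s. s \<le> 0 \<Longrightarrow> f s = 0"
    and f1: "f 0 = 0" "\<And>s. s > 0 \<Longrightarrow> f s > 0"
      "\<exists>p. 2 < p \<and> p < 4 \<and>
         0 < Liminf (at_right 0) (\<lambda>s. ereal (f s / s powr (p - 1))) \<and>
         Liminf (at_right 0) (\<lambda>s. ereal (f s / s powr (p - 1)))
           \<le> Limsup (at_right 0) (\<lambda>s. ereal (f s / s powr (p - 1))) \<and>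
         Limsup (at_right 0) (\<lambda>s. ereal (f s / s powr (p - 1))) < \<infinity>"
    and f2: "\<alpha>\<^sub>0 > 0"
      "\<And>\<alpha>. \<alpha> > \<alpha>\<^sub>0 \<Longrightarrow> ((\<lambda>s. f s * exp (- \<alpha> * s\<^sup>2)) \<longlongrightarrow> 0) at_top"
      "\<And>\<alpha>. \<alpha> < \<alpha>\<^sub>0 \<Longrightarrow> filterlim (\<lambda>s. f s * exp (- \<alpha> * s\<^sup>2)) at_top at_top"
    and f3: "((\<lambda>s. F f s / (f s * s)) \<longlongrightarrow> 0) at_top"
    and geom: "local_min_geometry f \<alpha>\<^sub>0 c\<^sub>0 \<rho> \<tau>\<^sub>0"
  shows "\<exists>c\<^sub>1. 0 < c\<^sub>1 \<and> c\<^sub>1 \<le> c\<^sub>0 \<and>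
    (\<forall>c. 0 < c \<and> c < c\<^sub>1 \<longrightarrow>
      (\<forall>u. local_minimizer f \<rho> c u \<longrightarrow> normalized_ground_state f c u))"
proof -
  have nn: "f s \<ge> 0" for s using f_nonpos[of s] f1(2)[of s] by (cases "s \<le> 0") auto
  have lin: "\<exists>C>0. \<forall>s. 0 \<le> s \<and> s \<le> M \<longrightarrow> f s \<le> C * s" for M
  proof -
    from f1(3) obtain p where "p > 2" "Limsup (at_right 0) (\<lambda>s. ereal (f s / s powr (p - 1))) < \<infinity>" by blast
    then obtain C where "C > 0" "\<And>s. 0 \<le> s \<Longrightarrow> s \<le> M \<Longrightarrow> f s \<le> C * s"
      by (rule linear_bound_near_0[OF f_cont f1(1), where M = M]) blast
    then show ?thesis by (intro exI[of _ C]) simp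
  qed
  obtain C where "C > 0" and C: "\<And>s. F f s \<le> C * s\<^sup>2 + f s * s / 8"
    by (rule F_le_quadratic_plus[OF f_cont f_nonpos f1(2) lin f3]; (assumption | rule that))
  have "c\<^sub>0 > 0" "\<rho> > 0" and mneg: "\<And>c. 0 < c \<Longrightarrow> c < c\<^sub>0 \<Longrightarrow> m f \<rho> c < 0"
    using geom by (auto simp: local_min_geometry_def)
  \<comment> \<open>Chosen so that 4C c^2/3 \<le> \<rho>/3, the least value of D/3 for a critical
    point outside \<open>V \<rho> c\<close>.\<close>
  define c\<^sub>1 where "c\<^sub>1 = min c\<^sub>0 (sqrt (\<rho> / (4 * C)))"
  show ?thesis
  proof (intro exI[of _ c\<^sub>1] conjI allI impI)
    show "0 < c\<^sub>1" "c\<^sub>1 \<le> c\<^sub>0" using \<open>c\<^sub>0 > 0\<close> \<open>\<rho> > 0\<close> \<open>C > 0\<close> by (auto simp: c\<^sub>1_def)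
    fix c u assume c: "0 < c \<and> c < c\<^sub>1" and u: "local_minimizer f \<rho> c u"
    then have uS: "u \<in> S c" and Iu: "ereal (I f u) = m f \<rho> c" and "\<exists>lam. weak_solution f lam u"
      by (auto simp: local_minimizer_def V_def)
    have "c\<^sup>2 \<le> (sqrt (\<rho> / (4 * C)))\<^sup>2" using c by (intro power_mono) (auto simp: c\<^sub>1_def)
    then have "c\<^sup>2 \<le> \<rho> / (4 * C)" using \<open>\<rho> > 0\<close> \<open>C > 0\<close> by simp
    then have small: "4/3 * C * c\<^sup>2 \<le> \<rho> / 3" using \<open>C > 0\<close> by (simp add: field_simps)
    have "m f \<rho> c < 0" using c by (intro mneg) (auto simp: c\<^sub>1_def)
    then have neg: "I f u < 0" unfolding Iu[symmetric] by simp
    show "normalized_ground_state f c u"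
      unfolding normalized_ground_state_def
    proof (intro conjI allI impI)
      show "constrained_critical f c u"
        using uS \<open>\<exists>lam. weak_solution f lam u\<close> by (simp add: constrained_critical_def)
      fix v assume "constrained_critical f c v"
      then obtain lam where vS: "v \<in> S c" and sol: "weak_solution f lam v"
        by (auto simp: constrained_critical_def)
      show "I f u \<le> I f v"
      proof (cases "sq_norm (wgrad v) < \<rho>")
        case True
        then have "v \<in> V \<rho> c" using vS by (simp add: V_def)
        then have "m f \<rho> c \<le> ereal (I f v)" unfolding m_def by (rule INF_lower)
        then show ?thesis by (simp flip: Iu)
      next
        case False
        have "v \<in> H1" "sq_norm v = c\<^sup>2" using vS by (auto simp: S_def)
        \<comment> \<open>Any exponent above the critical one serves as the beta of the growth
          condition.\<close>
        have "\<alpha>\<^sub>0 + 1 > \<alpha>\<^sub>0" "\<alpha>\<^sub>0 + 1 > 0" using f2(1) by auto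
        from critical_point_energy[OF f_cont f_nonpos nn lin f2(2)[OF this(1)] this(2) C \<open>v \<in> H1\<close> sol]
        have "sq_norm (wgrad v) / 3 - 4/3 * C * c\<^sup>2 \<le> I f v" using \<open>sq_norm v = c\<^sup>2\<close> by simp
        with False small have "0 \<le> I f v" by linarith
        with neg show ?thesis by linarith
      qed
    qed
  qed
qed

end
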